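(* Let $i\ge 2$ be an integer and let $M$ be a linear bounded automaton with running time $T_M$ such that $B\le T_M(B)$ for all tape sizes $B$, and $T_M(B_1)\ge T_M(B_2)$ for any two tape sizes $B_1\ge B_2$. For each $n$, let $B=B(n)$ be the smallest positive integer satisfying $n\le B^{i-1}\cdot T_M(B)$. Let $\Pi_M^i$ be the specific LCL problem constructed from $M$ and $i$ in the context. Then $\Pi_M^i$ has (deterministic LOCAL) time complexity $\Theta(n/B^{i-1})=\Theta(T_M(B))$. The upper and lower bounds are the following: (1) $\Pi_M^i$ can be solved in $O(T_M(B))$ rounds; (2) $\Pi_M^i$ cannot be solved in $o(T_M(B))$ rounds.
   Context: **Graphs and model.** Input graphs $G=(V,E)$ are simple, connected, undirected, with $n=|V|$ nodes and maximum degree at most a known constant $\Delta=O(1)$, where $\Delta\ge 2i$. In the LOCAL model every node runs the same deterministic algorithm. Nodes have unique $O(\log n)$-bit identifiers, and each node initially knows its identifier, its degree, $n$, and its own input. In each synchronous round a node sends messages (of unbounded size) to its neighbours, receives messages from them, and performs arbitrary computation. Time is the number of rounds until all nodes have stopped and produced their local outputs. **LCL problems.** An LCL is a tuple $(\Sigma_{\mathrm{in}},\Sigma_{\mathrm{out}},C,\rho)$ with constant-size label sets, a constant radius $\rho$, and a set $C$ of input- and output-labelled graphs centred at a node and of radius at most $\rho$. Given $G$ with an input labelling, an output labelling is valid if for every node $v$ the labelled subgraph induced by the nodes at distance at most $\rho$ from $v$ is in $C$. Equivalently, validity is given by constraints that each node checks in its constant-radius neighbourhood, independently of identifiers and $n$.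 Labels on edge endpoints, or several labels per node, are encoded as a single label per node. The time complexity is the pointwise smallest $t(n)$ such that some deterministic LOCAL algorithm solves the problem in $t(n)$ rounds on all $n$-node graphs of the family, for all $n$ and all input labellings. **Linear bounded automaton.** $M=(Q,q_0,f,\Gamma,\delta)$, where $Q$ is a finite set of states, $q_0\in Q$ is the initial state, $f\in Q$ is the final state, $\Gamma$ is a finite tape alphabet containing a blank $b$ and markers $L$ and $R$, and $\delta\colon (Q\setminus\{f\})\times\Gamma\to Q\times\Gamma\times\{-,\leftarrow,\rightarrow\}$. On a tape of $B$ cells, the first cell contains $L$, the last contains $R$, all others contain $b$; the head starts on the cell with $L$, in state $q_0$. If $\delta(s_0,t_0)=(s_1,t_1,d)$ for current state $s_0$ and symbol $t_0$ under the head, then $M$ enters state $s_1$, writes $t_1$, and moves the head one cell towards $R$ ($\rightarrow$), one cell towards $L$ ($\leftarrow$), or not at all ($-$). The head is never moved beyond the boundaries, and $L,R$ are never overwritten. $M$ terminates when $\delta$ is not defined on the current state and symbol. $T_M(B)$ is the running time of $M$ on a tape of size $B$; $M$ is assumed to terminate on every tape size. **Input labels of $\Pi_M^i$.** Each edge $e=\{u,v\}$ carries two input labels $L_u(e),L_v(e)$, one per endpoint, from the set $\{(\mathsf{Prev},j),(\mathsf{Next},j): 1\le j\le i\}$. An edge $e$ incident to $v$ is said to be labelled $\ell$ (at $v$) if $L_v(e)=\ell$. For a node $v$ and labels $L_1,\dots,L_p$, let $z_v(L_1,\dots,L_p)$ be the node reached from $v$ by successively following the edges with labels $L_1,\dots,L_p$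 (each read at the node currently reached); it is undefined if at some point there are $0$ or at least $2$ edges with the required label. An origin is a node with no incident edge labelled $(\mathsf{Prev},j)$ for any $j$. **Grid constraints** at a node $v$: - Each incident edge $e$ has exactly one $v$-sided label $L_v(e)$, and it is in $\{(\mathsf{Prev},j),(\mathsf{Next},j)\}$ for some $1\le j\le i$; any two incident edges have different $v$-sided labels; for each $1\le j\le i$ at least one incident edge has $v$-sided label in $\{(\mathsf{Prev},j),(\mathsf{Next},j)\}$. - For each incident edge $e=\{v,u\}$: $L_u(e)=(\mathsf{Prev},j)$ if $L_v(e)=(\mathsf{Next},j)$, and $L_u(e)=(\mathsf{Next},j)$ if $L_v(e)=(\mathsf{Prev},j)$. - If $j\ne k$, and $e=\{v,u\}$, $e'=\{v,u'\}$ satisfy $L_v(e)\in\{(\mathsf{Prev},j),(\mathsf{Next},j)\}$ and $L_v(e')\in\{(\mathsf{Prev},k),(\mathsf{Next},k)\}$, then $u$ has an incident edge $e''$ with $L_u(e'')=L_v(e')$, $u'$ has an incident edge $e'''$ with $L_{u'}(e''')=L_v(e)$, and the other endpoints of $e''$ and $e'''$ coincide: $z_u(L_u(e''))=z_{u'}(L_{u'}(e'''))$. A neighbourhood has a valid grid structure if the grid constraints hold there. **Output labels of $\Pi_M^i$.** - Encoding labels $\mathcal L^{\mathrm{enc}}$: $\mathsf{Tape}(t)$ for $t\in\Gamma$, $\mathsf{State}(q)$ for $q\in Q$, $\mathsf{Head}$, $\mathsf{Dimension}(k)$ for $2\le k\le i$, and $\mathsf{Exempt_M}$. - Unbalance labels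 $\mathcal L^{\mathrm{unb}}=\{\mathsf{Unbalanced},\mathsf{Exempt_U}\}$. - Error labels $\mathcal L^{\mathrm{err}}$: $\mathsf{Error}$, and error pointers $(s,r)$ with $s\in\{(\mathsf{Prev},j),(\mathsf{Next},j):1\le j\le i\}$ and type $r\in\{0,1\}$. **Encoding constraints** at a node $v$: - (LC1) $v$ is labelled with either $\mathsf{Exempt_M}$ or $\mathsf{Dimension}(k)$ for exactly one $2\le k\le i$. In the former case $v$ has no other labels; in the latter case $v$ additionally has some $\mathsf{Tape}$ label and some $\mathsf{State}$ label, and potentially $\mathsf{Head}$, but no other labels. - (LC2) If $v$ is the origin, it has label $\mathsf{Dimension}(k)$ for some $2\le k\le i$. - (LC3) If $v$ is labelled $\mathsf{Dimension}(k)$ and has an incident edge labelled $(\mathsf{Prev},j)$, then $j=1$ or $j=k$. Moreover, if $v$ is labelled $\mathsf{Dimension}(k)$, then $z_v((\mathsf{Prev},1))$, $z_v((\mathsf{Prev},k))$, $z_v((\mathsf{Next},k))$ (when defined) are labelled $\mathsf{Dimension}(k)$. - (LC4) Suppose $v$ is labelled $\mathsf{Dimension}(k)$. If $v$ has no incident edge labelled $(\mathsf{Prev},1)$, then: (a) if $v$ has no incident edge labelled $(\mathsf{Prev},k)$, it has labels $\mathsf{Head}$ and $\mathsf{Tape}(L)$; (b) if $v$ has no incident edge labelled $(\mathsf{Next},k)$, it has label $\mathsf{Tape}(R)$; (c) if $v$ has both an incident edge labelled $(\mathsf{Prev},k)$ and one labelled $(\mathsf{Next},k)$, it has label $\mathsf{Tape}(b)$;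 (d) $v$ has label $\mathsf{State}(q_0)$; (e) if $q_0\ne f$, then $z_v((\mathsf{Next},1))$ (if defined) is labelled $\mathsf{Dimension}(k)$. If $v$ has an incident edge labelled $(\mathsf{Prev},1)$, $v$ has labels $\mathsf{State}(q),\mathsf{Tape}(t)$, and $z_v((\mathsf{Prev},1))$ has labels $\mathsf{State}(q'),\mathsf{Tape}(t')$, then: (f) $q'\ne f$; (g) if $z_v((\mathsf{Prev},1))$ is labelled $\mathsf{Head}$, then $q$ and $t$ are derived from $q'$ and $t'$ according to the specification of $M$, and the new position of the head is on $v$, on $z_v((\mathsf{Prev},k))$, or on $z_v((\mathsf{Next},k))$, depending on $M$; (h) otherwise $t=t'$, and $z_v((\mathsf{Prev},k))$ and $z_v((\mathsf{Next},k))$ (if defined) are labelled $\mathsf{State}(q)$; (i) if $q\ne f$, then $z_v((\mathsf{Next},1))$ (if defined) is labelled $\mathsf{Dimension}(k)$. **Unbalance constraints.** Write $u=z_v((\mathsf{Prev},1),\dots,(\mathsf{Prev},i))$ and $w=z_v((\mathsf{Next},1),\dots,(\mathsf{Next},i))$. A node $v$ labelled $\mathsf{Unbalanced}$ must satisfy one of: (1) $u$ and $w$ both exist and are both labelled $\mathsf{Unbalanced}$; (2) $w$ exists and is labelled $\mathsf{Unbalanced}$, and $v$ has no incident edge labelled $(\mathsf{Prev},j)$ for any $j$; (3) $u$ exists and is labelled $\mathsf{Unbalanced}$, and $v$ has an incident edge labelled $(\mathsf{Next},j)$ for all $2\le j\le i$, but none labelled $(\mathsf{Next},1)$. Moreover,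 the origin must be labelled $\mathsf{Unbalanced}$. **The problem $\Pi_M^i$.** An output labelling is correct if: 1. Each node produces at least one output label; if it produces at least two, all of them are in $\mathcal L^{\mathrm{enc}}\setminus\{\mathsf{Exempt_M}\}$. 2. Each node at which the grid constraints are violated outputs $\mathsf{Error}$; no other node outputs $\mathsf{Error}$. 3. A node that outputs $\mathsf{Exempt_U}$ or $\mathsf{Exempt_M}$ has at least one incident edge labelled $(\mathsf{Prev},j)$ for some $j\in\{1,\dots,i\}$. 4. If the output labels of $v$ are in $\mathcal L^{\mathrm{enc}}\setminus\{\mathsf{Exempt_M}\}$, then either some node in $v$'s $2$-radius neighbourhood outputs a label from $\mathcal L^{\mathrm{err}}$, or the output labels of all nodes in $v$'s $2$-radius neighbourhood are in $\mathcal L^{\mathrm{enc}}$; in the latter case, moreover, $v$'s $2$-radius neighbourhood has a valid grid structure and the encoding constraints are satisfied at $v$. 5. If $v$ outputs $\mathsf{Unbalanced}$, then either some node in $v$'s $i$-radius neighbourhood outputs a label from $\mathcal L^{\mathrm{err}}$, or the output labels of all nodes in $v$'s $i$-radius neighbourhood are in $\mathcal L^{\mathrm{unb}}$; in the latter case, moreover, $v$'s $i$-radius neighbourhood has a valid grid structure and the unbalance constraints are satisfied at $v$. 6. If $v$ outputs an error pointer $(s,r)$, then $u=z_v(s)$ is defined, and $u$ outputs either $\mathsf{Error}$ or an error pointer $(s',r')$ such that: $r'\ge r$; if $r'=r=0$ then $s'=s$; if $r'=r=1$, $s\in\{(\mathsf{Prev},j),(\mathsf{Next},j)\}$ and $s'\in\{(\mathsf{Prev},j'),(\mathsf{Next},j')\}$,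 then $j'\ge j$; and if $r'=r=1$ and $s,s'\in\{(\mathsf{Prev},j),(\mathsf{Next},j)\}$ for the same $j$, then $s'=s$.
   Formalization: The encoding constraints also require that Head occurs only where the head starts or M moves it; otherwise extra Head labels make the problem O(1) for some M. Theta is read as O(g) and not o(g), as in (1) and (2), since pointwise Theta fails when T_M jumps. Tape sizes are at least 2. *)

theory Defs
  imports Complex_Main "HOL-Library.Landau_Symbols"
begin

section \<open>Graphs and the deterministic LOCAL model\<close>

text \<open>A simple graph is given by its nodes (natural numbers, which the algorithms never see) and
  a symmetric irreflexive adjacency relation.\<close>

type_synonym adjacency = "(nat \<times> nat) set"

definition simple_connected_graph :: "nat set \<Rightarrow> adjacency \<Rightarrow> bool" where
  "simple_connected_graph V E \<longleftrightarrow>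
     finite V \<and> V \<noteq> {} \<and> E \<subseteq> V \<times> V \<and> sym E \<and> irrefl E \<and>
     (\<forall>u\<in>V. \<forall>v\<in>V. (u, v) \<in> E\<^sup>*)"

definition degree :: "adjacency \<Rightarrow> nat \<Rightarrow> nat" where
  "degree E v = card (E `` {v})"

definition nbhd :: "adjacency \<Rightarrow> nat \<Rightarrow> nat \<Rightarrow> nat set" where
  "nbhd E r v = {u. \<exists>d\<le>r. (v, u) \<in> E ^^ d}"

text \<open>\<open>label N v u\<close> is the label $L_v(e)$ of the edge $e = \{v,u\}$ at the endpoint \<open>v\<close>.
  \<open>port N v p\<close> is the neighbour of \<open>v\<close> behind its port \<open>p < degree E v\<close>; the port numbering is
  arbitrary and merely lets a node refer to its incident edges.\<close>

record 'i network =
  nodes :: "nat set"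
  edges :: adjacency
  ident :: "nat \<Rightarrow> nat"
  port :: "nat \<Rightarrow> nat \<Rightarrow> nat"
  label :: "nat \<Rightarrow> nat \<Rightarrow> 'i"

text \<open>Identifiers of $O(\log n)$ bits are elements of $\{1,\dots,n^c\}$ for a constant \<open>c\<close>.\<close>

definition is_network :: "nat \<Rightarrow> nat \<Rightarrow> 'i set \<Rightarrow> nat \<Rightarrow> 'i network \<Rightarrow> bool" where
  "is_network \<Delta> c \<Sigma> n N \<longleftrightarrow>
     simple_connected_graph (nodes N) (edges N) \<and>
     card (nodes N) = n \<and>
     (\<forall>v\<in>nodes N. degree (edges N) v \<le> \<Delta>) \<and>
     inj_on (ident N) (nodes N) \<and>
     (\<forall>v\<in>nodes N. ident N v \<in> {1..n ^ c}) \<and>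
     (\<forall>v\<in>nodes N. bij_betw (port N v) {..<degree (edges N) v} (edges N `` {v})) \<and>
     (\<forall>(v, u)\<in>edges N. label N v u \<in> \<Sigma>)"

text \<open>States and messages are natural numbers.  This is no restriction: up to isomorphism there
  are only countably many networks with labels from a finite set, so an algorithm uses only
  countably many states and messages.  There is no computability requirement.
  \<open>initial n x d ls\<close> is the initial state of a node with identifier \<open>x\<close>, degree \<open>d\<close> and endpoint
  labels \<open>ls\<close> (in port order) in an \<open>n\<close>-node graph.  \<open>send s p\<close> is the message sent to port \<open>p\<close>,
  \<open>receive s ms\<close> the new state when \<open>ms\<close> are the messages received, in port order.
  A node has stopped, with output \<open>x\<close>, when \<open>decision s = Some x\<close>.\<close>

record ('i, 'o) algorithm =
  initial :: "nat \<Rightarrow> nat \<Rightarrow> nat \<Rightarrow> 'i list \<Rightarrow> nat"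
  send :: "nat \<Rightarrow> nat \<Rightarrow> nat"
  receive :: "nat \<Rightarrow> nat list \<Rightarrow> nat"
  decision :: "nat \<Rightarrow> 'o option"

definition initial_state :: "('i, 'o) algorithm \<Rightarrow> 'i network \<Rightarrow> nat \<Rightarrow> nat" where
  "initial_state A N v =
     initial A (card (nodes N)) (ident N v) (degree (edges N) v)
       (map (\<lambda>p. label N v (port N v p)) [0..<degree (edges N) v])"

definition port_to :: "'i network \<Rightarrow> nat \<Rightarrow> nat \<Rightarrow> nat" where
  "port_to N u v = (THE p. p < degree (edges N) u \<and> port N u p = v)"

definition round_step ::
  "('i, 'o) algorithm \<Rightarrow> 'i network \<Rightarrow> (nat \<Rightarrow> nat) \<Rightarrow> nat \<Rightarrow> nat" where
  "round_step A N st v =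
     (if decision A (st v) \<noteq> None then st v
      else receive A (st v)
        (map (\<lambda>p. let u = port N v p in send A (st u) (port_to N u v))
          [0..<degree (edges N) v]))"

definition state_after :: "('i, 'o) algorithm \<Rightarrow> 'i network \<Rightarrow> nat \<Rightarrow> nat \<Rightarrow> nat" where
  "state_after A N t = (round_step A N ^^ t) (initial_state A N)"

text \<open>A graph problem with labels on edge endpoints as input: the input alphabet, and the
  relation saying which output labellings are correct.\<close>

record ('i, 'o) problem =
  in_labels :: "'i set"
  correct :: "nat set \<Rightarrow> adjacency \<Rightarrow> (nat \<Rightarrow> nat \<Rightarrow> 'i) \<Rightarrow> (nat \<Rightarrow> 'o) \<Rightarrow> bool"

definition solves ::
  "nat \<Rightarrow> nat \<Rightarrow> ('i, 'o) problem \<Rightarrow> ('i, 'o) algorithm \<Rightarrow> (nat \<Rightarrow> nat) \<Rightarrow> bool" where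
  "solves \<Delta> c P A t \<longleftrightarrow>
     (\<forall>n N. is_network \<Delta> c (in_labels P) n N \<longrightarrow>
        (\<forall>v\<in>nodes N. decision A (state_after A N (t n) v) \<noteq> None) \<and>
        correct P (nodes N) (edges N) (label N)
          (\<lambda>v. the (decision A (state_after A N (t n) v))))"

definition solvable_in :: "nat \<Rightarrow> nat \<Rightarrow> ('i, 'o) problem \<Rightarrow> (nat \<Rightarrow> nat) \<Rightarrow> bool" where
  "solvable_in \<Delta> c P t \<longleftrightarrow> (\<exists>A. solves \<Delta> c P A t)"

definition is_time_complexity :: "nat \<Rightarrow> nat \<Rightarrow> ('i, 'o) problem \<Rightarrow> (nat \<Rightarrow> nat) \<Rightarrow> bool" where
  "is_time_complexity \<Delta> c P \<tau> \<longleftrightarrow>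
     solvable_in \<Delta> c P \<tau> \<and> (\<forall>t. solvable_in \<Delta> c P t \<longrightarrow> (\<forall>n. \<tau> n \<le> t n))"


section \<open>Linear bounded automata\<close>

datatype move = Stay | Leftward | Rightward

text \<open>The values of \<open>delta\<close> in the state \<open>final\<close> are never used.\<close>

record ('q, 'g) lba =
  start :: 'q
  final :: 'q
  blank :: 'g
  left_marker :: 'g
  right_marker :: 'g
  delta :: "'q \<Rightarrow> 'g \<Rightarrow> 'q \<times> 'g \<times> move"

type_synonym ('q, 'g) config = "'q \<times> (nat \<Rightarrow> 'g) \<times> nat"

fun move_head :: "move \<Rightarrow> nat \<Rightarrow> nat" where
  "move_head Stay h = h"
| "move_head Leftward h = h - 1"
| "move_head Rightward h = h + 1"

fun lba_step :: "('q, 'g) lba \<Rightarrow> ('q, 'g) config \<Rightarrow> ('q, 'g) config" where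
  "lba_step M (q, tape, h) =
     (if q = final M then (q, tape, h)
      else case delta M q (tape h) of (q', g, d) \<Rightarrow> (q', tape(h := g), move_head d h))"

definition initial_config :: "('q, 'g) lba \<Rightarrow> nat \<Rightarrow> ('q, 'g) config" where
  "initial_config M B =
     (start M,
      \<lambda>p. if p = 0 then left_marker M else if p = B - 1 then right_marker M else blank M,
      0)"

definition lba_run :: "('q, 'g) lba \<Rightarrow> nat \<Rightarrow> nat \<Rightarrow> ('q, 'g) config" where
  "lba_run M B t = (lba_step M ^^ t) (initial_config M B)"

text \<open>A tape has at least two cells, since the first one contains \<open>left_marker\<close> and the last one
  \<open>right_marker\<close>.\<close>

definition is_lba :: "('q, 'g) lba \<Rightarrow> bool" where
  "is_lba M \<longleftrightarrow>
     distinct [blank M, left_marker M, right_marker M] \<and>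
     (\<forall>B\<ge>2. \<forall>t q tape h q' g d.
        lba_run M B t = (q, tape, h) \<and> q \<noteq> final M \<and> delta M q (tape h) = (q', g, d) \<longrightarrow>
          (h = 0 \<longrightarrow> d \<noteq> Leftward) \<and> (h = B - 1 \<longrightarrow> d \<noteq> Rightward) \<and>
          (h = 0 \<or> h = B - 1 \<longrightarrow> g = tape h)) \<and>
     (\<forall>B\<ge>2. \<exists>t. fst (lba_run M B t) = final M)"

definition running_time :: "('q, 'g) lba \<Rightarrow> nat \<Rightarrow> nat" where
  "running_time M B = (LEAST t. fst (lba_run M B t) = final M)"

definition tape_size :: "('q, 'g) lba \<Rightarrow> nat \<Rightarrow> nat \<Rightarrow> nat" where
  "tape_size M i n = (LEAST B. 2 \<le> B \<and> n \<le> B ^ (i - 1) * running_time M B)"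


section \<open>Grid structure\<close>

datatype side = Prev (axis_of: nat) | Next (axis_of: nat)

definition sides :: "nat \<Rightarrow> side set" where
  "sides i = Prev ` {1..i} \<union> Next ` {1..i}"

fun opposite :: "side \<Rightarrow> side" where
  "opposite (Prev j) = Next j"
| "opposite (Next j) = Prev j"

type_synonym labelling = "nat \<Rightarrow> nat \<Rightarrow> side"

definition has_edge :: "adjacency \<Rightarrow> labelling \<Rightarrow> nat \<Rightarrow> side \<Rightarrow> bool" where
  "has_edge E L v s \<longleftrightarrow> (\<exists>u. (v, u) \<in> E \<and> L v u = s)"

fun z :: "adjacency \<Rightarrow> labelling \<Rightarrow> nat \<Rightarrow> side list \<Rightarrow> nat option" where
  "z E L v [] = Some v"
| "z E L v (s # ss) =
     (if \<exists>!u. (v, u) \<in> E \<and> L v u = s then z E L (THE u. (v, u) \<in> E \<and> L v u = s) ss else None)"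

definition is_origin :: "adjacency \<Rightarrow> labelling \<Rightarrow> nat \<Rightarrow> bool" where
  "is_origin E L v \<longleftrightarrow> (\<forall>j. \<not> has_edge E L v (Prev j))"

definition grid_ok :: "nat \<Rightarrow> adjacency \<Rightarrow> labelling \<Rightarrow> nat \<Rightarrow> bool" where
  "grid_ok i E L v \<longleftrightarrow>
     (\<forall>u\<in>E `` {v}. L v u \<in> sides i) \<and>
     inj_on (L v) (E `` {v}) \<and>
     (\<forall>j\<in>{1..i}. has_edge E L v (Prev j) \<or> has_edge E L v (Next j)) \<and>
     (\<forall>u\<in>E `` {v}. L u v = opposite (L v u)) \<and>
     (\<forall>u\<in>E `` {v}. \<forall>u'\<in>E `` {v}. axis_of (L v u) \<noteq> axis_of (L v u') \<longrightarrow>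
        z E L u [L v u'] \<noteq> None \<and> z E L u [L v u'] = z E L u' [L v u])"


section \<open>The problem $\Pi_M^i$\<close>

datatype ('q, 'g) out_label =
    Tape 'g | State 'q | Head | Dimension nat | ExemptM
  | Unbalanced | ExemptU
  | Error | Pointer side nat

definition enc_labels :: "nat \<Rightarrow> ('q, 'g) out_label set" where
  "enc_labels i = range Tape \<union> range State \<union> {Head, ExemptM} \<union> Dimension ` {2..i}"

definition unb_labels :: "('q, 'g) out_label set" where
  "unb_labels = {Unbalanced, ExemptU}"

definition err_labels :: "nat \<Rightarrow> ('q, 'g) out_label set" where
  "err_labels i = insert Error {Pointer s r | s r. s \<in> sides i \<and> r \<in> {0, 1}}"

text \<open>Every node outputs a set of labels.\<close>

type_synonym ('q, 'g) outputs = "nat \<Rightarrow> ('q, 'g) out_label set"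

definition LC1 :: "nat \<Rightarrow> ('q, 'g) outputs \<Rightarrow> nat \<Rightarrow> bool" where
  "LC1 i out v \<longleftrightarrow>
     out v = {ExemptM} \<or>
     (\<exists>k\<in>{2..i}. \<exists>t q. out v = {Dimension k, Tape t, State q} \<or>
                         out v = {Dimension k, Tape t, State q, Head})"

definition LC2 :: "nat \<Rightarrow> adjacency \<Rightarrow> labelling \<Rightarrow> ('q, 'g) outputs \<Rightarrow> nat \<Rightarrow> bool" where
  "LC2 i E L out v \<longleftrightarrow> (is_origin E L v \<longrightarrow> (\<exists>k\<in>{2..i}. Dimension k \<in> out v))"

definition LC3 :: "nat \<Rightarrow> adjacency \<Rightarrow> labelling \<Rightarrow> ('q, 'g) outputs \<Rightarrow> nat \<Rightarrow> bool" where
  "LC3 i E L out v \<longleftrightarrow>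
     (\<forall>k\<in>{2..i}. Dimension k \<in> out v \<longrightarrow>
        (\<forall>j. has_edge E L v (Prev j) \<longrightarrow> j = 1 \<or> j = k) \<and>
        (\<forall>s\<in>{Prev 1, Prev k, Next k}. \<forall>u. z E L v [s] = Some u \<longrightarrow> Dimension k \<in> out u))"

text \<open>The conditions on a node \<open>v\<close> of the first row of the encoding.\<close>

definition LC4_first ::
  "('q, 'g) lba \<Rightarrow> adjacency \<Rightarrow> labelling \<Rightarrow> ('q, 'g) outputs \<Rightarrow> nat \<Rightarrow> nat \<Rightarrow> bool" where
  "LC4_first M E L out k v \<longleftrightarrow>
     (\<not> has_edge E L v (Prev k) \<longrightarrow> Head \<in> out v \<and> Tape (left_marker M) \<in> out v) \<and>
     (\<not> has_edge E L v (Next k) \<longrightarrow> Tape (right_marker M) \<in> out v) \<and>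
     (has_edge E L v (Prev k) \<and> has_edge E L v (Next k) \<longrightarrow> Tape (blank M) \<in> out v) \<and>
     State (start M) \<in> out v \<and>
     (start M \<noteq> final M \<longrightarrow> (\<forall>u. z E L v [Next 1] = Some u \<longrightarrow> Dimension k \<in> out u))"

text \<open>The conditions on a node \<open>v\<close> with labels \<open>State q\<close>, \<open>Tape t\<close> whose predecessor
  \<open>p\<close>, the node $z_v(\mathsf{Prev},1)$, has labels \<open>State q'\<close>, \<open>Tape t'\<close>.\<close>

definition LC4_next ::
  "('q, 'g) lba \<Rightarrow> adjacency \<Rightarrow> labelling \<Rightarrow> ('q, 'g) outputs \<Rightarrow> nat \<Rightarrow> nat \<Rightarrow>
     nat \<Rightarrow> 'q \<Rightarrow> 'g \<Rightarrow> 'q \<Rightarrow> 'g \<Rightarrow> bool" where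
  "LC4_next M E L out k v p q t q' t' \<longleftrightarrow>
     q' \<noteq> final M \<and>
     (if Head \<in> out p
      then (\<exists>d. delta M q' t' = (q, t, d) \<and>
             (case d of
                Stay \<Rightarrow> Head \<in> out v
              | Leftward \<Rightarrow> (\<exists>u. z E L v [Prev k] = Some u \<and> Head \<in> out u)
              | Rightward \<Rightarrow> (\<exists>u. z E L v [Next k] = Some u \<and> Head \<in> out u)))
      else t = t' \<and>
           (\<forall>s\<in>{Prev k, Next k}. \<forall>u. z E L v [s] = Some u \<longrightarrow> State q \<in> out u)) \<and>
     (q \<noteq> final M \<longrightarrow> (\<forall>u. z E L v [Next 1] = Some u \<longrightarrow> Dimension k \<in> out u))"

text \<open>The machine has a single head: the label \<open>Head\<close> marks \<^emph>\<open>the\<close> position of the head and so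
  occurs only where it starts or where $M$ moves it to.  Without this, a labelling with \<open>Head\<close>
  everywhere could run the machine on each cell separately.\<close>

definition head_moves_to ::
  "('q, 'g) lba \<Rightarrow> adjacency \<Rightarrow> labelling \<Rightarrow> ('q, 'g) outputs \<Rightarrow> nat \<Rightarrow> nat \<Rightarrow> bool" where
  "head_moves_to M E L out k v \<longleftrightarrow>
     (\<exists>x p q t d.
        z E L x [Prev 1] = Some p \<and> {Head, State q, Tape t} \<subseteq> out p \<and>
        q \<noteq> final M \<and> snd (snd (delta M q t)) = d \<and>
        (case d of
           Stay \<Rightarrow> x = v
         | Leftward \<Rightarrow> z E L v [Next k] = Some x
         | Rightward \<Rightarrow> z E L v [Prev k] = Some x))"

definition single_head ::
  "('q, 'g) lba \<Rightarrow> adjacency \<Rightarrow> labelling \<Rightarrow> ('q, 'g) outputs \<Rightarrow> nat \<Rightarrow> nat \<Rightarrow> bool" where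
  "single_head M E L out k v \<longleftrightarrow>
     (Head \<in> out v \<longrightarrow>
        (if has_edge E L v (Prev 1) then head_moves_to M E L out k v
         else \<not> has_edge E L v (Prev k)))"

definition LC4 ::
  "nat \<Rightarrow> ('q, 'g) lba \<Rightarrow> adjacency \<Rightarrow> labelling \<Rightarrow> ('q, 'g) outputs \<Rightarrow> nat \<Rightarrow> bool" where
  "LC4 i M E L out v \<longleftrightarrow>
     (\<forall>k\<in>{2..i}. Dimension k \<in> out v \<longrightarrow>
        (\<not> has_edge E L v (Prev 1) \<longrightarrow> LC4_first M E L out k v) \<and>
        (has_edge E L v (Prev 1) \<longrightarrow>
           (\<forall>p q t q' t'. z E L v [Prev 1] = Some p \<and>
              {State q, Tape t} \<subseteq> out v \<and> {State q', Tape t'} \<subseteq> out p \<longrightarrow>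
              LC4_next M E L out k v p q t q' t')) \<and>
        single_head M E L out k v)"

definition encoding_ok ::
  "nat \<Rightarrow> ('q, 'g) lba \<Rightarrow> adjacency \<Rightarrow> labelling \<Rightarrow> ('q, 'g) outputs \<Rightarrow> nat \<Rightarrow> bool" where
  "encoding_ok i M E L out v \<longleftrightarrow>
     LC1 i out v \<and> LC2 i E L out v \<and> LC3 i E L out v \<and> LC4 i M E L out v"

definition unbalance_ok ::
  "nat \<Rightarrow> adjacency \<Rightarrow> labelling \<Rightarrow> ('q, 'g) outputs \<Rightarrow> nat \<Rightarrow> bool" where
  "unbalance_ok i E L out v \<longleftrightarrow>
     (let back = (\<exists>u. z E L v (map Prev [1..<Suc i]) = Some u \<and> Unbalanced \<in> out u);
          forth = (\<exists>w. z E L v (map Next [1..<Suc i]) = Some w \<and> Unbalanced \<in> out w)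
      in (Unbalanced \<in> out v \<longrightarrow>
            (back \<and> forth) \<or>
            (forth \<and> (\<forall>j. \<not> has_edge E L v (Prev j))) \<or>
            (back \<and> (\<forall>j\<in>{2..i}. has_edge E L v (Next j)) \<and> \<not> has_edge E L v (Next 1)))) \<and>
     (is_origin E L v \<longrightarrow> Unbalanced \<in> out v)"

text \<open>Whether an error pointer \<open>(s, r)\<close> may be followed by an error pointer \<open>(s', r')\<close>.\<close>

definition pointer_continues :: "side \<Rightarrow> nat \<Rightarrow> side \<Rightarrow> nat \<Rightarrow> bool" where
  "pointer_continues s r s' r' \<longleftrightarrow>
     r' \<ge> r \<and>
     (r' = 0 \<and> r = 0 \<longrightarrow> s' = s) \<and>
     (r' = 1 \<and> r = 1 \<longrightarrow> axis_of s' \<ge> axis_of s) \<and>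
     (r' = 1 \<and> r = 1 \<and> axis_of s' = axis_of s \<longrightarrow> s' = s)"

definition Pi_correct_at ::
  "nat \<Rightarrow> ('q, 'g) lba \<Rightarrow> adjacency \<Rightarrow> labelling \<Rightarrow> ('q, 'g) outputs \<Rightarrow> nat \<Rightarrow> bool" where
  "Pi_correct_at i M E L out v \<longleftrightarrow>
     out v \<subseteq> enc_labels i \<union> unb_labels \<union> err_labels i \<and>
     out v \<noteq> {} \<and> (card (out v) \<ge> 2 \<longrightarrow> out v \<subseteq> enc_labels i - {ExemptM}) \<and>
     (Error \<in> out v \<longleftrightarrow> \<not> grid_ok i E L v) \<and>
     (ExemptU \<in> out v \<or> ExemptM \<in> out v \<longrightarrow> (\<exists>j\<in>{1..i}. has_edge E L v (Prev j))) \<and>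
     (out v \<subseteq> enc_labels i - {ExemptM} \<longrightarrow>
        (\<exists>u\<in>nbhd E 2 v. out u \<inter> err_labels i \<noteq> {}) \<or>
        ((\<forall>u\<in>nbhd E 2 v. out u \<subseteq> enc_labels i) \<and>
         (\<forall>u\<in>nbhd E 2 v. grid_ok i E L u) \<and>
         encoding_ok i M E L out v)) \<and>
     (Unbalanced \<in> out v \<longrightarrow>
        (\<exists>u\<in>nbhd E i v. out u \<inter> err_labels i \<noteq> {}) \<or>
        ((\<forall>u\<in>nbhd E i v. out u \<subseteq> unb_labels) \<and>
         (\<forall>u\<in>nbhd E i v. grid_ok i E L u) \<and>
         unbalance_ok i E L out v)) \<and>
     (\<forall>s r. Pointer s r \<in> out v \<longrightarrow>
        (\<exists>u. z E L v [s] = Some u \<and>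
           (Error \<in> out u \<or> (\<exists>s' r'. Pointer s' r' \<in> out u \<and> pointer_continues s r s' r'))))"

definition Pi_problem ::
  "nat \<Rightarrow> ('q, 'g) lba \<Rightarrow> (side, ('q, 'g) out_label set) problem" where
  "Pi_problem i M =
     \<lparr>in_labels = sides i,
      correct = (\<lambda>V E L out. \<forall>v\<in>V. Pi_correct_at i M E L out v)\<rparr>"


section \<open>Asymptotics\<close>

text \<open>A tight bound in the sense of an upper bound $O(g)$ together with the impossibility of
  $o(g)$.  The lower bound concerns infinitely many $n$ only: if, for instance, $n$ is prime, then
  no valid grid with $n$ nodes has an origin, and $\Pi_M^i$ may be much easier.\<close>

definition tight_bound :: "(nat \<Rightarrow> real) \<Rightarrow> (nat \<Rightarrow> real) \<Rightarrow> bool" where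
  "tight_bound f g \<longleftrightarrow> f \<in> O(g) \<and> f \<notin> o(g)"

end

theory Submission
  imports Defs "HOL-Library.Nat_Bijection" "HOL-Library.Countable" "HOL-Library.FuncSet" "HOL-Library.Multiset"
begin

text \<open>
  Upper bound.  A node looks at a neighbourhood whose radius is a constant times
  $R = B + n/B^{i-1} + T_M(B-1) + 1 = O(n/B^{i-1})$.  If a violated grid constraint can be reached by a path
  that follows the axes in increasing order, with boundedly many steps along each axis, it outputs a
  pointer of type 1 along such a path.  Otherwise all short paths from it run through a valid grid, as
  they can be sorted by axis.  If it then finds an origin that outputs no pointer either, it knows the side
  lengths, truncated at $R$, of the box with corner in this origin.  As the box has at most $n$ nodes,
  either axis 1 is strictly the shortest, and the diagonal is labelled \<open>Unbalanced\<close>, or the execution of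
  $M$ on the shortest of the other axes fits into radius $R$ (or runs into the end of axis 1).

  Lower bound.  On the $T_M(B) \times B \times \dots \times B$ box every correct output encodes the execution
  of $M$, row by row.  Shifting all identifiers by one row along axis 1 does not change what nodes far from
  both ends see, so a fast algorithm would produce equal consecutive configurations, and $M$ would not
  terminate.
\<close>

text \<open>A node cannot know how long an axis is, only whether it ends within \<open>R\<close>
  steps, so \<open>R\<close> has to make truncated lengths sufficient. The critical case is an axis
  1 that is cut off while the tape axis, of length d, is not longer: the box then has at least (R+1)
  * d^(i-1) of the n nodes. The term n/B^(i-1) rules this out for d \<ge> B, and for d < B
  monotonicity gives T_M(d) \<le> T_M(B-1) < R. The last term cannot be T_M(B), which may be far
  larger than n/B^(i-1); by minimality of B, (B-1)^(i-1) * T_M(B-1) < n, whence T_M(B-1) \<le>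
  2^(i-1) * n/B^(i-1). Error labels close to a node excuse its encoding and unbalance constraints.
  So these are verified only where the whole checked neighbourhood is error-free, and there all
  nodes agree on origin and plan. The search for errors is restricted because pointers of type 1 may
  only move on to larger axes; the obstacle is that this restricted search must still certify a
  whole ball. Nodes in valid surroundings without an origin in reach, as in tori, output
  \<open>ExemptM\<close>.\<close>

section \<open>Combining algorithms\<close>

text \<open>Nodes know n, so a different algorithm may be run for every n. The state carries n along
  because \<open>send\<close>, \<open>receive\<close> and \<open>decision\<close> see nothing but
  the state.\<close>

definition combine :: "(nat \<Rightarrow> ('i, 'o) algorithm) \<Rightarrow> ('i, 'o) algorithm" where
  "combine Alg =
     \<lparr>initial = (\<lambda>n x d ls. prod_encode (n, initial (Alg n) n x d ls)),
      send = (\<lambda>s. send (Alg (fst (prod_decode s))) (snd (prod_decode s))),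
      receive = (\<lambda>s ms. prod_encode (fst (prod_decode s),
                   receive (Alg (fst (prod_decode s))) (snd (prod_decode s)) ms)),
      decision = (\<lambda>s. decision (Alg (fst (prod_decode s))) (snd (prod_decode s)))\<rparr>"

lemma state_after_combine:
  "state_after (combine Alg) N t =
     (\<lambda>v. prod_encode (card (nodes N), state_after (Alg (card (nodes N))) N t v))"
proof (induction t)
  case 0
  show ?case by (auto simp: state_after_def initial_state_def combine_def)
next
  case (Suc t)
  have "state_after (combine Alg) N (Suc t) = round_step (combine Alg) N (state_after (combine Alg) N t)"
    by (simp add: state_after_def)
  also have "\<dots> = (\<lambda>v. prod_encode (card (nodes N),
      round_step (Alg (card (nodes N))) N (state_after (Alg (card (nodes N))) N t) v))"
    unfolding Suc.IH by (rule ext) (simp add: round_step_def combine_def Let_def)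
  finally show ?case by (simp add: state_after_def)
qed

lemma decision_combine:
  "decision (combine Alg) (state_after (combine Alg) N t v) =
     decision (Alg (card (nodes N))) (state_after (Alg (card (nodes N))) N t v)"
  by (simp add: state_after_combine) (simp add: combine_def)

text \<open>For each n some algorithm attains the minimum at n. It is needed on n-node networks
  only, so \<open>combine\<close> glues these choices into one algorithm that attains the minimum at
  every n.\<close>

lemma time_complexity_exists:
  assumes "solvable_in \<Delta> c P t0"
  shows "\<exists>\<tau>. is_time_complexity \<Delta> c P \<tau>"
proof -
  define \<tau> where "\<tau> n = (LEAST m. \<exists>t. solvable_in \<Delta> c P t \<and> t n = m)" for n
  have "\<exists>t. solvable_in \<Delta> c P t \<and> t n = \<tau> n" for n
    unfolding \<tau>_def by (rule LeastI_ex) (use assms in blast)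
  then have "\<exists>A t. solves \<Delta> c P A t \<and> t n = \<tau> n" for n
    unfolding solvable_in_def by blast
  then obtain Alg t where Alg: "\<And>n. solves \<Delta> c P (Alg n) (t n)" "\<And>n. t n n = \<tau> n"
    by metis
  have "solves \<Delta> c P (combine Alg) \<tau>"
    unfolding solves_def
  proof (intro allI impI)
    fix n N assume N: "is_network \<Delta> c (in_labels P) n N"
    then have "card (nodes N) = n" by (simp add: is_network_def)
    then show "(\<forall>v\<in>nodes N. decision (combine Alg) (state_after (combine Alg) N (\<tau> n) v) \<noteq> None) \<and>
        correct P (nodes N) (edges N) (label N)
          (\<lambda>v. the (decision (combine Alg) (state_after (combine Alg) N (\<tau> n) v)))"
      using Alg(1)[of n] N Alg(2)[of n] unfolding solves_def decision_combine by metis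
  qed
  moreover have "\<tau> n \<le> t n" if "solvable_in \<Delta> c P t" for t n
    unfolding \<tau>_def by (rule Least_le) (use that in blast)
  ultimately show ?thesis
    unfolding is_time_complexity_def solvable_in_def by blast
qed

section \<open>Gathering neighbourhoods\<close>

text \<open>The components are n, the own identifier, the number of rounds done, the own endpoint
  labels in port order, and the edges known so far, each as (identifier, label at this end,
  identifier of the other end).\<close>

type_synonym 'i gather_state = "nat \<times> nat \<times> nat \<times> 'i list \<times> (nat \<times> 'i \<times> nat) list"

definition gather_step :: "'i gather_state \<Rightarrow> 'i gather_state list \<Rightarrow> 'i gather_state" where
  "gather_step s ms = (case s of (n, x, r, ls, K) \<Rightarrow>
     (n, x, Suc r, ls,
      K @ concat (map (\<lambda>(_, _, _, _, K'). K') ms) @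
      map (\<lambda>(l, (_, y, _)). (x, l, y)) (zip ls ms)))"

text \<open>A message is the whole state. All nodes stop in the same round \<open>T n\<close>, so no
  state is frozen while others still gather. \<open>F\<close> is an arbitrary function, as the model
  asks for no computability.\<close>

definition gather ::
  "(nat \<Rightarrow> nat) \<Rightarrow> (nat \<Rightarrow> nat \<Rightarrow> (nat \<times> 'i::countable \<times> nat) set \<Rightarrow> 'o) \<Rightarrow> ('i, 'o) algorithm" where
  "gather T F =
     \<lparr>initial = (\<lambda>n x d ls. to_nat (n, x, 0::nat, ls, []::(nat \<times> 'i \<times> nat) list)),
      send = (\<lambda>s p. s),
      receive = (\<lambda>s ms. to_nat (gather_step (from_nat s :: 'i gather_state) (map from_nat ms))),
      decision = (\<lambda>s. case from_nat s of (n, x, r, ls :: 'i list, K) \<Rightarrow>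
         if T n \<le> r then Some (F n x (set K)) else None)\<rparr>"

text \<open>The strict bound \<open>d < t\<close> reflects that the identifiers of neighbours arrive
  only with their first messages: initially not even the own edges are known in this form.\<close>

definition known :: "'i network \<Rightarrow> nat \<Rightarrow> nat \<Rightarrow> (nat \<times> 'i \<times> nat) set" where
  "known N t v = {(ident N u, label N u w, ident N w) | u w.
     (u, w) \<in> edges N \<and> (\<exists>d<t. (v, u) \<in> edges N ^^ d)}"

lemma known_Suc:
  "known N (Suc t) v = (\<lambda>w. (ident N v, label N v w, ident N w)) ` (edges N `` {v}) \<union>
     known N t v \<union> (\<Union>u\<in>edges N `` {v}. known N t u)"  (is "?L = ?R")
proof
  show "?L \<subseteq> ?R"
  proof
    fix e assume "e \<in> ?L"
    then obtain u w d where e: "e = (ident N u, label N u w, ident N w)" "(u, w) \<in> edges N"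
      "d < Suc t" "(v, u) \<in> edges N ^^ d" by (auto simp: known_def)
    show "e \<in> ?R"
    proof (cases d)
      case 0
      then show ?thesis using e by auto
    next
      case (Suc d')
      then obtain y where "(v, y) \<in> edges N" "(y, u) \<in> edges N ^^ d'"
        using e(4) by (meson relpow_Suc_D2)
      moreover have "d' < t" using Suc e(3) by simp
      ultimately have "e \<in> known N t y" "y \<in> edges N `` {v}" using e by (auto simp: known_def)
      then show ?thesis by blast
    qed
  qed
next
  have "known N t v \<subseteq> ?L" unfolding known_def using less_SucI by blast
  moreover have "known N t u \<subseteq> ?L" if "(v, u) \<in> edges N" for u
  proof
    fix e assume "e \<in> known N t u"
    then obtain y w d where e: "e = (ident N y, label N y w, ident N w)" "(y, w) \<in> edges N"
      "d < t" "(u, y) \<in> edges N ^^ d" by (auto simp: known_def)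
    have "(v, y) \<in> edges N ^^ Suc d" using that e(4) by (rule relpow_Suc_I2)
    then show "e \<in> ?L" using e unfolding known_def by (smt (verit) Suc_mono mem_Collect_eq)
  qed
  moreover have "(\<lambda>w. (ident N v, label N v w, ident N w)) ` (edges N `` {v}) \<subseteq> ?L"
    by (fastforce simp: known_def)
  ultimately show "?R \<subseteq> ?L" by blast
qed

lemma state_after_gather:
  fixes N :: "'i::countable network"
  assumes "\<And>v. bij_betw (port N v) {..<degree (edges N) v} (edges N `` {v})"
    and "t \<le> T (card (nodes N))"
  shows "\<exists>K. set K = known N t v \<and>
     state_after (gather T F) N t v = to_nat (card (nodes N), ident N v, t,
       map (\<lambda>p. label N v (port N v p)) [0..<degree (edges N) v], K)"
  using assms(2)
proof (induction t arbitrary: v)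
  case 0
  show ?case by (auto simp: state_after_def initial_state_def gather_def known_def)
next
  case (Suc t)
  define st where "st = state_after (gather T F) N t"
  define ls where "ls = (\<lambda>v. map (\<lambda>p. label N v (port N v p)) [0..<degree (edges N) v])"
  have "\<forall>v. \<exists>K. set K = known N t v \<and>
    st v = to_nat (card (nodes N), ident N v, t, ls v, K)"
    using Suc.IH Suc.prems unfolding st_def ls_def by simp
  then obtain K where K: "\<And>v. set (K v) = known N t v"
    "\<And>v. st v = to_nat (card (nodes N), ident N v, t, ls v, K v)"
    by metis
  define dg where "dg = degree (edges N) v"
  have bij: "bij_betw (port N v) {..<dg} (edges N `` {v})" using assms(1) by (simp add: dg_def)
  then have im: "port N v ` {..<dg} = edges N `` {v}" by (simp add: bij_betw_def)
  define ms where "ms = map (\<lambda>p. (card (nodes N), ident N (port N v p), t, ls (port N v p), K (port N v p))) [0..<dg]"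
  have und: "decision (gather T F) (st v) = None"
    using Suc.prems by (simp add: K(2) gather_def)
  have "state_after (gather T F) N (Suc t) v = round_step (gather T F) N st v"
    by (simp add: state_after_def st_def)
  also have "\<dots> = receive (gather T F) (st v) (map (\<lambda>p. st (port N v p)) [0..<dg])"
    by (simp add: round_step_def und dg_def) (simp add: gather_def)
  also have "map (\<lambda>p. st (port N v p)) [0..<dg] = map to_nat ms"
    unfolding ms_def by (auto simp: K(2))
  also have "receive (gather T F) (st v) (map to_nat ms) =
      to_nat (gather_step (card (nodes N), ident N v, t, ls v, K v) ms)"
    using Suc.prems by (simp add: gather_def K(2) comp_def)
  finally have eq: "state_after (gather T F) N (Suc t) v =
      to_nat (gather_step (card (nodes N), ident N v, t, ls v, K v) ms)" .
  define K' where "K' = K v @ concat (map (\<lambda>(_, _, _, _, K'). K') ms) @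
      map (\<lambda>(l, (_, y, _)). (ident N v, l, y)) (zip (ls v) ms)"
  have z: "map (\<lambda>(l, (_, y, _)). (ident N v, l, y)) (zip (ls v) ms) =
      map (\<lambda>p. (ident N v, label N v (port N v p), ident N (port N v p))) [0..<dg]"
    by (rule nth_equalityI) (auto simp: ls_def ms_def dg_def)
  have "set K' = known N t v \<union> (\<Union>p\<in>{..<dg}. known N t (port N v p)) \<union>
      (\<lambda>p. (ident N v, label N v (port N v p), ident N (port N v p))) ` {..<dg}"
    unfolding K'_def z by (auto simp: K(1) ms_def)
  also have "\<dots> = known N (Suc t) v"
    unfolding known_Suc im[symmetric] by (auto simp: image_image)
  finally show ?case
    unfolding eq by (auto simp: gather_step_def K'_def ls_def intro!: exI[of _ K'])
qed

text \<open>The last hypothesis covers every number \<open>v\<close>, node or not, since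
  \<open>correct\<close> receives the output labelling as a total function. A non-node has degree 0,
  so its port map is trivially bijective and the simulation lemma applies to it too.\<close>

lemma gather_solves:
  fixes P :: "('i::countable, 'o) problem"
  assumes "\<And>n N. is_network \<Delta> c (in_labels P) n N \<Longrightarrow>
     correct P (nodes N) (edges N) (label N) (out N) \<and> (\<forall>v. F n (ident N v) (known N (T n) v) = out N v)"
  shows "solvable_in \<Delta> c P T"
proof -
  have "solves \<Delta> c P (gather T F) T"
    unfolding solves_def
  proof (intro allI impI)
    fix n N assume N: "is_network \<Delta> c (in_labels P) n N"
    then have n: "card (nodes N) = n" and sub: "edges N \<subseteq> nodes N \<times> nodes N"
      and p: "\<forall>v\<in>nodes N. bij_betw (port N v) {..<degree (edges N) v} (edges N `` {v})"
      by (auto simp: is_network_def simple_connected_graph_def)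
    have p': "bij_betw (port N v) {..<degree (edges N) v} (edges N `` {v})" for v
    proof (cases "v \<in> nodes N")
      case False
      then have "edges N `` {v} = {}" using sub by auto
      then show ?thesis by (simp add: degree_def bij_betw_def)
    qed (use p in blast)
    have d: "decision (gather T F) (state_after (gather T F) N (T n) v) = Some (out N v)" for v
    proof -
      obtain K where "set K = known N (T n) v" "state_after (gather T F) N (T n) v = to_nat (n, ident N v, T n,
       map (\<lambda>p. label N v (port N v p)) [0..<degree (edges N) v], K)"
        using state_after_gather[where T = T and F = F, OF p', of "T n" v, unfolded n, OF order_refl] by blast
      then show ?thesis using assms[OF N] by (simp add: gather_def)
    qed
    show "(\<forall>v\<in>nodes N. decision (gather T F) (state_after (gather T F) N (T n) v) \<noteq> None) \<and>
        correct P (nodes N) (edges N) (label N)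
          (\<lambda>v. the (decision (gather T F) (state_after (gather T F) N (T n) v)))"
      unfolding d using assms[OF N] by simp
  qed
  then show ?thesis unfolding solvable_in_def by blast
qed

section \<open>Local grids\<close>

lemma opposite_opposite [simp]: "opposite (opposite s) = s"
  by (cases s) auto

lemma axis_of_opposite [simp]: "axis_of (opposite s) = axis_of s"
  by (cases s) auto

lemma same_axis: "axis_of s = axis_of t \<longleftrightarrow> t = s \<or> t = opposite s"
  by (cases s; cases t) auto

declare z.simps(2) [simp del]

lemma z_append: "z E L v (p @ q) = Option.bind (z E L v p) (\<lambda>u. z E L u q)"
  by (induction E L v p rule: z.induct) (auto simp: z.simps(2))

lemma z_Cons: "z E L v (s # p) = Option.bind (z E L v [s]) (\<lambda>u. z E L u p)"
  using z_append[of E L v "[s]" p] by simp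

lemma z_single_iff: "z E L v [s] = Some u \<longleftrightarrow> (\<forall>w. (v, w) \<in> E \<and> L v w = s \<longleftrightarrow> w = u)"
proof
  assume "z E L v [s] = Some u"
  then have ex: "\<exists>!u. (v, u) \<in> E \<and> L v u = s" and u: "u = (THE u. (v, u) \<in> E \<and> L v u = s)"
    by (auto simp: z.simps(2) split: if_splits)
  then show "\<forall>w. (v, w) \<in> E \<and> L v w = s \<longleftrightarrow> w = u"
    using theI'[OF ex] by blast
next
  assume *: "\<forall>w. (v, w) \<in> E \<and> L v w = s \<longleftrightarrow> w = u"
  then have "\<exists>!u. (v, u) \<in> E \<and> L v u = s" by metis
  moreover have "(THE u. (v, u) \<in> E \<and> L v u = s) = u" using * by simp
  ultimately show "z E L v [s] = Some u" by (simp add: z.simps(2))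
qed

lemma z_single_edge: "z E L v [s] = Some u \<Longrightarrow> (v, u) \<in> E \<and> L v u = s"
  by (simp add: z_single_iff)

lemma z_imp_relpow: "z E L v p = Some u \<Longrightarrow> (v, u) \<in> E ^^ length p"
proof (induction p arbitrary: v)
  case (Cons s p)
  then obtain w where w: "z E L v [s] = Some w" "z E L w p = Some u"
    unfolding z_Cons[of E L v s p] by (auto simp: bind_eq_Some_conv)
  from z_single_edge[OF w(1)] Cons.IH[OF w(2)] show ?case
    by (metis length_Cons relpow_Suc_I2)
qed simp

lemma z_rotate:
  assumes "z E L v (p @ q) = Some w" shows "\<exists>u. z E L v p = Some u \<and> z E L u q = Some w"
  using assms by (auto simp: z_append bind_eq_Some_conv)

lemma grid_ok_edge: "grid_ok i E L v \<Longrightarrow> (v, u) \<in> E \<Longrightarrow> z E L v [L v u] = Some u"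
  unfolding z_single_iff grid_ok_def by (metis Image_singleton_iff inj_onD)

lemma grid_ok_has_edge: "grid_ok i E L v \<Longrightarrow> has_edge E L v s \<longleftrightarrow> (\<exists>u. z E L v [s] = Some u)"
  unfolding has_edge_def using grid_ok_edge z_single_edge by metis

text \<open>Each label belongs to exactly one axis, so agreement on every axis makes the two words
  permutations of each other.\<close>

lemma same_axes_length:
  assumes "\<And>j. filter (\<lambda>s. axis_of s = j) p = filter (\<lambda>s. axis_of s = j) q"
  shows "length p = length q"
proof -
  have "mset p = mset q"
  proof (rule multiset_eqI)
    fix x show "count (mset p) x = count (mset q) x"
      using arg_cong[OF assms[of "axis_of x"], of "\<lambda>l. count (mset l) x"] by simp
  qed
  then show ?thesis by (metis size_mset)
qed

locale local_grid =
  fixes i :: nat and E :: adjacency and L :: labelling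
  assumes sym_E: "sym E"
begin

abbreviation ok :: "nat \<Rightarrow> bool" where "ok \<equiv> grid_ok i E L"
abbreviation zz :: "nat \<Rightarrow> side list \<Rightarrow> nat option" where "zz \<equiv> z E L"

text \<open>Only nodes that label paths can name are tested. Nothing nearby is missed: at a valid
  node every incident edge is a step of a label path, by \<open>grid_ok_edge\<close>.\<close>

definition quiet :: "nat \<Rightarrow> nat \<Rightarrow> bool" where
  "quiet n v \<longleftrightarrow> (\<forall>p u. length p \<le> n \<longrightarrow> zz v p = Some u \<longrightarrow> ok u)"

lemma quiet_ok: "quiet n v \<Longrightarrow> ok v"
  unfolding quiet_def by (metis le0 list.size(3) z.simps(1))

lemma quiet_mono: "quiet n v \<Longrightarrow> m \<le> n \<Longrightarrow> quiet m v"
  unfolding quiet_def by (meson le_trans)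

lemma quiet_path:
  assumes "quiet n v" "zz v p = Some u" "length p + m \<le> n" shows "quiet m u"
  unfolding quiet_def
proof (intro allI impI)
  fix q w assume "length q \<le> m" "zz u q = Some w"
  then have "zz v (p @ q) = Some w" "length (p @ q) \<le> n" using assms by (auto simp: z_append)
  then show "ok w" using assms(1) unfolding quiet_def by blast
qed

lemma ok_side: "ok v \<Longrightarrow> zz v [s] = Some u \<Longrightarrow> s \<in> sides i"
  using z_single_edge[of E L v s u] unfolding grid_ok_def by auto

lemma ok_back:
  assumes "ok v" "ok u" "zz v [s] = Some u" shows "zz u [opposite s] = Some v"
proof -
  have "(v, u) \<in> E" "L v u = s" using z_single_edge[OF assms(3)] by auto
  then have "L u v = opposite s" "(u, v) \<in> E"
    using assms(1) sym_E unfolding grid_ok_def by (auto dest: symD)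
  then show ?thesis using grid_ok_edge[OF assms(2), of v] by simp
qed

lemma ok_square:
  assumes "ok v" "zz v [s] = Some u" "zz v [t] = Some w" "axis_of s \<noteq> axis_of t"
  shows "\<exists>y. zz u [t] = Some y \<and> zz w [s] = Some y"
proof -
  have "(v, u) \<in> E" "L v u = s" "(v, w) \<in> E" "L v w = t"
    using z_single_edge[OF assms(2)] z_single_edge[OF assms(3)] by auto
  then have "zz u [t] \<noteq> None \<and> zz u [t] = zz w [s]"
    using assms(1,4) unfolding grid_ok_def by blast
  then show ?thesis by (metis not_None_eq)
qed

text \<open>The square is completed from \<open>u\<close>, where both the step back to
  \<open>v\<close> and the step \<open>t\<close> start.\<close>

lemma ok_square_back:
  assumes "ok v" "ok u" "zz v [s] = Some u" "zz u [t] = Some y" "axis_of s \<noteq> axis_of t"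
  shows "\<exists>w. zz v [t] = Some w \<and> zz w [s] = Some y"
proof -
  obtain w where w: "zz v [t] = Some w"
    using ok_square[OF assms(2) ok_back[OF assms(1-3)] assms(4)] assms(5) by auto
  with ok_square[OF assms(1,3) w assms(5)] assms(4) show ?thesis by auto
qed

lemma z_two: "zz v [s, t] = Some y \<longleftrightarrow> (\<exists>u. zz v [s] = Some u \<and> zz u [t] = Some y)"
  using z_Cons[of E L v s "[t]"] by (simp add: bind_eq_Some_conv)

lemma quiet_commute:
  assumes "quiet 1 v" "axis_of s \<noteq> axis_of t" shows "zz v [s, t] = zz v [t, s]"
proof -
  have "zz v [t, s] = Some y" if st: "zz v [s, t] = Some y" "axis_of s \<noteq> axis_of t" for s t y
  proof -
    obtain u where u: "zz v [s] = Some u" "zz u [t] = Some y" using st(1) unfolding z_two by blast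
    have "ok u" by (rule quiet_ok[OF quiet_path[OF assms(1) u(1), of 0]]) simp
    then show ?thesis
      using ok_square_back[OF quiet_ok[OF assms(1)] _ u st(2)] unfolding z_two by blast
  qed
  with assms(2) show ?thesis by (metis option.exhaust)
qed

text \<open>The step \<open>s\<close> is carried through \<open>w\<close> one square at a time. As
  an equation between options this also covers existence. The end of the path itself may be invalid,
  which is why radius \<open>length w\<close> is enough.\<close>

lemma quiet_swap:
  "quiet (length w) v \<Longrightarrow> \<forall>t\<in>set w. axis_of t \<noteq> axis_of s \<Longrightarrow> zz v (w @ [s]) = zz v (s # w)"
proof (induction w arbitrary: v)
  case (Cons t w)
  have two: "zz v [t, s] = zz v [s, t]"
    by (rule quiet_commute[OF quiet_mono[OF Cons.prems(1)]]) (use Cons.prems in auto)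
  have "zz v ((t # w) @ [s]) = Option.bind (zz v [t]) (\<lambda>u. zz u (w @ [s]))"
    using z_Cons[of E L v t "w @ [s]"] by simp
  also have "\<dots> = Option.bind (zz v [t]) (\<lambda>u. zz u (s # w))"
  proof (cases "zz v [t]")
    case (Some u)
    have "quiet (length w) u" by (rule quiet_path[OF Cons.prems(1) Some]) simp
    then show ?thesis using Cons.IH Cons.prems(2) Some by simp
  qed simp
  also have "\<dots> = zz v ([t, s] @ w)" using z_append[of E L v "[t]" "s # w"] by simp
  also have "\<dots> = zz v ([s, t] @ w)" unfolding z_append two ..
  finally show ?case by simp
qed simp

text \<open>Each square hands the existence of an \<open>s\<close>-step on to the next node of a
  path that avoids this axis. This is what makes the region around an origin a product of
  intervals.\<close>

lemma quiet_push:
  "quiet (length w) v \<Longrightarrow> \<forall>t\<in>set w. axis_of t \<noteq> axis_of s \<Longrightarrow> zz v w = Some x \<Longrightarrow> zz v [s] = Some m \<Longrightarrow>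
     \<exists>y. zz x [s] = Some y"
proof (induction w arbitrary: v m)
  case (Cons t w)
  obtain u where u: "zz v [t] = Some u" "zz u w = Some x"
    using z_rotate[of E L v "[t]" w x] Cons.prems(3) by auto
  obtain y where "zz u [s] = Some y"
    using ok_square[OF quiet_ok[OF Cons.prems(1)] u(1) Cons.prems(4)] Cons.prems(2)
    by auto
  moreover have "quiet (length w) u" by (rule quiet_path[OF Cons.prems(1) u(1)]) simp
  ultimately show ?case using Cons.IH[of u] Cons.prems(2) u(2) by simp
qed simp

text \<open>Steps along different axes commute, so only the sequence of steps along each axis matters.\<close>

lemma quiet_perm:
  "quiet (length p - 1) v \<Longrightarrow> (\<And>j. filter (\<lambda>s. axis_of s = j) p = filter (\<lambda>s. axis_of s = j) q) \<Longrightarrow>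
     zz v p = zz v q"
proof (induction p arbitrary: v q)
  case Nil
  have "q = []"
  proof (rule ccontr)
    assume "q \<noteq> []"
    then show False using Nil(2)[of "axis_of (hd q)"] by (cases q) auto
  qed
  then show ?case by simp
next
  case (Cons s p)
  have "filter (\<lambda>t. axis_of t = axis_of s) q = s # filter (\<lambda>t. axis_of t = axis_of s) p"
    using Cons.prems(2)[of "axis_of s"] by simp
  \<comment> \<open>Everything before \<open>s\<close> in \<open>q\<close> lies on other axes, so
    \<open>quiet_swap\<close> moves \<open>s\<close> to the front, and the induction hypothesis
    handles the rest.\<close>
  from filter_eq_ConsD[OF this] obtain q1 q2
    where q: "q = q1 @ s # q2" "\<forall>t\<in>set q1. axis_of t \<noteq> axis_of s"
      "filter (\<lambda>t. axis_of t = axis_of s) p = filter (\<lambda>t. axis_of t = axis_of s) q2"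
    by (elim exE conjE)
  have f: "filter (\<lambda>s. axis_of s = j) p = filter (\<lambda>s. axis_of s = j) (q1 @ q2)" for j
  proof (cases "j = axis_of s")
    case True
    then show ?thesis using q by (auto simp: filter_empty_conv)
  next
    case False
    then show ?thesis using Cons.prems(2)[of j] q(1) by simp
  qed
  have len: "length p = length (q1 @ q2)" by (rule same_axes_length[OF f])
  have "zz v (q1 @ [s]) = zz v (s # q1)"
    by (rule quiet_swap[OF quiet_mono[OF Cons.prems(1)]]) (use q len in auto)
  then have "zz v q = zz v (s # (q1 @ q2))"
    using q(1) z_append[of E L v "q1 @ [s]" q2] z_append[of E L v "s # q1" q2] by simp
  also have "\<dots> = zz v (s # p)"
  proof (cases "zz v [s]")
    case (Some u)
    show ?thesis
    proof (cases "p = []")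
      case True
      then show ?thesis using len by simp
    next
      case False
      have "quiet (length p - 1) u" by (rule quiet_path[OF Cons.prems(1) Some]) (use False in \<open>cases p; simp\<close>)
      then show ?thesis using Cons.IH[of u "q1 @ q2"] f Some
        z_Cons[of E L v s p] z_Cons[of E L v s "q1 @ q2"] by simp
    qed
  next
    case None
    then show ?thesis
      using z_Cons[of E L v s p] z_Cons[of E L v s "q1 @ q2"] by simp
  qed
  finally show ?case by simp
qed

end

section \<open>Searching for errors along increasing axes\<close>

text \<open>At level \<open>k\<close> the search uses the axes \<open>i - k + 1, \<dots>, i\<close>, in this order.\<close>

primrec error_within :: "nat \<Rightarrow> nat \<Rightarrow> adjacency \<Rightarrow> labelling \<Rightarrow> nat \<Rightarrow> nat \<Rightarrow> bool" where
  "error_within i D E L 0 v \<longleftrightarrow> \<not> grid_ok i E L v"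
| "error_within i D E L (Suc k) v \<longleftrightarrow>
     (\<exists>a\<le>D. \<exists>s\<in>{Next (i - k), Prev (i - k)}. \<exists>u.
        z E L v (replicate a s) = Some u \<and> error_within i D E L k u)"

lemma error_within_mono: "error_within i D E L k v \<Longrightarrow> k \<le> l \<Longrightarrow> error_within i D E L l v"
proof (induction l)
  case (Suc l)
  show ?case
  proof (cases "k = Suc l")
    case False
    then have "error_within i D E L l v" using Suc by simp
    then have "\<exists>u. z E L v (replicate 0 (Next (i - l))) = Some u \<and> error_within i D E L l u" by simp
    then show ?thesis unfolding error_within.simps by blast
  qed (use Suc.prems in simp)
qed simp

text \<open>A word on one axis that is not constant changes direction somewhere, and on one axis
  this means an immediate step back.\<close>

lemma zigzag_free:
  "\<forall>t\<in>set xs. axis_of t = j \<Longrightarrow>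
     (\<exists>s\<in>{Next j, Prev j}. xs = replicate (length xs) s) \<or> (\<exists>a s b. xs = a @ [s, opposite s] @ b)"
proof (induction xs)
  case (Cons t xs)
  have t: "t \<in> {Next j, Prev j}" using Cons.prems by (cases t) auto
  from Cons consider s where "s \<in> {Next j, Prev j}" "xs = replicate (length xs) s"
    | a s b where "xs = a @ [s, opposite s] @ b" by auto
  then show ?case
  proof cases
    case 1
    show ?thesis
    proof (cases "xs = [] \<or> s = t")
      case True
      then have "t # xs = replicate (length (t # xs)) t" using 1(2) by auto
      then show ?thesis using t by blast
    next
      case False
      then obtain n where "xs = s # replicate n s" using 1(2) by (cases "length xs") auto
      moreover have "s = opposite t" using t 1(1) False by auto
      ultimately have "t # xs = [] @ [t, opposite t] @ replicate n s" by simp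
      then show ?thesis by blast
    qed
  next
    case 2
    then have "t # xs = (t # a) @ [s, opposite s] @ b" by simp
    then show ?thesis by blast
  qed
qed auto

text \<open>Sorting by axis keeps the order within each axis, which is what
  \<open>quiet_perm\<close> needs to identify a path with its sorted version.\<close>

lemma filter_sorted_by_axis:
  "distinct js \<Longrightarrow>
     filter (\<lambda>s. axis_of s = j) (concat (map (\<lambda>j'. filter (\<lambda>s. axis_of s = j') p) js)) =
     (if j \<in> set js then filter (\<lambda>s. axis_of s = j) p else [])"
  by (induction js) (auto simp: filter_empty_conv filter_concat conj_commute cong: conj_cong)

text \<open>The canonical path from an origin to the point with coordinates \<open>x\<close>, axis
  by axis; \<open>weight\<close> is its length. Values of \<open>x\<close> outside {1..i} are
  irrelevant, so coordinates are unique only up to them.\<close>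

definition word :: "nat \<Rightarrow> (nat \<Rightarrow> nat) \<Rightarrow> side list" where
  "word i x = concat (map (\<lambda>j. replicate (x j) (Next j)) [1..<Suc i])"

definition weight :: "nat \<Rightarrow> (nat \<Rightarrow> nat) \<Rightarrow> nat" where
  "weight i x = (\<Sum>j=1..i. x j)"

lemma filter_replicate_blocks:
  "distinct js \<Longrightarrow> filter (\<lambda>s. axis_of s = j) (concat (map (\<lambda>j. replicate (x j) (Next j)) js)) =
     (if j \<in> set js then replicate (x j) (Next j) else [])"
  by (induction js) (auto simp: filter_empty_conv)

lemma filter_word: "filter (\<lambda>s. axis_of s = j) (word i x) = (if j \<in> {1..i} then replicate (x j) (Next j) else [])"
  unfolding word_def by (subst filter_replicate_blocks) auto

lemma length_word [simp]: "length (word i x) = weight i x"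
  unfolding word_def weight_def
  by (simp add: length_concat comp_def interv_sum_list_conv_sum_set_nat atLeastLessThanSuc_atLeastAtMost
      del: upt_Suc)

lemma word_cong: "(\<And>j. j \<in> {1..i} \<Longrightarrow> x j = y j) \<Longrightarrow> word i x = word i y"
  unfolding word_def by (intro arg_cong[of _ _ concat] map_cong) auto

lemma weight_cong: "(\<And>j. j \<in> {1..i} \<Longrightarrow> x j = y j) \<Longrightarrow> weight i x = weight i y"
  unfolding weight_def by (rule sum.cong) auto

lemma weight_upd: "j \<in> {1..i} \<Longrightarrow> weight i (x(j := a)) + x j = weight i x + a"
  unfolding weight_def by (simp add: sum.remove[of _ j])

locale bounded_grid = local_grid +
  fixes D :: nat
begin

abbreviation near :: "nat \<Rightarrow> nat \<Rightarrow> bool" where "near \<equiv> error_within i D E L"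

lemma not_near_ok: "\<not> near k v \<Longrightarrow> ok v"
  using error_within_mono[of i D E L 0 v k] by auto

text \<open>Each block of at most \<open>D\<close> equal steps is one level of
  \<open>error_within\<close>, so the negation is handed down block by block. Empty blocks are
  allowed because the level may take a = 0 steps.\<close>

lemma not_near_blocks:
  assumes "k \<le> i" "\<not> near k v" "\<And>j. Suc i - k \<le> j \<Longrightarrow> j \<le> i \<Longrightarrow> \<exists>a\<le>D. \<exists>s\<in>{Next j, Prev j}. B j = replicate a s"
    and "zz v (concat (map B [Suc i - k..<Suc i])) = Some u"
  shows "ok u"
  using assms
proof (induction k arbitrary: v)
  case 0
  then show ?case by simp
next
  case (Suc k)
  have up: "[Suc i - Suc k..<Suc i] = (i - k) # [Suc i - k..<Suc i]"
    using Suc.prems(1) by (simp add: upt_conv_Cons Suc_diff_le del: upt_Suc)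
  obtain a s where as: "a \<le> D" "s \<in> {Next (i - k), Prev (i - k)}" "B (i - k) = replicate a s"
    using Suc.prems(3)[of "i - k"] Suc.prems(1) by auto
  have "zz v (replicate a s @ concat (map B [Suc i - k..<Suc i])) = Some u"
    using Suc.prems(4) unfolding up using as(3) by simp
  then obtain w where w: "zz v (replicate a s) = Some w" "zz w (concat (map B [Suc i - k..<Suc i])) = Some u"
    using z_rotate by blast
  then have "\<not> near k w" using Suc.prems(2) as(1,2) by auto
  then show ?case using Suc.IH[of w] Suc.prems(1,3) w(2) by simp
qed

text \<open>A shortest path to an error, once sorted by axis, has no two consecutive opposite steps and hence
  is one of the paths that \<open>error_within\<close> searches.\<close>

lemma not_near_quiet_aux: "\<not> near i v \<Longrightarrow> n \<le> D \<Longrightarrow> quiet n v"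
proof (induction n)
  case 0
  then show ?case using not_near_ok unfolding quiet_def by auto
next
  case (Suc n)
  then have IH: "quiet n v" by simp
  show ?case
    unfolding quiet_def
  proof (intro allI impI)
    fix p u assume p: "length p \<le> Suc n" "zz v p = Some u"
    define B where "B j = filter (\<lambda>s. axis_of s = j) p" for j
    define q where "q = concat (map B [1..<Suc i])"
    show "ok u"
    proof (cases "length p \<le> n")
      case True
      then show ?thesis using IH p unfolding quiet_def by blast
    next
      case False
      then have len: "length p = Suc n" using p(1) by simp
      \<comment> \<open>Each step starts at a node within distance n, which is valid by the
        induction hypothesis. Hence sorting over the axes 1 to i loses no step.\<close>
      have ax: "axis_of s \<in> {1..i}" if s: "s \<in> set p" for s
      proof -
        obtain p1 p2 where p12: "p = p1 @ s # p2" using s by (meson split_list)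
        obtain m where m: "zz v p1 = Some m" "zz m (s # p2) = Some u"
          using z_rotate p(2) p12 by blast
        then obtain m' where "zz m [s] = Some m'" using z_rotate[of E L m "[s]" p2] by auto
        moreover have "ok m" by (rule quiet_ok[OF quiet_path[OF IH m(1), of 0]]) (use len p12 in auto)
        ultimately have "s \<in> sides i" using ok_side by blast
        then show ?thesis unfolding sides_def by auto
      qed
      have fl: "filter (\<lambda>s. axis_of s = j) p = filter (\<lambda>s. axis_of s = j) q" for j
        unfolding q_def B_def using ax
        by (subst filter_sorted_by_axis) (fastforce simp: filter_empty_conv simp del: upt_Suc)+
      \<comment> \<open>\<open>quiet_perm\<close> asks for validity up to length p - 1 = n only,
        which is the induction hypothesis.\<close>
      have zq: "zz v q = Some u"
        using quiet_perm[of p v q] IH fl len p(2) by simp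
      have lq: "length q = Suc n" using same_axes_length[OF fl] len by simp
      show ?thesis
      proof (cases "\<forall>j\<in>{1..i}. \<exists>s\<in>{Next j, Prev j}. B j = replicate (length (B j)) s")
        case True
        have "\<exists>a\<le>D. \<exists>s\<in>{Next j, Prev j}. B j = replicate a s" if "Suc i - i \<le> j" "j \<le> i" for j
        proof -
          have "length (B j) \<le> D" unfolding B_def using length_filter_le[of _ p] len Suc.prems(2)
            by (metis le_trans)
          then show ?thesis using True that by (metis Suc_diff_diff atLeastAtMost_iff diff_Suc_1 diff_self_eq_0 Suc_diff_le le_refl)
        qed
        then show ?thesis
          using not_near_blocks[of i v B u] Suc.prems(1) zq unfolding q_def by simp
      next
        case False
        then obtain j where j: "j \<in> {1..i}" "\<not> (\<exists>s\<in>{Next j, Prev j}. B j = replicate (length (B j)) s)" by blast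
        then obtain a s b where "B j = a @ [s, opposite s] @ b"
          using zigzag_free[of "B j" j] unfolding B_def by auto
        moreover have "j \<in> set [1..<Suc i]" using j(1) by auto
        then obtain ys zs where "[1..<Suc i] = ys @ j # zs" by (meson split_list)
        ultimately obtain A C where AC: "q = A @ [s, opposite s] @ C"
          unfolding q_def by (simp del: upt_Suc) (metis append.assoc append_Cons)
        obtain m where m: "zz v A = Some m" "zz m ([s, opposite s] @ C) = Some u"
          using z_rotate zq AC by blast
        obtain w where w: "zz m [s, opposite s] = Some w" "zz w C = Some u"
          using z_rotate m(2) by blast
        obtain m' where m': "zz m [s] = Some m'" "zz m' [opposite s] = Some w" using w(1) unfolding z_two by blast
        have qm: "quiet 1 m" by (rule quiet_path[OF IH m(1)]) (use lq AC in auto)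
        have "ok m'" by (rule quiet_ok[OF quiet_path[OF qm m'(1), of 0]]) simp
        \<comment> \<open>The step back returns to \<open>m\<close>, so both steps can be cut out,
          leaving a shorter path to \<open>u\<close> that the induction hypothesis covers.\<close>
        then have "w = m" using ok_back[OF quiet_ok[OF qm] _ m'(1)] m'(2) by simp
        then have "zz v (A @ C) = Some u" using m(1) w(2) by (simp add: z_append)
        moreover have "length (A @ C) \<le> n" using lq AC by simp
        ultimately show ?thesis using IH unfolding quiet_def by blast
      qed
    qed
  qed
qed

lemma not_near_quiet: "\<not> near i v \<Longrightarrow> quiet D v"
  using not_near_quiet_aux by blast

end

section \<open>Coordinates relative to an origin\<close>

context local_grid begin

lemma zz_reverse:
  "quiet (length p) v \<Longrightarrow> zz v p = Some u \<Longrightarrow> zz u (rev (map opposite p)) = Some v"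
proof (induction p arbitrary: v)
  case (Cons s p)
  obtain w where w: "zz v [s] = Some w" "zz w p = Some u"
    using z_rotate[of E L v "[s]" p u] Cons.prems(2) by auto
  have q: "quiet (length p) w" by (rule quiet_path[OF Cons.prems(1) w(1)]) simp
  have "zz w [opposite s] = Some v" by (rule ok_back[OF quiet_ok[OF Cons.prems(1)] quiet_ok[OF q] w(1)])
  then show ?case using Cons.IH[OF q w(2)] by (simp add: z_append)
qed simp

lemma origin_no_prev: "is_origin E L v \<Longrightarrow> zz v [Prev j] = None"
  unfolding is_origin_def has_edge_def using z_single_edge by (metis not_None_eq)

end

locale quiet_origin = local_grid +
  fixes D og :: nat
  assumes quiet_o: "quiet D og" and origin_o: "is_origin E L og"
begin

lemma coord_ok: "zz og (word i x) = Some v \<Longrightarrow> weight i x \<le> D \<Longrightarrow> ok v"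
  using quiet_o unfolding quiet_def by (metis length_word)

lemma coord_next:
  assumes "zz og (word i x) = Some v" "zz v [Next j] = Some u" "weight i x \<le> D"
  shows "j \<in> {1..i} \<and> zz og (word i (x(j := Suc (x j)))) = Some u"
proof -
  have j: "j \<in> {1..i}" using ok_side[OF coord_ok[OF assms(1,3)] assms(2)] by (auto simp: sides_def)
  have "zz og (word i x @ [Next j]) = zz og (word i (x(j := Suc (x j))))"
  proof (rule quiet_perm)
    show "quiet (length (word i x @ [Next j]) - 1) og"
      using quiet_mono[OF quiet_o] assms(3) by simp
    show "filter (\<lambda>s. axis_of s = k) (word i x @ [Next j]) =
      filter (\<lambda>s. axis_of s = k) (word i (x(j := Suc (x j))))" for k
      using j by (auto simp: filter_word replicate_append_same)
  qed
  then show ?thesis using assms(1,2) j by (simp add: z_append)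
qed

lemma coord_pred:
  assumes "zz og (word i x) = Some v" "x j > 0" "j \<in> {1..i}" "weight i x \<le> D"
  shows "\<exists>m. zz og (word i (x(j := x j - 1))) = Some m \<and> zz m [Next j] = Some v \<and> zz v [Prev j] = Some m"
proof -
  let ?y = "x(j := x j - 1)"
  have w: "Suc (weight i ?y) = weight i x" using weight_upd[OF assms(3), of x "x j - 1"] assms(2) by simp
  have "zz og (word i ?y @ [Next j]) = zz og (word i x)"
  proof (rule quiet_perm)
    show "quiet (length (word i ?y @ [Next j]) - 1) og"
      using quiet_mono[OF quiet_o] assms(4) w by simp
    show "filter (\<lambda>s. axis_of s = k) (word i ?y @ [Next j]) = filter (\<lambda>s. axis_of s = k) (word i x)" for k
      using assms(2,3) by (cases "x j") (auto simp: filter_word replicate_append_same)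
  qed
  then obtain m where m: "zz og (word i ?y) = Some m" "zz m [Next j] = Some v"
    using assms(1) z_rotate by metis
  have "zz v [opposite (Next j)] = Some m"
    by (rule ok_back[OF coord_ok[OF m(1)] coord_ok[OF assms(1,4)] m(2)]) (use w assms(4) in simp)
  with m show ?thesis by auto
qed

text \<open>If \<open>x j\<close> were 0, the step \<open>Prev j\<close> would commute with the
  whole word and could be taken first, at the origin, which has no such edge.\<close>

lemma coord_prev:
  assumes "zz og (word i x) = Some v" "zz v [Prev j] = Some u" "weight i x \<le> D"
  shows "j \<in> {1..i} \<and> x j > 0 \<and> zz og (word i (x(j := x j - 1))) = Some u"
proof -
  have j: "j \<in> {1..i}" using ok_side[OF coord_ok[OF assms(1,3)] assms(2)] by (auto simp: sides_def)
  have "x j > 0"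
  proof (rule ccontr)
    assume 0: "\<not> x j > 0"
    have "\<forall>t\<in>set (word i x). axis_of t \<noteq> axis_of (Prev j)"
      using 0 by (auto simp: word_def simp del: upt_Suc)
    then have "zz og (word i x @ [Prev j]) = zz og (Prev j # word i x)"
      using quiet_swap[OF quiet_mono[OF quiet_o]] assms(3) by (metis length_word)
    also have "\<dots> = None" using z_Cons[of E L og "Prev j" "word i x"] origin_no_prev[OF origin_o] by simp
    finally show False using assms(1,2) by (simp add: z_append)
  qed
  with coord_pred[OF assms(1) this j assms(3)] assms(2) j show ?thesis by auto
qed

text \<open>Only the coordinate on axis j decides: its steps are moved to the front by
  \<open>quiet_perm\<close>, and \<open>quiet_push\<close> transports the further step along the
  remaining word. So side lengths can be read off from the axes through the origin.\<close>

lemma coord_next_iff: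
  assumes "zz og (word i x) = Some v" "weight i x \<le> D" "j \<in> {1..i}"
  shows "(\<exists>u. zz v [Next j] = Some u) \<longleftrightarrow> (\<exists>u. zz og (replicate (Suc (x j)) (Next j)) = Some u)"
proof -
  let ?r = "word i (x(j := 0))"
  have w: "weight i (x(j := 0)) + x j = weight i x" using weight_upd[OF assms(3), of x 0] by simp
  have p1: "zz og (word i x @ [Next j]) = zz og (replicate (Suc (x j)) (Next j) @ ?r)"
  proof (rule quiet_perm)
    show "quiet (length (word i x @ [Next j]) - 1) og"
      using quiet_mono[OF quiet_o] assms(2) by simp
    show "filter (\<lambda>s. axis_of s = k) (word i x @ [Next j]) =
      filter (\<lambda>s. axis_of s = k) (replicate (Suc (x j)) (Next j) @ ?r)" for k
      using assms(3) by (auto simp: filter_word replicate_append_same)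
  qed
  have p2: "zz og (word i x) = zz og (replicate (x j) (Next j) @ ?r)"
  proof (rule quiet_perm)
    show "quiet (length (word i x) - 1) og"
      using quiet_mono[OF quiet_o] assms(2) by simp
    show "filter (\<lambda>s. axis_of s = k) (word i x) =
      filter (\<lambda>s. axis_of s = k) (replicate (x j) (Next j) @ ?r)" for k
      using assms(3) by (auto simp: filter_word)
  qed
  obtain m where m: "zz og (replicate (x j) (Next j)) = Some m" "zz m ?r = Some v"
    using p2 assms(1) z_rotate by metis
  show ?thesis
  proof
    assume "\<exists>u. zz v [Next j] = Some u"
    then obtain u where "zz og (word i x @ [Next j]) = Some u" using assms(1) by (auto simp: z_append)
    then show "\<exists>u. zz og (replicate (Suc (x j)) (Next j)) = Some u"
      using p1 z_rotate by metis
  next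
    assume "\<exists>u. zz og (replicate (Suc (x j)) (Next j)) = Some u"
    then obtain m' where "zz m [Next j] = Some m'"
      using m(1) unfolding replicate_Suc replicate_append_same[symmetric] by (auto simp: z_append)
    moreover have "quiet (length ?r) m" by (rule quiet_path[OF quiet_o m(1)]) (use w assms(2) in simp)
    moreover have "\<forall>t\<in>set ?r. axis_of t \<noteq> axis_of (Next j)"
      by (auto simp: word_def simp del: upt_Suc)
    ultimately show "\<exists>u. zz v [Next j] = Some u" using quiet_push m(2) by blast
  qed
qed

lemma coord_defined:
  assumes "weight i x \<le> D" "\<And>j. j \<in> {1..i} \<Longrightarrow> \<exists>u. zz og (replicate (x j) (Next j)) = Some u"
  shows "\<exists>v. zz og (word i x) = Some v"
  using assms
proof (induction "weight i x" arbitrary: x)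
  case 0
  then have "word i x = []" by (metis length_0_conv length_word)
  then show ?case by simp
next
  case (Suc n)
  then obtain j where j: "j \<in> {1..i}" "x j > 0"
    unfolding weight_def by (metis Zero_not_Suc gr0I sum.neutral)
  let ?y = "x(j := x j - 1)"
  have w: "Suc (weight i ?y) = weight i x" using weight_upd[OF j(1), of x "x j - 1"] j(2) by simp
  have r: "replicate (x j) (Next j) = replicate (x j - 1) (Next j) @ [Next j]"
    using j(2) by (cases "x j") (auto simp: replicate_append_same)
  have "\<exists>u. zz og (replicate (?y k) (Next k)) = Some u" if k: "k \<in> {1..i}" for k
    using Suc.prems(2)[OF k] Suc.prems(2)[OF j(1)] unfolding r by (cases "k = j") (auto dest: z_rotate)
  then obtain v where v: "zz og (word i ?y) = Some v" using Suc.hyps(1)[of ?y] Suc.hyps(2) w Suc.prems(1) by auto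
  then obtain u where "zz v [Next j] = Some u"
    using coord_next_iff[OF v _ j(1)] Suc.prems(2)[OF j(1)] w Suc.prems(1) j by auto
  from coord_next[OF v this] w Suc.prems(1) j(2) show ?case by auto
qed

end

text \<open>A \<open>Prev j\<close> step is visible at \<open>v\<close> itself and lowers the j-th
  coordinate with respect to both origins. Taking such steps while possible ends at a node without
  \<open>Prev\<close> edges, the common origin.\<close>

lemma (in local_grid) coord_unique:
  assumes "quiet D og" "is_origin E L og" "quiet D og'" "is_origin E L og'"
    and "zz og (word i x) = Some v" "zz og' (word i y) = Some v" "weight i x \<le> D" "weight i y \<le> D"
  shows "og = og' \<and> (\<forall>j\<in>{1..i}. x j = y j)"
  using assms(5-8)
proof (induction "weight i x" arbitrary: x y v)
  case 0
  interpret O: quiet_origin i E L D og by unfold_locales (use assms in auto)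
  interpret O': quiet_origin i E L D og' by unfold_locales (use assms in auto)
  from 0 have x: "word i x = []" "\<forall>j\<in>{1..i}. x j = 0"
    using length_word[of i x] by (auto simp: weight_def simp del: length_word)
  then have v: "v = og" using 0 by simp
  have y: "y j = 0" if "j \<in> {1..i}" for j
    using O'.coord_pred[OF 0(3) _ that 0(5)] origin_no_prev[OF assms(2)] v by force
  then have "weight i y = 0" by (simp add: weight_def)
  then have "word i y = []" by (metis length_0_conv length_word)
  then show ?case using 0 v x y by simp
next
  case (Suc n)
  interpret O: quiet_origin i E L D og by unfold_locales (use assms in auto)
  interpret O': quiet_origin i E L D og' by unfold_locales (use assms in auto)
  obtain j where j: "j \<in> {1..i}" "x j > 0"
    using Suc.hyps(2) unfolding weight_def by (metis Zero_not_Suc gr0I sum.neutral)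
  obtain m where m: "zz og (word i (x(j := x j - 1))) = Some m" "zz v [Prev j] = Some m"
    using O.coord_pred[OF Suc.prems(1) j(2,1) Suc.prems(3)] by blast
  have m': "y j > 0" "zz og' (word i (y(j := y j - 1))) = Some m"
    using O'.coord_prev[OF Suc.prems(2) m(2) Suc.prems(4)] by auto
  have "og = og' \<and> (\<forall>k\<in>{1..i}. (x(j := x j - 1)) k = (y(j := y j - 1)) k)"
    by (rule Suc.hyps(1)[OF _ m(1) m'(2)])
       (use weight_upd[OF j(1), of x "x j - 1"] weight_upd[OF j(1), of y "y j - 1"] j m' Suc.hyps(2) Suc.prems in auto)
  moreover from this have "x j - 1 = y j - 1" using j(1) by force
  ultimately show ?case using j m'(1) by (metis Suc_pred' fun_upd_other)
qed

section \<open>Encoding an execution\<close>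

lemma lba_run_Suc: "lba_run M B (Suc t) = lba_step M (lba_run M B t)"
  by (simp add: lba_run_def)

lemma lba_head_bound:
  assumes "is_lba M" "B \<ge> 2" "lba_run M B t = (q, tape, h)" shows "h < B"
  using assms(3)
proof (induction t arbitrary: q tape h)
  case 0
  then show ?case using assms(2) by (auto simp: lba_run_def initial_config_def)
next
  case (Suc t)
  obtain q' tape' h' where r: "lba_run M B t = (q', tape', h')" by (cases "lba_run M B t") auto
  then have h': "h' < B" by (rule Suc.IH)
  show ?case
  proof (cases "q' = final M")
    case True
    then show ?thesis using Suc.prems r h' by (simp add: lba_run_Suc)
  next
    case False
    obtain p g d where d: "delta M q' (tape' h') = (p, g, d)" by (cases "delta M q' (tape' h')") auto
    have "h' = B - 1 \<longrightarrow> d \<noteq> Rightward"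
      using assms(1,2) r False d unfolding is_lba_def by blast
    then show ?thesis using Suc.prems r h' False d by (cases d) (auto simp: lba_run_Suc)
  qed
qed

lemma lba_halts:
  assumes "is_lba M" "B \<ge> 2" shows "fst (lba_run M B (running_time M B)) = final M"
  unfolding running_time_def by (rule LeastI_ex) (use assms in \<open>auto simp: is_lba_def\<close>)

lemma lba_run_not_final: "t < running_time M B \<Longrightarrow> fst (lba_run M B t) \<noteq> final M"
  unfolding running_time_def by (rule not_less_Least)

text \<open>Rows are time steps: \<open>a\<close> counts the steps of the machine and
  \<open>b\<close> is the cell, on a tape of \<open>B\<close> cells along axis
  \<open>k\<close>.\<close>

definition row_label :: "('q, 'g) lba \<Rightarrow> nat \<Rightarrow> nat \<Rightarrow> nat \<Rightarrow> nat \<Rightarrow> ('q, 'g) out_label set" where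
  "row_label M B k a b = (case lba_run M B a of (q, tape, h) \<Rightarrow>
     {Dimension k, Tape (tape b), State q} \<union> (if b = h then {Head} else {}))"

text \<open>Labels are prescribed only close to (a, b), since nodes further away may carry error
  pointers. \<open>up\<close> reaches one cell to either side because a head arriving at
  \<open>v\<close> may come from an adjacent cell. \<open>n1\<close> is conditional, as axis 1 may
  end or the machine may have halted.\<close>

lemma encoding_ok_rows:
  fixes f :: "nat \<Rightarrow> nat \<Rightarrow> nat"
  assumes M: "is_lba M" and B: "B \<ge> 2" and k: "k \<in> {2..i}"
    and a: "a \<le> running_time M B" and b: "b < B" and v: "v = f a b"
    and pe: "\<And>j. has_edge E L v (Prev j) \<longleftrightarrow> (j = 1 \<and> a > 0) \<or> (j = k \<and> b > 0)"
    and ne: "has_edge E L v (Next k) \<longleftrightarrow> b + 1 < B"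
    and p1: "a > 0 \<Longrightarrow> z E L v [Prev 1] = Some (f (a - 1) b)"
    and pk: "b > 0 \<Longrightarrow> z E L v [Prev k] = Some (f a (b - 1))"
    and nk: "b + 1 < B \<Longrightarrow> z E L v [Next k] = Some (f a (b + 1))"
    and up: "\<And>b'. a > 0 \<Longrightarrow> b' \<le> b + 1 \<Longrightarrow> b \<le> b' + 1 \<Longrightarrow> b' < B \<Longrightarrow>
        z E L (f a b') [Prev 1] = Some (f (a - 1) b') \<and> out (f (a - 1) b') = row_label M B k (a - 1) b'"
    and out: "\<And>b'. b' \<le> b + 1 \<Longrightarrow> b \<le> b' + 1 \<Longrightarrow> b' < B \<Longrightarrow> out (f a b') = row_label M B k a b'"
    and n1: "\<And>u. z E L v [Next 1] = Some u \<Longrightarrow> a < running_time M B \<Longrightarrow> out u = row_label M B k (a + 1) b"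
  shows "encoding_ok i M E L out v"
proof -
  obtain q tape h where r: "lba_run M B a = (q, tape, h)" by (cases "lba_run M B a") auto
  have hB: "h < B" by (rule lba_head_bound[OF M B r])
  have ov: "out v = {Dimension k, Tape (tape b), State q} \<union> (if b = h then {Head} else {})"
    using out[of b] b v r by (simp add: row_label_def)
  have dim: "Dimension k' \<in> out v \<Longrightarrow> k' = k" for k'
    unfolding ov by (auto split: if_splits)
  have dimr: "Dimension k \<in> row_label M B k a' b'" for a' b'
    unfolding row_label_def by (auto split: prod.splits)
  have nk': "z E L v [Next k] = Some u \<Longrightarrow> b + 1 < B \<and> u = f a (b + 1)" for u
    using ne nk z_single_edge[of E L v "Next k" u] unfolding has_edge_def by force
  have pk': "z E L v [Prev k] = Some u \<Longrightarrow> b > 0 \<and> u = f a (b - 1)" for u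
    using pe[of k] pk z_single_edge[of E L v "Prev k" u] k unfolding has_edge_def by force
  have p1': "z E L v [Prev 1] = Some u \<Longrightarrow> a > 0 \<and> u = f (a - 1) b" for u
    using pe[of 1] p1 z_single_edge[of E L v "Prev 1" u] k unfolding has_edge_def by force
  have outn: "b + 1 < B \<Longrightarrow> out (f a (b + 1)) = row_label M B k a (b + 1)"
    and outp: "b > 0 \<Longrightarrow> out (f a (b - 1)) = row_label M B k a (b - 1)"
    using out[of "b + 1"] out[of "b - 1"] b by auto
  have out1: "a > 0 \<Longrightarrow> out (f (a - 1) b) = row_label M B k (a - 1) b"
    using up[of b] b by simp
  have "out v = {Dimension k, Tape (tape b), State q} \<or> out v = {Dimension k, Tape (tape b), State q, Head}"
    unfolding ov by auto
  then have "LC1 i out v" unfolding LC1_def using k by blast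
  moreover have "LC2 i E L out v" unfolding LC2_def ov using k by auto
  moreover have "LC3 i E L out v"
    unfolding LC3_def
  proof (intro ballI impI)
    fix k' assume "Dimension k' \<in> out v"
    then have [simp]: "k' = k" by (rule dim)
    show "(\<forall>j. has_edge E L v (Prev j) \<longrightarrow> j = 1 \<or> j = k') \<and>
        (\<forall>s\<in>{Prev 1, Prev k', Next k'}. \<forall>u. z E L v [s] = Some u \<longrightarrow> Dimension k' \<in> out u)"
      using pe nk' pk' p1' outn outp out1 dimr by auto
  qed
  moreover have "LC4 i M E L out v"
    unfolding LC4_def
  proof (intro ballI impI)
    fix k' assume "Dimension k' \<in> out v"
    then have [simp]: "k' = k" by (rule dim)
    have final: "q \<noteq> final M \<Longrightarrow> a < running_time M B"
      using lba_halts[OF M B] a r by (cases "a = running_time M B") auto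
    have next1: "q \<noteq> final M \<Longrightarrow> z E L v [Next 1] = Some u \<Longrightarrow> Dimension k \<in> out u" for u
      using n1[of u] final dimr by simp
    have first: "LC4_first M E L out k v" if "a = 0"
    proof -
      have "q = start M" "h = 0"
        "tape = (\<lambda>p. if p = 0 then left_marker M else if p = B - 1 then right_marker M else blank M)"
        using r that by (auto simp: lba_run_def initial_config_def)
      then show ?thesis
        unfolding LC4_first_def using pe[of k] ne k b B next1 by (auto simp: ov)
    qed
    have nxt: "LC4_next M E L out k v p q1 t q' t'"
      if a0: "a > 0" and p: "z E L v [Prev 1] = Some p" and m: "{State q1, Tape t} \<subseteq> out v" "{State q', Tape t'} \<subseteq> out p"
      for p q1 t q' t'
    proof -
      obtain a' where a': "a = Suc a'" using a0 by (cases a) auto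
      obtain q0 tape0 h0 where r0: "lba_run M B a' = (q0, tape0, h0)" by (cases "lba_run M B a'") auto
      have h0: "h0 < B" by (rule lba_head_bound[OF M B r0])
      have p': "p = f a' b" using p1'[OF p] a' by simp
      have op: "out p = {Dimension k, Tape (tape0 b), State q0} \<union> (if b = h0 then {Head} else {})"
        using out1 a' p' r0 by (simp add: row_label_def)
      have eqs: "q1 = q" "t = tape b" "q' = q0" "t' = tape0 b"
        using m unfolding ov op by (auto split: if_splits)
      have nf: "q0 \<noteq> final M" using lba_run_not_final[of a' M B] a a' r0 by simp
      obtain p2 g d where d: "delta M q0 (tape0 h0) = (p2, g, d)" by (cases "delta M q0 (tape0 h0)") auto
      have step: "q = p2" "tape = tape0(h0 := g)" "h = move_head d h0"
        using r r0 nf d unfolding a' by (auto simp: lba_run_Suc)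
      have bnd: "h0 = 0 \<longrightarrow> d \<noteq> Leftward" "h0 = B - 1 \<longrightarrow> d \<noteq> Rightward"
        using M B r0 nf d unfolding is_lba_def by blast+
      have hd: "Head \<in> out p \<longleftrightarrow> b = h0" unfolding op by auto
      show ?thesis
      proof (cases "b = h0")
        case True
        have "\<exists>d. delta M q' t' = (q1, t, d) \<and>
             (case d of
                Stay \<Rightarrow> Head \<in> out v
              | Leftward \<Rightarrow> (\<exists>u. z E L v [Prev k] = Some u \<and> Head \<in> out u)
              | Rightward \<Rightarrow> (\<exists>u. z E L v [Next k] = Some u \<and> Head \<in> out u))"
        proof (intro exI conjI)
          show "delta M q' t' = (q1, t, d)" using d True eqs step by simp
          show "case d of
                Stay \<Rightarrow> Head \<in> out v
              | Leftward \<Rightarrow> (\<exists>u. z E L v [Prev k] = Some u \<and> Head \<in> out u)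
              | Rightward \<Rightarrow> (\<exists>u. z E L v [Next k] = Some u \<and> Head \<in> out u)"
          proof (cases d)
            case Stay
            then show ?thesis using True step by (simp add: ov)
          next
            case Leftward
            then show ?thesis using True step bnd pk outp r by (simp add: row_label_def)
          next
            case Rightward
            then have "b + 1 < B" using True bnd h0 by auto
            then show ?thesis using Rightward True step nk outn r by (simp add: row_label_def)
          qed
        qed
        then show ?thesis unfolding LC4_next_def using hd True nf eqs next1 by simp
      next
        case False
        have "State q \<in> row_label M B k a b'" for b' using r by (simp add: row_label_def)
        then have "\<forall>s\<in>{Prev k, Next k}. \<forall>u. z E L v [s] = Some u \<longrightarrow> State q1 \<in> out u"
          using eqs nk' pk' outn outp by auto
        then show ?thesis unfolding LC4_next_def using hd False nf eqs step next1 by simp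
      qed
    qed
    have "single_head M E L out k v"
      unfolding single_head_def
    proof
      assume "Head \<in> out v"
      then have bh: "b = h" unfolding ov by (auto split: if_splits)
      show "if has_edge E L v (Prev 1) then head_moves_to M E L out k v else \<not> has_edge E L v (Prev k)"
      proof (cases a)
        case 0
        then have "h = 0" using r by (simp add: lba_run_def initial_config_def)
        then show ?thesis using pe[of 1] pe[of k] 0 bh k by auto
      next
        case (Suc a')
        obtain q0 tape0 h0 where r0: "lba_run M B a' = (q0, tape0, h0)" by (cases "lba_run M B a'") auto
        have h0: "h0 < B" by (rule lba_head_bound[OF M B r0])
        have nf: "q0 \<noteq> final M" using lba_run_not_final[of a' M B] a Suc r0 by simp
        obtain p2 g d where d: "delta M q0 (tape0 h0) = (p2, g, d)" by (cases "delta M q0 (tape0 h0)") auto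
        have hh: "h = move_head d h0"
          using r r0 nf d unfolding Suc by (auto simp: lba_run_Suc)
        have bnd: "h0 = 0 \<longrightarrow> d \<noteq> Leftward" "h0 = B - 1 \<longrightarrow> d \<noteq> Rightward"
          using M B r0 nf d unfolding is_lba_def by blast+
        \<comment> \<open>The head moves by at most one cell, so \<open>up\<close> covers the
          witness for \<open>head_moves_to\<close>: the node of the current row at the old head
          position.\<close>
        have near: "h0 \<le> b + 1" "b \<le> h0 + 1" using hh bh by (cases d; auto)+
        have u: "z E L (f a h0) [Prev 1] = Some (f (a - 1) h0)"
          "out (f (a - 1) h0) = row_label M B k (a - 1) h0"
          using up[OF _ near h0] Suc by auto
        have "head_moves_to M E L out k v"
          unfolding head_moves_to_def
        proof (intro exI conjI)
          show "z E L (f a h0) [Prev 1] = Some (f (a - 1) h0)" by (rule u)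
          show "{Head, State q0, Tape (tape0 h0)} \<subseteq> out (f (a - 1) h0)"
            unfolding u(2) using Suc r0 by (simp add: row_label_def)
          show "q0 \<noteq> final M" by (rule nf)
          show "snd (snd (delta M q0 (tape0 h0))) = d" using d by simp
          show "case d of Stay \<Rightarrow> f a h0 = v | Leftward \<Rightarrow> z E L v [Next k] = Some (f a h0)
              | Rightward \<Rightarrow> z E L v [Prev k] = Some (f a h0)"
          proof (cases d)
            case Stay
            then show ?thesis using hh bh v by simp
          next
            case Leftward
            then have "b + 1 = h0" using hh bh bnd by auto
            then show ?thesis using Leftward nk h0 by simp
          next
            case Rightward
            then have "b - 1 = h0" "b > 0" using hh bh by auto
            then show ?thesis using Rightward pk by simp
          qed
        qed
        then show ?thesis using pe[of 1] Suc by simp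
      qed
    qed
    then show "(\<not> has_edge E L v (Prev 1) \<longrightarrow> LC4_first M E L out k' v) \<and>
        (has_edge E L v (Prev 1) \<longrightarrow>
           (\<forall>p q t q' t'. z E L v [Prev 1] = Some p \<and>
              {State q, Tape t} \<subseteq> out v \<and> {State q', Tape t'} \<subseteq> out p \<longrightarrow>
              LC4_next M E L out k' v p q t q' t')) \<and>
        single_head M E L out k' v"
      using first nxt pe[of 1] k by auto
  qed
  ultimately show ?thesis unfolding encoding_ok_def by simp
qed

section \<open>Error pointers\<close>

definition hits :: "nat \<Rightarrow> nat \<Rightarrow> adjacency \<Rightarrow> labelling \<Rightarrow> nat \<Rightarrow> side \<Rightarrow> nat \<Rightarrow> nat \<Rightarrow> bool" where
  "hits i D E L k s a v \<longleftrightarrow> (\<exists>u. z E L v (replicate a s) = Some u \<and> error_within i D E L k u)"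

text \<open>Each node on the way to the nearer error on the chosen axis makes the same choice again: one step
  in this direction shortens this way and lengthens the other one.\<close>

definition prefers_next :: "nat \<Rightarrow> nat \<Rightarrow> adjacency \<Rightarrow> labelling \<Rightarrow> nat \<Rightarrow> nat \<Rightarrow> bool" where
  "prefers_next i D E L k v \<longleftrightarrow>
     (\<exists>a\<le>D. hits i D E L k (Next (i - k)) a v \<and> (\<forall>b<a. \<not> hits i D E L k (Prev (i - k)) b v))"

text \<open>The least level means the largest axis on which a search path can start. Choosing it
  commits the pointer to as late an axis as possible, which fits the rule that axes never
  decrease.\<close>

definition error_side :: "nat \<Rightarrow> nat \<Rightarrow> adjacency \<Rightarrow> labelling \<Rightarrow> nat \<Rightarrow> side" where
  "error_side i D E L v =
     (let k = LEAST k. error_within i D E L (Suc k) v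
      in if prefers_next i D E L k v then Next (i - k) else Prev (i - k))"

context bounded_grid begin

lemma near_Suc_hits: "near (Suc k) v \<longleftrightarrow> (\<exists>a\<le>D. hits i D E L k (Next (i - k)) a v \<or> hits i D E L k (Prev (i - k)) a v)"
  unfolding hits_def by auto

lemma hits_0: "hits i D E L k s 0 v \<longleftrightarrow> near k v"
  unfolding hits_def by simp

lemma hits_Suc: "zz v [s] = Some u \<Longrightarrow> hits i D E L k s (Suc a) v \<longleftrightarrow> hits i D E L k s a u"
  unfolding hits_def using z_Cons[of E L v s "replicate a s"] by simp

lemma hits_Suc_D: "hits i D E L k s (Suc a) v \<Longrightarrow> \<exists>u. zz v [s] = Some u"
  unfolding hits_def using z_rotate[of E L v "[s]" "replicate a s"] by auto

text \<open>The next node finds an error at the same or a smaller least level. A smaller level is a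
  larger axis, which a pointer of type 1 may switch to. At the same level the node must keep the
  side, and the comparison of distances in \<open>prefers_next\<close> gives this.\<close>

lemma error_side_step:
  assumes v: "ok v" "near i v"
  shows "axis_of (error_side i D E L v) \<in> {1..i} \<and>
    (\<exists>u. zz v [error_side i D E L v] = Some u \<and>
       (\<not> ok u \<or> near i u \<and> pointer_continues (error_side i D E L v) 1 (error_side i D E L u) 1))"
proof -
  have i0: "i > 0" using v by (cases i) auto
  then obtain i' where i': "i = Suc i'" by (cases i) auto
  define k where "k = (LEAST k. near (Suc k) v)"
  have nk: "near (Suc k) v" unfolding k_def by (rule LeastI[of _ i']) (use v i' in simp)
  have ki: "k < i"
  proof -
    have "k \<le> i'" unfolding k_def by (rule Least_le) (use v i' in simp)
    then show ?thesis using i' by simp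
  qed
  have nnk: "\<not> near k v"
  proof (cases k)
    case 0
    then show ?thesis using v by simp
  next
    case (Suc l)
    then show ?thesis using not_less_Least[of l "\<lambda>k. near (Suc k) v"] unfolding k_def by simp
  qed
  let ?j = "i - k"
  have cont: "\<not> ok u \<or> near i u \<and> pointer_continues s 1 (error_side i D E L u) 1"
    if s: "axis_of s = ?j" and u: "near (Suc k) u"
      and same: "\<not> near k u \<Longrightarrow> (if prefers_next i D E L k u then Next ?j else Prev ?j) = s" for s u
  proof (cases "ok u")
    case True
    define k' where "k' = (LEAST k. near (Suc k) u)"
    have le: "k' \<le> k" unfolding k'_def by (rule Least_le) (rule u)
    have ax: "axis_of (error_side i D E L u) = i - k'" unfolding error_side_def k'_def by (simp add: Let_def)
    have ni: "near i u" using error_within_mono[OF u] ki by simp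
    have "pointer_continues s 1 (error_side i D E L u) 1"
    proof (cases "near k u")
      case True
      have "k > 0" using True \<open>ok u\<close> by (cases k) auto
      then obtain l where l: "k = Suc l" by (cases k) auto
      have "k' \<le> l" unfolding k'_def by (rule Least_le) (use True l in simp)
      then show ?thesis using ax s ki l unfolding pointer_continues_def by auto
    next
      case False
      have "near (Suc k') u" unfolding k'_def by (rule LeastI) (rule u)
      then have "k' = k" using le False error_within_mono[of i D E L "Suc k'" u k]
        by linarith
      then have "error_side i D E L u = s"
        using same[OF False] unfolding error_side_def k'_def by (simp add: Let_def)
      then show ?thesis unfolding pointer_continues_def by simp
    qed
    then show ?thesis using ni by simp
  qed simp
  show ?thesis
  proof (cases "prefers_next i D E L k v")
    case True
    then have es: "error_side i D E L v = Next ?j" unfolding error_side_def k_def by (simp add: Let_def)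
    obtain a where a: "a \<le> D" "hits i D E L k (Next ?j) a v" "\<forall>b<a. \<not> hits i D E L k (Prev ?j) b v"
      using True unfolding prefers_next_def by blast
    have "a \<noteq> 0" using a(2) nnk hits_0 by metis
    then obtain a' where a': "a = Suc a'" by (cases a) auto
    obtain u where u: "zz v [Next ?j] = Some u" using hits_Suc_D a(2) a' by blast
    have h: "hits i D E L k (Next ?j) a' u" using hits_Suc[OF u] a(2) a' by simp
    have "near (Suc k) u" unfolding near_Suc_hits using h a(1) a' by (metis Suc_leD)
    moreover have "prefers_next i D E L k u" if n: "\<not> near k u"
      unfolding prefers_next_def
    proof (intro exI conjI allI impI)
      show "a' \<le> D" "hits i D E L k (Next ?j) a' u" using a a' h by auto
      fix b assume b: "b < a'"
      have rev_step: "zz u [Prev ?j] = Some v" using ok_back[OF v(1) not_near_ok[OF n] u] by simp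
      show "\<not> hits i D E L k (Prev ?j) b u"
      proof (cases b)
        case 0
        then show ?thesis using n hits_0 by simp
      next
        case (Suc b')
        then show ?thesis using hits_Suc[OF rev_step] a(3) a' b by simp
      qed
    qed
    ultimately show ?thesis using cont[of "Next ?j" u] es u ki by auto
  next
    case False
    then have es: "error_side i D E L v = Prev ?j" unfolding error_side_def k_def by (simp add: Let_def)
    \<comment> \<open>Ties are resolved in favour of \<open>Next\<close>, so here the nearest error
      in direction \<open>Prev\<close> is strictly nearer than any in direction
      \<open>Next\<close>.\<close>
    obtain a where a: "a \<le> D" "hits i D E L k (Prev ?j) a v" "\<forall>b\<le>a. \<not> hits i D E L k (Next ?j) b v"
    proof -
      have "\<exists>a. a \<le> D \<and> hits i D E L k (Prev ?j) a v"
      proof -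
        obtain a where "a \<le> D" "hits i D E L k (Next ?j) a v \<or> hits i D E L k (Prev ?j) a v"
          using nk unfolding near_Suc_hits by blast
        then show ?thesis using False unfolding prefers_next_def by (meson le_trans less_imp_le)
      qed
      then obtain a where a: "a \<le> D \<and> hits i D E L k (Prev ?j) a v"
        "\<forall>b<a. \<not> (b \<le> D \<and> hits i D E L k (Prev ?j) b v)"
        using exists_least_iff[of "\<lambda>a. a \<le> D \<and> hits i D E L k (Prev ?j) a v"] by blast
      have "\<not> hits i D E L k (Next ?j) b v" if "b \<le> a" for b
      proof
        assume "hits i D E L k (Next ?j) b v"
        then have "prefers_next i D E L k v"
          unfolding prefers_next_def using a that by (intro exI[of _ b]) auto
        then show False using False by simp
      qed
      then show thesis using that a by blast
    qed
    have "a \<noteq> 0" using a(2) nnk hits_0 by metis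
    then obtain a' where a': "a = Suc a'" by (cases a) auto
    obtain u where u: "zz v [Prev ?j] = Some u" using hits_Suc_D a(2) a' by blast
    have h: "hits i D E L k (Prev ?j) a' u" using hits_Suc[OF u] a(2) a' by simp
    have "near (Suc k) u" unfolding near_Suc_hits using h a(1) a' by (metis Suc_leD)
    moreover have "\<not> prefers_next i D E L k u" if n: "\<not> near k u"
    proof
      assume "prefers_next i D E L k u"
      then obtain b where b: "hits i D E L k (Next ?j) b u" "\<forall>c<b. \<not> hits i D E L k (Prev ?j) c u"
        unfolding prefers_next_def by blast
      have rev_step: "zz u [Next ?j] = Some v" using ok_back[OF v(1) not_near_ok[OF n] u] by simp
      have "b \<noteq> 0" using b(1) n hits_0 by metis
      then obtain b' where b': "b = Suc b'" by (cases b) auto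
      have "hits i D E L k (Next ?j) b' v" using hits_Suc[OF rev_step] b(1) b' by simp
      then have "b' > a" using a(3) by (meson leI)
      then show False using b(2) h a' b' by auto
    qed
    ultimately show ?thesis using cont[of "Prev ?j" u] es u ki by auto
  qed
qed

end

section \<open>The output rule\<close>

text \<open>The side length of the box along axis j in nodes, with the origin counted, cut off at R
  + 1.\<close>

definition extent :: "nat \<Rightarrow> adjacency \<Rightarrow> labelling \<Rightarrow> nat \<Rightarrow> nat \<Rightarrow> nat" where
  "extent R E L v j = card {a. a \<le> R \<and> (\<exists>u. z E L v (replicate a (Next j)) = Some u)}"

text \<open>The feasible numbers of steps form an initial segment, since a prefix of a path is a
  path; so its cardinality is its maximum plus one.\<close>

lemma less_extent_iff:
  "a < extent R E L v j \<longleftrightarrow> a \<le> R \<and> (\<exists>u. z E L v (replicate a (Next j)) = Some u)"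
proof -
  define S where "S = {a. a \<le> R \<and> (\<exists>u. z E L v (replicate a (Next j)) = Some u)}"
  have fin: "finite S" by (rule finite_subset[of _ "{..R}"]) (auto simp: S_def)
  have ne: "0 \<in> S" by (simp add: S_def)
  have "b \<in> S" if "a \<in> S" "b \<le> a" for a b
  proof -
    have "replicate a (Next j) = replicate b (Next j) @ replicate (a - b) (Next j)"
      using that(2) by (simp flip: replicate_add)
    then show ?thesis using that unfolding S_def by (auto dest: z_rotate)
  qed
  then have "S = {..Max S}" using fin ne by (auto intro: Max_in)
  then have "card S = Suc (Max S)" by (metis card_atMost)
  then have "a < card S \<longleftrightarrow> a \<in> S" using \<open>S = {..Max S}\<close> by (metis atMost_iff less_Suc_eq_le)
  then show ?thesis unfolding extent_def S_def by simp
qed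

lemma extent_le: "extent R E L v j \<le> Suc R"
proof (rule ccontr)
  assume "\<not> extent R E L v j \<le> Suc R"
  then have "Suc R < extent R E L v j" by simp
  then show False unfolding less_extent_iff by simp
qed

text \<open>A shortest axis other than axis 1. The choice depends on \<open>d\<close> alone, so all
  nodes with the same origin make the same one.\<close>

definition tape_axis :: "nat \<Rightarrow> (nat \<Rightarrow> nat) \<Rightarrow> nat" where
  "tape_axis i d = (SOME k. k \<in> {2..i} \<and> (\<forall>l\<in>{2..i}. d k \<le> d l))"

lemma tape_axis:
  assumes "i \<ge> 2" shows "tape_axis i d \<in> {2..i} \<and> (\<forall>l\<in>{2..i}. d (tape_axis i d) \<le> d l)"
proof -
  have "\<exists>k. k \<in> {2..i} \<and> (\<forall>l\<in>{2..i}. d k \<le> d l)"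
    using ex_min_if_finite[of "d ` {2..i}"] assms
    by (metis (no_types, lifting) arg_min_least atLeastAtMost_iff empty_iff finite_atLeastAtMost order_refl arg_min_if_finite(1))
  then show ?thesis unfolding tape_axis_def by (rule someI_ex)
qed

text \<open>The test works with truncated lengths: if \<open>d 1\<close> is strictly smaller than
  another length, it is below the cut-off and hence exact. In the other branch
  \<open>tape_fits\<close> shows that the tape length is exact.\<close>

definition plan :: "nat \<Rightarrow> ('q, 'g) lba \<Rightarrow> (nat \<Rightarrow> nat) \<Rightarrow> (nat \<Rightarrow> nat) \<Rightarrow> ('q, 'g) out_label set" where
  "plan i M d x =
     (if \<forall>k\<in>{2..i}. d 1 < d k
      then if \<forall>j\<in>{1..i}. x j = x 1 then {Unbalanced} else {ExemptU}
      else let k = tape_axis i d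
        in if x 1 \<le> running_time M (d k) \<and> (\<forall>j\<in>{1..i} - {1, k}. x j = 0)
           then row_label M (d k) k (x 1) (x k) else {ExemptM})"

lemma plan_cong:
  assumes "i \<ge> 2" "\<And>j. j \<in> {1..i} \<Longrightarrow> x j = y j" shows "plan i M d x = plan i M d y"
proof -
  have "x 1 = y 1" "x (tape_axis i d) = y (tape_axis i d)"
    using assms tape_axis[OF assms(1), of d] by auto
  moreover have "(\<forall>j\<in>{1..i}. x j = y 1) \<longleftrightarrow> (\<forall>j\<in>{1..i}. y j = y 1)"
    "(\<forall>j\<in>{1..i} - {1, tape_axis i d}. x j = 0) \<longleftrightarrow> (\<forall>j\<in>{1..i} - {1, tape_axis i d}. y j = 0)"
    using assms(2) by auto
  ultimately show ?thesis unfolding plan_def by (simp add: Let_def)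
qed

text \<open>The path is written from \<open>v\<close> back to the origin, since \<open>v\<close> is
  where the search starts. The origin must have no error near it, so that its box is a genuine
  grid.\<close>

definition anchored :: "nat \<Rightarrow> nat \<Rightarrow> nat \<Rightarrow> adjacency \<Rightarrow> labelling \<Rightarrow> nat \<Rightarrow> (nat \<Rightarrow> nat) \<Rightarrow> nat \<Rightarrow> bool" where
  "anchored i K D E L v x og \<longleftrightarrow>
     weight i x \<le> K \<and> z E L v (rev (map opposite (word i x))) = Some og \<and>
     is_origin E L og \<and> \<not> error_within i D E L i og"

text \<open>Labels are collected over all anchors rather than taken from a chosen one: a choice of a
  node would depend on node names, whereas this set is the same in every copy of the neighbourhood.
  By \<open>out_plan\<close> all anchors give the same labels.\<close>

definition rule ::
  "nat \<Rightarrow> ('q, 'g) lba \<Rightarrow> nat \<Rightarrow> nat \<Rightarrow> nat \<Rightarrow> adjacency \<Rightarrow> labelling \<Rightarrow> nat \<Rightarrow> ('q, 'g) out_label set" where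
  "rule i M R K D E L v =
     (if \<not> grid_ok i E L v then {Error}
      else if error_within i D E L i v then {Pointer (error_side i D E L v) 1}
      else if \<exists>x og. anchored i K D E L v x og
      then {l. \<exists>x og. anchored i K D E L v x og \<and> l \<in> plan i M (extent R E L og) x}
      else {ExemptM})"

lemma z_in_nbhd: "z E L v p = Some u \<Longrightarrow> length p \<le> r \<Longrightarrow> u \<in> nbhd E r v"
  using z_imp_relpow unfolding nbhd_def by blast

lemma word_0 [simp]: "word i (\<lambda>_. 0) = []"
  by (simp add: word_def concat_eq_Nil_conv)

lemma weight_0 [simp]: "weight i (\<lambda>_. 0) = 0"
  by (simp add: weight_def)

lemma word_1: "word i (\<lambda>_. 1) = map Next [1..<Suc i]"
proof -
  have "concat (map (\<lambda>j. replicate 1 (Next j)) xs) = map Next xs" for xs by (induction xs) auto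
  then show ?thesis unfolding word_def .
qed

lemma weight_1 [simp]: "weight i (\<lambda>_. Suc 0) = i"
  by (simp add: weight_def)

section \<open>Truncated boxes at an origin\<close>

context quiet_origin begin

lemma coord_axis:
  assumes "zz og (word i x) = Some v" "weight i x \<le> D" "j \<in> {1..i}"
  shows "\<exists>u. zz og (replicate (x j) (Next j)) = Some u"
proof -
  have "zz og (word i x) = zz og (replicate (x j) (Next j) @ word i (x(j := 0)))"
  proof (rule quiet_perm)
    show "quiet (length (word i x) - 1) og"
      using quiet_mono[OF quiet_o] assms(2) by simp
    show "filter (\<lambda>s. axis_of s = k) (word i x) =
      filter (\<lambda>s. axis_of s = k) (replicate (x j) (Next j) @ word i (x(j := 0)))" for k
      using assms(3) by (auto simp: filter_word)
  qed
  then show ?thesis using assms(1) z_rotate by metis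
qed

text \<open>The last hypothesis excludes that the cut-off, and not the end of the axis, bounds the
  extent.\<close>

lemma coord_less_extent:
  assumes "zz og (word i x) = Some v" "weight i x \<le> D" "j \<in> {1..i}"
    and "x j \<le> R \<or> extent R E L og j \<le> R"
  shows "x j < extent R E L og j"
proof (rule ccontr)
  assume "\<not> x j < extent R E L og j"
  then have le: "extent R E L og j \<le> x j" by simp
  obtain u where u: "zz og (replicate (x j) (Next j)) = Some u"
    using coord_axis[OF assms(1-3)] by blast
  have "replicate (x j) (Next j) = replicate (extent R E L og j) (Next j) @ replicate (x j - extent R E L og j) (Next j)"
    using le by (simp flip: replicate_add)
  then obtain w where "zz og (replicate (extent R E L og j) (Next j)) = Some w"
    using u z_rotate by metis
  then have "extent R E L og j < extent R E L og j"
    unfolding less_extent_iff[of "extent R E L og j"] using assms(4) le by auto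
  then show False by simp
qed

lemma coord_has_prev:
  assumes "zz og (word i x) = Some v" "weight i x \<le> D"
  shows "has_edge E L v (Prev j) \<longleftrightarrow> j \<in> {1..i} \<and> x j > 0"
  using coord_prev[OF assms(1) _ assms(2)] coord_pred[OF assms(1) _ _ assms(2)]
    grid_ok_has_edge[OF coord_ok[OF assms]] by blast

lemma coord_has_next:
  assumes "zz og (word i x) = Some v" "weight i x \<le> D" "j \<in> {1..i}"
    and "Suc (x j) \<le> R \<or> extent R E L og j \<le> R"
  shows "has_edge E L v (Next j) \<longleftrightarrow> Suc (x j) < extent R E L og j"
proof -
  have "has_edge E L v (Next j) \<longleftrightarrow> (\<exists>u. zz og (replicate (Suc (x j)) (Next j)) = Some u)"
    unfolding grid_ok_has_edge[OF coord_ok[OF assms(1,2)]] by (rule coord_next_iff[OF assms(1-3)])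
  moreover have "Suc (x j) < extent R E L og j" if n: "has_edge E L v (Next j)"
  proof -
    obtain u where u: "zz v [Next j] = Some u" using n grid_ok_has_edge[OF coord_ok[OF assms(1,2)]] by blast
    show ?thesis
    proof (cases "Suc (x j) \<le> R")
      case True
      then show ?thesis using calculation n less_extent_iff by blast
    next
      case False
      then have e: "extent R E L og j \<le> R" using assms(4) by simp
      have "x j < extent R E L og j" by (rule coord_less_extent[OF assms(1-3)]) (use e in simp)
      with e False have "extent R E L og j = Suc (x j)" by simp
      then show ?thesis using e False by simp
    qed
  qed
  ultimately show ?thesis using less_extent_iff[of "Suc (x j)"] by blast
qed

lemma coord_step:
  assumes "zz og (word i x) = Some v" "weight i x + 1 \<le> D" "(v, u) \<in> E"
  shows "\<exists>y. zz og (word i y) = Some u \<and> weight i y \<le> weight i x + 1"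
proof -
  have "ok v" by (rule coord_ok[OF assms(1)]) (use assms(2) in simp)
  from grid_ok_edge[OF this assms(3)] have u: "zz v [L v u] = Some u" .
  show ?thesis
  proof (cases "L v u")
    case (Prev j)
    have "j \<in> {1..i} \<and> x j > 0 \<and> zz og (word i (x(j := x j - 1))) = Some u"
      by (rule coord_prev[OF assms(1) u[unfolded Prev]]) (use assms(2) in simp)
    then show ?thesis using weight_upd[of j i x "x j - 1"]
      by (intro exI[of _ "x(j := x j - 1)"]) auto
  next
    case (Next j)
    have "j \<in> {1..i} \<and> zz og (word i (x(j := Suc (x j)))) = Some u"
      by (rule coord_next[OF assms(1) u[unfolded Next]]) (use assms(2) in simp)
    then show ?thesis using weight_upd[of j i x "Suc (x j)"]
      by (intro exI[of _ "x(j := Suc (x j))"]) auto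
  qed
qed

lemma extent_ge_2:
  assumes "j \<in> {1..i}" "R \<ge> 1" shows "extent R E L og j \<ge> 2"
proof -
  have "ok og" by (rule quiet_ok[OF quiet_o])
  then have "has_edge E L og (Next j)"
    using assms(1) origin_o unfolding grid_ok_def is_origin_def by blast
  then have "1 < extent R E L og j"
    unfolding less_extent_iff using grid_ok_has_edge[OF \<open>ok og\<close>] assms(2) by simp
  then show ?thesis by simp
qed

text \<open>Different points of the truncated box are different nodes by
  \<open>coord_unique\<close>; \<open>i * R \<le> D\<close> keeps all their words within the quiet
  radius. This is how the number of nodes constrains the side lengths.\<close>

lemma prod_extent_le:
  assumes "finite V" "E \<subseteq> V \<times> V" "og \<in> V" "i * R \<le> D"
  shows "(\<Prod>j=1..i. extent R E L og j) \<le> card V"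
proof -
  let ?B = "PiE {1..i} (\<lambda>j. {..<extent R E L og j})"
  have wt: "weight i x \<le> D" if "x \<in> ?B" for x
  proof -
    have "x j \<le> R" if "j \<in> {1..i}" for j
      using PiE_mem[OF \<open>x \<in> ?B\<close> that] extent_le[of R E L og j] by simp
    then have "weight i x \<le> of_nat (card {1..i}) * R" unfolding weight_def by (intro sum_bounded_above)
    then show ?thesis using assms(4) by simp
  qed
  have "\<exists>v. zz og (word i x) = Some v" if x: "x \<in> ?B" for x
  proof (rule coord_defined[OF wt[OF x]])
    fix j assume "j \<in> {1..i}"
    then have "x j < extent R E L og j" using PiE_mem[OF x] by simp
    then show "\<exists>u. zz og (replicate (x j) (Next j)) = Some u" unfolding less_extent_iff by simp
  qed
  then obtain f where f: "\<And>x. x \<in> ?B \<Longrightarrow> zz og (word i x) = Some (f x)" by metis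
  have "inj_on f ?B"
  proof (rule inj_onI)
    fix x y assume xy: "x \<in> ?B" "y \<in> ?B" "f x = f y"
    have "og = og \<and> (\<forall>j\<in>{1..i}. x j = y j)"
      by (rule coord_unique[OF quiet_o origin_o quiet_o origin_o f[OF xy(1)] _ wt wt])
         (use xy f[OF xy(2)] in auto)
    then show "x = y" using xy by (intro PiE_ext) auto
  qed
  moreover have "f ` ?B \<subseteq> V"
  proof
    fix u assume "u \<in> f ` ?B"
    then obtain x where "zz og (word i x) = Some u" using f by auto
    then have "(og, u) \<in> E\<^sup>*" using z_imp_relpow relpow_imp_rtrancl by blast
    then show "u \<in> V" using assms(2,3) by (induction rule: rtrancl_induct) auto
  qed
  ultimately have "card ?B \<le> card V" using assms(1) by (rule card_inj_on_le)
  then show ?thesis by (simp add: card_PiE)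
qed

end

section \<open>Correctness of the rule\<close>

lemma label_classes:
  "ExemptM \<in> enc_labels i" "Unbalanced \<notin> enc_labels i" "ExemptU \<notin> enc_labels i" "Error \<notin> enc_labels i"
  "Pointer s r \<notin> enc_labels i" "Unbalanced \<in> unb_labels" "ExemptU \<in> unb_labels" "Error \<in> err_labels i"
  "s \<in> sides i \<Longrightarrow> Pointer s (Suc 0) \<in> err_labels i"
  by (auto simp: enc_labels_def unb_labels_def err_labels_def)

lemma plan_unbalanced:
  "\<forall>k\<in>{2..i}. d 1 < d k \<Longrightarrow>
     plan i M d x = (if \<forall>j\<in>{1..i}. x j = x 1 then {Unbalanced} else {ExemptU})"
  unfolding plan_def by (rule if_P)

lemma plan_rows:
  "\<not> (\<forall>k\<in>{2..i}. d 1 < d k) \<Longrightarrow>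
     plan i M d x = (if x 1 \<le> running_time M (d (tape_axis i d)) \<and> (\<forall>j\<in>{1..i} - {1, tape_axis i d}. x j = 0)
       then row_label M (d (tape_axis i d)) (tape_axis i d) (x 1) (x (tape_axis i d)) else {ExemptM})"
  unfolding plan_def Let_def by (rule if_not_P)

text \<open>Exempt labels are forbidden at nodes without \<open>Prev\<close> edges. The point 0 lies
  on the diagonal and at the start of row 0, so neither branch of the plan exempts it.\<close>

lemma plan_zero:
  assumes "i \<ge> 2" "\<forall>j\<in>{1..i}. x j = 0"
  shows "plan i M d x \<noteq> {ExemptM}" "plan i M d x \<noteq> {ExemptU}"
proof -
  have "1 \<in> {1..i}" using assms(1) by simp
  then have c: "\<forall>j\<in>{1..i}. x j = x 1" "x 1 = 0" using assms(2) by metis+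
  have "plan i M d x = {Unbalanced} \<or> (\<exists>B k a b. plan i M d x = row_label M B k a b)"
  proof (cases "\<forall>k\<in>{2..i}. d 1 < d k")
    case True
    show ?thesis unfolding plan_unbalanced[OF True] if_P[OF c(1)] by simp
  next
    case False
    have "x 1 \<le> running_time M (d (tape_axis i d)) \<and> (\<forall>j\<in>{1..i} - {1, tape_axis i d}. x j = 0)"
      using assms(2) c(2) by simp
    then show ?thesis unfolding plan_rows[OF False] if_P[OF \<open>x 1 \<le> _ \<and> _\<close>] by blast
  qed
  moreover have "Dimension k \<in> row_label M B k a b" for B k a b
    by (cases "lba_run M B a") (simp add: row_label_def)
  ultimately show "plan i M d x \<noteq> {ExemptM}" "plan i M d x \<noteq> {ExemptU}" by force+
qed

lemma filter_rev_distinct: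
  "distinct (map f xs) \<Longrightarrow> filter (\<lambda>s. f s = j) (rev xs) = filter (\<lambda>s. f s = j) xs"
proof (induction xs)
  case (Cons a xs)
  have "f a \<notin> f ` set xs" using Cons.prems by simp
  then have "\<forall>x\<in>set xs. f x \<noteq> f a" by (metis imageI)
  then have "filter (\<lambda>s. f s = f a) xs = []" by (simp add: filter_empty_conv)
  then show ?case using Cons by auto
qed simp

text \<open>\<open>R\<close> cuts off side lengths, \<open>K\<close> bounds the words considered
  (coordinates up to \<open>R\<close> and i further steps), and \<open>D > K\<close> keeps these
  words within the region certified by the error search. \<open>room\<close> says that once axis 1
  reaches the cut-off, the run on the tape axis fits into \<open>R\<close> rows.\<close>

locale solver = bounded_grid i E L D
  for i :: nat and E :: adjacency and L :: labelling and D :: nat +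
  fixes M :: "('q, 'g) lba" and R K :: nat and V :: "nat set"
  assumes lba: "is_lba M" and i2: "i \<ge> 2" and T_ge: "\<And>B. B \<ge> 2 \<Longrightarrow> B \<le> running_time M B"
    and fin: "finite V" and EV: "E \<subseteq> V \<times> V" and R1: "R \<ge> 1" and K_def: "K = i * Suc R" and D_ge: "D > K"
    and room: "\<And>d. d \<ge> 2 \<Longrightarrow> Suc R * d ^ (i - 1) \<le> card V \<Longrightarrow> running_time M d < R"
begin

abbreviation out :: "nat \<Rightarrow> ('q, 'g) out_label set" where "out \<equiv> rule i M R K D E L"

text \<open>By \<open>coord_unique\<close> all anchors share the origin and the coordinates on
  {1..i}, so the union in \<open>rule\<close> is over equal sets.\<close>

lemma out_plan:
  assumes og: "is_origin E L og" "\<not> near i og" and v: "zz og (word i x) = Some v" "weight i x \<le> K" "\<not> near i v"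
  shows "out v = plan i M (extent R E L og) x"
proof -
  have a: "anchored i K D E L v x og"
    unfolding anchored_def using og v(2)
      zz_reverse[OF quiet_mono[OF not_near_quiet[OF og(2)]] v(1)] D_ge by simp
  have uniq: "og' = og \<and> (\<forall>j\<in>{1..i}. x' j = x j)" if a': "anchored i K D E L v x' og'" for x' og'
  proof -
    from a' have w: "weight i x' \<le> K" "zz v (rev (map opposite (word i x'))) = Some og'"
      "is_origin E L og'" "\<not> near i og'" unfolding anchored_def by auto
    have "zz og' (rev (map opposite (rev (map opposite (word i x'))))) = Some v"
      by (rule zz_reverse[OF quiet_mono[OF not_near_quiet[OF v(3)]] w(2)]) (use w D_ge in simp)
    then have "zz og' (word i x') = Some v" by (simp add: rev_map comp_def)
    from coord_unique[OF not_near_quiet[OF w(4)] w(3) not_near_quiet[OF og(2)] og(1) this v(1)]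
    show ?thesis using w(1) v(2) D_ge by simp
  qed
  have "out v = {l. \<exists>x og. anchored i K D E L v x og \<and> l \<in> plan i M (extent R E L og) x}"
    unfolding rule_def using a v(3) not_near_ok by auto
  also have "\<dots> = plan i M (extent R E L og) x"
  proof -
    have "plan i M (extent R E L og') x' = plan i M (extent R E L og) x" if "anchored i K D E L v x' og'" for x' og'
      using uniq[OF that] plan_cong[OF i2, of x' x] by simp
    then show ?thesis using a by blast
  qed
  finally show ?thesis .
qed

lemma out_error: "out v \<inter> err_labels i = {} \<Longrightarrow> \<not> near i v"
  unfolding rule_def err_labels_def
  using error_side_step[of v]
  by (cases "error_side i D E L v") (auto simp: sides_def split: if_splits)

lemma out_exempt:
  assumes "ok v" "\<not> is_origin E L v"
  shows "\<exists>j\<in>{1..i}. has_edge E L v (Prev j)"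
proof -
  obtain j where j: "has_edge E L v (Prev j)" using assms(2) unfolding is_origin_def by blast
  then obtain u where u: "zz v [Prev j] = Some u" using grid_ok_has_edge[OF assms(1)] by blast
  have "j \<in> {1..i}" using ok_side[OF assms(1) u] by (auto simp: sides_def)
  with j show ?thesis by blast
qed

end

locale solver_origin = solver i E L D M R K V
  for i :: nat and E :: adjacency and L :: labelling and D :: nat
    and M :: "('q, 'g) lba" and R K :: nat and V :: "nat set" +
  fixes og :: nat
  assumes origin: "is_origin E L og" and far: "\<not> near i og" and ogV: "og \<in> V"

sublocale solver_origin \<subseteq> quiet_origin i E L D og
  by unfold_locales (use origin far not_near_quiet in auto)

context solver_origin begin

abbreviation d :: "nat \<Rightarrow> nat" where "d \<equiv> extent R E L og"

lemma KR: "i * R + i = K" unfolding K_def by simp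

lemma d_prod: "(\<Prod>j=1..i. d j) \<le> card V"
  by (rule prod_extent_le[OF fin EV ogV]) (use KR D_ge in simp)

lemma d_ge: "j \<in> {1..i} \<Longrightarrow> d j \<ge> 2" using extent_ge_2 R1 by blast

text \<open>A node without error label is not near an error, so it follows the plan of the same
  origin, at coordinates reached by at most \<open>r\<close> single steps.\<close>

lemma nbhd_coord:
  assumes v: "zz og (word i x) = Some v" "weight i x + r \<le> K"
    and ne: "\<forall>u\<in>nbhd E r v. out u \<inter> err_labels i = {}" and u: "u \<in> nbhd E r v"
  shows "\<exists>y. zz og (word i y) = Some u \<and> weight i y \<le> weight i x + r \<and> out u = plan i M d y \<and> ok u"
proof -
  from u obtain e where e: "e \<le> r" "(v, u) \<in> E ^^ e" unfolding nbhd_def by blast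
  have "\<exists>y. zz og (word i y) = Some u \<and> weight i y \<le> weight i x + e"
    using e
  proof (induction e arbitrary: u)
    case 0
    then show ?case using v(1) by auto
  next
    case (Suc e)
    then obtain w where w: "(v, w) \<in> E ^^ e" "(w, u) \<in> E" by auto
    from Suc.IH[OF _ w(1)] Suc.prems(1) obtain y where y: "zz og (word i y) = Some w" "weight i y \<le> weight i x + e"
      by auto
    from coord_step[OF y(1) _ w(2)] y(2) Suc.prems(1) v(2) D_ge show ?case by fastforce
  qed
  then obtain y where y: "zz og (word i y) = Some u" "weight i y \<le> weight i x + r" using e(1) by fastforce
  have nu: "\<not> near i u" using out_error ne u by blast
  from out_plan[OF origin far y(1) _ nu] y v(2) not_near_ok[OF nu] show ?thesis by auto
qed

text \<open>If axis 1 is cut off, minimality of \<open>d k\<close> gives the box at least (R+1) * (d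
  k)^(i-1) nodes, and \<open>room\<close> applies. Then \<open>d k\<close> is below \<open>R\<close>
  as well, because a run takes at least as many steps as the tape has cells.\<close>

lemma tape_fits:
  assumes "\<not> (\<forall>k\<in>{2..i}. d 1 < d k)"
  defines "k \<equiv> tape_axis i d"
  shows "k \<in> {2..i}" "d k \<le> d 1" "d k \<le> R" "d 1 \<le> R \<or> running_time M (d k) < R"
proof -
  from tape_axis[OF i2, of d] have k: "k \<in> {2..i}" "\<forall>l\<in>{2..i}. d k \<le> d l" unfolding k_def by auto
  then show "k \<in> {2..i}" by simp
  obtain l where "l \<in> {2..i}" "d l \<le> d 1" using assms(1) by (meson not_less)
  then show dk: "d k \<le> d 1" using k(2) le_trans by blast
  have d1: "d 1 \<le> Suc R" by (rule extent_le)
  have dk2: "d k \<ge> 2" using d_ge k(1) by auto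
  have run: "running_time M (d k) < R" if "d 1 = Suc R"
  proof (rule room[OF dk2])
    have "Suc R * d k ^ (i - 1) = d 1 * (\<Prod>j\<in>{2..i}. d k)" using that by simp
    also have "\<dots> \<le> d 1 * (\<Prod>j\<in>{2..i}. d j)" using k(2) by (intro mult_left_mono prod_mono) auto
    also have "\<dots> = (\<Prod>j=1..i. d j)"
      using i2 prod.atLeast_Suc_atMost[of 1 i d] by (simp add: numeral_2_eq_2)
    also have "\<dots> \<le> card V" by (rule d_prod)
    finally show "Suc R * d k ^ (i - 1) \<le> card V" .
  qed
  then show "d 1 \<le> R \<or> running_time M (d k) < R" using d1 by linarith
  show "d k \<le> R"
  proof (cases "d 1 \<le> R")
    case True
    then show ?thesis using dk by simp
  next
    case False
    then show ?thesis using run d1 T_ge[OF dk2] by simp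
  qed
qed

text \<open>The diagonal ends exactly at the far end of axis 1, where every other axis still
  continues, as required of its last node. Since \<open>d 1\<close> is exact, this end is
  recognised.\<close>

lemma unbalanced_correct:
  assumes U: "\<forall>k\<in>{2..i}. d 1 < d k" and v: "zz og (word i x) = Some v" "weight i x \<le> K" "\<not> near i v"
    and ov: "out v = {Unbalanced}" and ne: "\<forall>u\<in>nbhd E i v. out u \<inter> err_labels i = {}"
  shows "(\<forall>u\<in>nbhd E i v. out u \<subseteq> unb_labels) \<and> (\<forall>u\<in>nbhd E i v. grid_ok i E L u) \<and> unbalance_ok i E L out v"
proof -
  define a where "a = x 1"
  have xa: "\<forall>j\<in>{1..i}. x j = a"
  proof -
    have "P" if "(if P then {Unbalanced :: ('q, 'g) out_label} else {ExemptU}) = {Unbalanced}" for P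
      using that by (simp split: if_splits)
    then show ?thesis
      using ov unfolding out_plan[OF origin far v, unfolded plan_unbalanced[OF U]] a_def .
  qed
  have "2 \<in> {2..i}" using i2 by simp
  then have "d 1 < d 2" using U by blast
  then have d1R: "d 1 \<le> R" using extent_le[of R E L og 2] by linarith
  have one: "1 \<in> {1..i}" using i2 by simp
  have wD: "weight i x \<le> D" using v(2) D_ge by simp
  have ad: "a < d 1" using coord_less_extent[OF v(1) wD one, of R] d1R a_def by simp
  have wx: "weight i x = i * a"
    using weight_cong[of i x "\<lambda>_. a"] xa by (simp add: weight_def)
  have wi: "weight i x + i \<le> K"
  proof -
    have "i * a \<le> i * R" by (rule mult_le_mono2) (use ad d1R in simp)
    then show ?thesis unfolding wx using KR by linarith
  qed
  have nb: "\<exists>y. zz og (word i y) = Some u \<and> weight i y \<le> weight i x + i \<and> out u = plan i M d y \<and> ok u"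
    if "u \<in> nbhd E i v" for u by (rule nbhd_coord[OF v(1) wi ne that])
  have diag: "plan i M d y = {Unbalanced}" if "\<forall>j\<in>{1..i}. y j = b" for y b
    unfolding plan_unbalanced[OF U] by (rule if_P) (metis that one)
  have d1_le: "d 1 \<le> d j" if j: "j \<in> {1..i}" for j
  proof (cases "j = 1")
    case False
    then have "j \<in> {2..i}" using j by auto
    then show ?thesis using U by (simp add: less_imp_le)
  qed simp
  have qv: "quiet D v" by (rule not_near_quiet[OF v(3)])
  let ?up = "map Next [1..<Suc i]" and ?down = "map Prev [1..<Suc i]"
  have up_lift: "\<exists>w. zz u ?up = Some w \<and> zz og (word i (\<lambda>_. Suc b)) = Some w"
    if "zz og (word i (\<lambda>_. b)) = Some u" "Suc b < d 1" for b u
  proof -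
    have "\<exists>w. zz og (word i (\<lambda>_. Suc b)) = Some w"
    proof (rule coord_defined)
      have "Suc b \<le> R" using that(2) d1R by simp
      then have "i * Suc b \<le> i * R" by (rule mult_le_mono2)
      then show "weight i (\<lambda>_. Suc b) \<le> D" using KR D_ge by (simp add: weight_def)
      fix j assume "j \<in> {1..i}"
      then have "Suc b < d j" using that(2) d1_le by fastforce
      then show "\<exists>u. zz og (replicate (Suc b) (Next j)) = Some u" unfolding less_extent_iff by blast
    qed
    then obtain w where w: "zz og (word i (\<lambda>_. Suc b)) = Some w" by blast
    have "zz og (word i (\<lambda>_. b) @ word i (\<lambda>_. 1)) = zz og (word i (\<lambda>_. Suc b))"
    proof (rule quiet_perm)
      have "Suc b \<le> R" using that(2) d1R by simp
      then have "i * Suc b \<le> i * R" by (rule mult_le_mono2)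
      then show "quiet (length (word i (\<lambda>_. b) @ word i (\<lambda>_. 1)) - 1) og"
        using KR D_ge by (intro quiet_mono[OF quiet_o]) (simp add: weight_def)
      show "filter (\<lambda>s. axis_of s = j) (word i (\<lambda>_. b) @ word i (\<lambda>_. 1)) =
         filter (\<lambda>s. axis_of s = j) (word i (\<lambda>_. Suc b))" for j
        by (simp add: filter_word replicate_append_same)
    qed
    then show ?thesis using w that(1) unfolding word_1 by (simp add: z_append del: upt_Suc)
  qed
  have xw: "word i x = word i (\<lambda>_. a)" using xa by (intro word_cong) auto
  have forth: "\<exists>w. zz v ?up = Some w \<and> Unbalanced \<in> out w" if lt: "Suc a < d 1"
  proof -
    obtain w where w: "zz v ?up = Some w" "zz og (word i (\<lambda>_. Suc a)) = Some w"
      using up_lift[of a v] v(1) lt xw by metis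
    have "\<not> near i w" using out_error ne z_in_nbhd[OF w(1), of i] by simp
    moreover have "weight i (\<lambda>_. Suc a) \<le> K" using wi wx by (simp add: weight_def)
    ultimately have "out w = plan i M d (\<lambda>_. Suc a)" using out_plan[OF origin far w(2)] by blast
    then show ?thesis using w(1) diag[of "\<lambda>_. Suc a" "Suc a"] by simp
  qed
  have rev: "\<exists>w. zz v ?down = Some w \<and> Unbalanced \<in> out w" if a0: "a > 0"
  proof -
    obtain b where b: "a = Suc b" using a0 by (cases a) auto
    have "\<exists>u. zz og (word i (\<lambda>_. b)) = Some u"
    proof (rule coord_defined)
      show "weight i (\<lambda>_. b) \<le> D" using wD wx b by (simp add: weight_def)
      fix j assume "j \<in> {1..i}"
      then have "b < d j" using ad b d1_le by fastforce
      then show "\<exists>u. zz og (replicate b (Next j)) = Some u" unfolding less_extent_iff by blast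
    qed
    then obtain u where u: "zz og (word i (\<lambda>_. b)) = Some u" by blast
    from up_lift[OF this] ad b obtain w where w: "zz u ?up = Some w" "zz og (word i (\<lambda>_. Suc b)) = Some w" by auto
    then have wv: "w = v" using v(1) xw b by simp
    have "quiet (length ?up) u"
      by (rule quiet_path[OF quiet_o u]) (use wD D_ge wx b i2 in \<open>simp add: weight_def\<close>)
    then have r: "zz v (rev (map opposite ?up)) = Some u" using zz_reverse w(1) wv by blast
    \<comment> \<open>The reversed path takes the axes in decreasing order, the constraint in
      increasing order; each axis occurs once, so \<open>quiet_perm\<close> identifies them.\<close>
    have "zz v (rev (map opposite ?up)) = zz v ?down"
    proof (rule quiet_perm)
      show "quiet (length (rev (map opposite ?up)) - 1) v"
        by (rule quiet_mono[OF qv]) (use KR D_ge in \<open>simp del: upt_Suc; linarith\<close>)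
      have m: "map opposite ?up = ?down" by simp
      have "distinct (map axis_of ?down)" by (simp add: comp_def del: upt_Suc)
      from filter_rev_distinct[OF this] show "filter (\<lambda>s. axis_of s = j) (rev (map opposite ?up)) = filter (\<lambda>s. axis_of s = j) ?down" for j
        unfolding m by simp
    qed
    then have z: "zz v ?down = Some u" using r by simp
    have "\<not> near i u" using out_error ne z_in_nbhd[OF z, of i] by simp
    moreover have "weight i (\<lambda>_. b) \<le> K" using v(2) wx b by (simp add: weight_def)
    ultimately have "out u = plan i M d (\<lambda>_. b)" using out_plan[OF origin far u] by blast
    then show ?thesis using z diag[of "\<lambda>_. b" b] by simp
  qed
  have hn: "has_edge E L v (Next j) \<longleftrightarrow> Suc a < d j" if j: "j \<in> {1..i}" for j
    using coord_has_next[OF v(1) wD j, of R] xa j ad d1R by simp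
  have hp: "has_edge E L v (Prev j) \<longleftrightarrow> j \<in> {1..i} \<and> a > 0" for j
    using coord_has_prev[OF v(1) wD] xa by auto
  have "unbalance_ok i E L out v"
    unfolding unbalance_ok_def Let_def
  proof (intro conjI impI)
    show "Unbalanced \<in> out v" if "is_origin E L v" using ov by simp
    \<comment> \<open>Start, inner points and end of the diagonal meet the second, the first and the
      third alternative.\<close>
    consider "a = 0" | "a > 0" "Suc a < d 1" | "a > 0" "Suc a = d 1" using ad by linarith
    then show "((\<exists>u. zz v ?down = Some u \<and> Unbalanced \<in> out u) \<and> (\<exists>w. zz v ?up = Some w \<and> Unbalanced \<in> out w)) \<or>
       ((\<exists>w. zz v ?up = Some w \<and> Unbalanced \<in> out w) \<and> (\<forall>j. \<not> has_edge E L v (Prev j))) \<or>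
       ((\<exists>u. zz v ?down = Some u \<and> Unbalanced \<in> out u) \<and> (\<forall>j\<in>{2..i}. has_edge E L v (Next j)) \<and> \<not> has_edge E L v (Next 1))"
    proof cases
      case 1
      have "Suc a < d 1" using d_ge[OF one] 1 by simp
      then show ?thesis using forth hp 1 by blast
    next
      case 2
      then show ?thesis using forth rev by blast
    next
      case 3
      have "\<forall>j\<in>{2..i}. has_edge E L v (Next j)" using 3 U hn by auto
      moreover have "\<not> has_edge E L v (Next 1)" using 3 hn one by simp
      ultimately show ?thesis using rev 3 by blast
    qed
  qed
  moreover have "out u \<subseteq> unb_labels" if "u \<in> nbhd E i v" for u
    using nb[OF that] unfolding plan_unbalanced[OF U] unb_labels_def by (auto split: if_splits)
  ultimately show ?thesis using nb by blast
qed

lemma rows_correct: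
  assumes U: "\<not> (\<forall>k\<in>{2..i}. d 1 < d k)" and v: "zz og (word i x) = Some v" "weight i x \<le> K" "\<not> near i v"
    and ov: "out v \<noteq> {ExemptM}" and ne: "\<forall>u\<in>nbhd E 2 v. out u \<inter> err_labels i = {}"
  shows "(\<forall>u\<in>nbhd E 2 v. out u \<subseteq> enc_labels i) \<and> (\<forall>u\<in>nbhd E 2 v. grid_ok i E L u) \<and> encoding_ok i M E L out v"
proof -
  define k where "k = tape_axis i d"
  note tf = tape_fits[OF U, folded k_def]
  define a b where "a = x 1" and "b = x k"
  have act: "a \<le> running_time M (d k)" "\<forall>j\<in>{1..i} - {1, k}. x j = 0"
    using ov out_plan[OF origin far v, unfolded plan_rows[OF U], folded k_def] unfolding a_def
    by (metis (full_types))+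
  have one: "1 \<in> {1..i}" and kk: "k \<in> {1..i}" and k1: "k \<noteq> 1" using i2 tf(1) by auto
  define pt where "pt a b = (\<lambda>j::nat. if j = 1 then a else if j = k then b else 0)" for a b :: nat
  have pt_simps: "pt a b 1 = a" "pt a b k = b" "j \<noteq> 1 \<Longrightarrow> j \<noteq> k \<Longrightarrow> pt a b j = 0" for a b j
    using k1 by (auto simp: pt_def)
  have pt_upd: "(pt a b)(1 := a') = pt a' b" "(pt a b)(k := b') = pt a b'" for a b a' b'
    using k1 by (auto simp: pt_def)
  have xw: "word i x = word i (pt a b)" "weight i x = weight i (pt a b)"
    using act(2) by (intro word_cong weight_cong; auto simp: pt_def a_def b_def)+
  have wpt: "weight i (pt a b) = a + b" for a b
  proof -
    have "(\<lambda>_. 0)(1 := a, k := b) = pt a b" using k1 by (auto simp: pt_def fun_eq_iff)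
    then show ?thesis
      using weight_upd[OF one, of "\<lambda>_. 0" a] weight_upd[OF kk, of "(\<lambda>_. 0)(1 := a)" b] k1 by simp
  qed
  have wD: "weight i x \<le> D" using v(2) D_ge by simp
  have bd: "b < d k" using coord_less_extent[OF v(1) wD kk, of R] tf(3) b_def by simp
  \<comment> \<open>Either way the next row, if it exists, has index at most \<open>R\<close>, so
    its labels are still governed by the plan.\<close>
  have a_small: "a < R \<or> d 1 \<le> R" using act(1) tf(4) by linarith
  have ad: "a < d 1" using coord_less_extent[OF v(1) wD one, of R] a_small a_def by auto
  have aR: "a \<le> R" using a_small ad by auto
  have KR2: "R + R + 2 \<le> K" using i2 unfolding K_def by (metis (no_types, opaque_lifting) add_2_eq_Suc' add_Suc_right add_Suc_shift mult_2 mult_le_mono1)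
  have wi: "weight i x + 2 \<le> K" using xw wpt aR bd tf(3) KR2 by simp
  have nb: "\<exists>y. zz og (word i y) = Some u \<and> weight i y \<le> weight i x + 2 \<and> out u = plan i M d y \<and> ok u"
    if "u \<in> nbhd E 2 v" for u by (rule nbhd_coord[OF v(1) wi ne that])
  have defd: "\<exists>u. zz og (word i (pt a' b')) = Some u" if "a' < d 1" "b' < d k" for a' b'
  proof (rule coord_defined)
    show "weight i (pt a' b') \<le> D"
      using that extent_le[of R E L og 1] tf(3) KR2 D_ge by (simp add: wpt)
    fix j assume "j \<in> {1..i}"
    then have "pt a' b' j < d j" using that d_ge[of j] by (auto simp: pt_def)
    then show "\<exists>u. zz og (replicate (pt a' b' j) (Next j)) = Some u" unfolding less_extent_iff by blast
  qed
  define f where "f a' b' = the (zz og (word i (pt a' b')))" for a' b'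
  have f: "zz og (word i (pt a' b')) = Some (f a' b')" if "a' < d 1" "b' < d k" for a' b'
    using defd[OF that] by (auto simp: f_def)
  have vf: "v = f a b" using v(1) xw by (simp add: f_def)
  have wle: "weight i (pt a' b') \<le> K" if "a' \<le> R" "b' < d k" for a' b'
    using that tf(3) KR2 by (simp add: wpt)
  have wleD: "weight i (pt a' b') \<le> D" if "a' \<le> R" "b' < d k" for a' b'
    using wle[OF that] D_ge by simp
  have prev1: "zz (f a' b') [Prev 1] = Some (f (a' - 1) b')" if "0 < a'" "a' \<le> R" "a' < d 1" "b' < d k" for a' b'
    using coord_pred[OF f[OF that(3,4)], of 1] that wleD one by (auto simp: pt_simps pt_upd f_def simp del: One_nat_def)
  have prevk: "zz (f a' b') [Prev k] = Some (f a' (b' - 1))" if "0 < b'" "a' \<le> R" "a' < d 1" "b' < d k" for a' b'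
    using coord_pred[OF f[OF that(3,4)], of k] that wleD kk by (auto simp: pt_simps pt_upd f_def)
  have nextk: "zz (f a' b') [Next k] = Some (f a' (b' + 1))" if "a' \<le> R" "a' < d 1" "b' + 1 < d k" for a' b'
  proof -
    have "b' + 1 < d k" "b' < d k" using that by auto
    then show ?thesis
      using coord_pred[OF f[OF that(2) \<open>b' + 1 < d k\<close>], of k] that wleD[OF that(1) \<open>b' + 1 < d k\<close>] kk
      by (auto simp: pt_simps pt_upd f_def)
  qed
  have outf: "out (f a' b') = row_label M (d k) k a' b'"
    if "a' \<le> R" "a' < d 1" "b' < d k" "a' \<le> running_time M (d k)" "f a' b' \<in> nbhd E 2 v" for a' b'
  proof -
    have "\<not> near i (f a' b')" using out_error ne that(5) by blast
    then have "out (f a' b') = plan i M d (pt a' b')"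
      using out_plan[OF origin far f[OF that(2,3)] wle[OF that(1,3)]] by blast
    moreover have "\<forall>j\<in>{1..i} - {1, k}. pt a' b' j = 0" using pt_simps(3) by blast
    ultimately show ?thesis using that(4) unfolding plan_rows[OF U] k_def[symmetric] pt_simps by simp
  qed
  have side_path: "\<exists>p. length p \<le> 1 \<and> zz v p = Some (f a b')" if b': "b' \<le> b + 1" "b \<le> b' + 1" "b' < d k" for b'
  proof -
    consider "b' = b" | "b' = b + 1" | "b' = b - 1" "b > 0" using b' by linarith
    then show ?thesis
    proof cases
      case 1
      then show ?thesis using vf by (intro exI[of _ "[]"]) simp
    next
      case 2
      then show ?thesis using nextk[OF aR ad] b' vf by (intro exI[of _ "[Next k]"]) simp
    next
      case 3
      then show ?thesis using prevk[OF _ aR ad bd] vf by (intro exI[of _ "[Prev k]"]) simp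
    qed
  qed
  have "encoding_ok i M E L out v"
  proof (rule encoding_ok_rows[where f = f and a = a and b = b and B = "d k" and k = k])
    show "is_lba M" "2 \<le> d k" "k \<in> {2..i}" "a \<le> running_time M (d k)" "b < d k" "v = f a b"
      using lba d_ge[OF kk] tf(1) act(1) bd vf by auto
    show "has_edge E L v (Prev j) \<longleftrightarrow> (j = 1 \<and> a > 0) \<or> (j = k \<and> b > 0)" for j
      using coord_has_prev[OF v(1) wD, of j] act(2) one kk a_def b_def by (cases "j = 1 \<or> j = k") auto
    show "has_edge E L v (Next k) \<longleftrightarrow> b + 1 < d k"
      using coord_has_next[OF v(1) wD kk, of R] tf(3) b_def by simp
    show "zz v [Prev 1] = Some (f (a - 1) b)" if "a > 0" using prev1[OF that aR ad bd] vf by simp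
    show "zz v [Prev k] = Some (f a (b - 1))" if "b > 0" using prevk[OF that aR ad bd] vf by simp
    show "zz v [Next k] = Some (f a (b + 1))" if "b + 1 < d k" using nextk[OF aR ad that] vf by simp
    show "zz (f a b') [Prev 1] = Some (f (a - 1) b') \<and> out (f (a - 1) b') = row_label M (d k) k (a - 1) b'"
      if b': "a > 0" "b' \<le> b + 1" "b \<le> b' + 1" "b' < d k" for b'
    proof -
      have pr: "zz (f a b') [Prev 1] = Some (f (a - 1) b')" by (rule prev1[OF b'(1) aR ad b'(4)])
      obtain p where p: "length p \<le> 1" "zz v p = Some (f a b')" using side_path b' by blast
      have "zz v (p @ [Prev 1]) = Some (f (a - 1) b')" using p pr by (simp add: z_append)
      then have "f (a - 1) b' \<in> nbhd E 2 v" by (rule z_in_nbhd) (use p in simp)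
      then show ?thesis using pr outf[of "a - 1" b'] b' aR ad act(1) by simp
    qed
    show "out (f a b') = row_label M (d k) k a b'" if b': "b' \<le> b + 1" "b \<le> b' + 1" "b' < d k" for b'
    proof -
      obtain p where p: "length p \<le> 1" "zz v p = Some (f a b')" using side_path b' by blast
      then have "f a b' \<in> nbhd E 2 v" by (intro z_in_nbhd) auto
      then show ?thesis using outf b' aR ad act(1) by simp
    qed
    show "out u = row_label M (d k) k (a + 1) b" if u: "zz v [Next 1] = Some u" and at: "a < running_time M (d k)" for u
    proof -
      have r: "Suc a \<le> R \<or> d 1 \<le> R" using a_small by auto
      have "has_edge E L v (Next 1)" using z_single_edge[OF u] unfolding has_edge_def by blast
      then have lt: "Suc a < d 1" using coord_has_next[OF v(1) wD one, of R] r a_def by simp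
      have leR: "Suc a \<le> R" using r lt by auto
      have "zz og (word i (pt (Suc a) b)) = Some u"
        using coord_next[OF v(1)[unfolded xw] u] wD xw(2) pt_simps pt_upd by metis
      then have "u = f (Suc a) b" by (simp add: f_def)
      moreover have "u \<in> nbhd E 2 v" by (rule z_in_nbhd[OF u]) simp
      ultimately show ?thesis using outf[OF leR lt bd] at by simp
    qed
  qed
  moreover have "row_label M (d k) k a' b' \<subseteq> enc_labels i" for a' b'
    using tf(1) unfolding row_label_def enc_labels_def by (auto split: prod.splits if_splits)
  then have "plan i M d y \<subseteq> enc_labels i" for y
    unfolding plan_rows[OF U] k_def[symmetric] by (auto simp: enc_labels_def)
  then have "out u \<subseteq> enc_labels i" if "u \<in> nbhd E 2 v" for u
    using nb[OF that] by metis
  ultimately show ?thesis using nb by blast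
qed

end

context solver begin

lemma out_correct:
  assumes vV: "v \<in> V" shows "Pi_correct_at i M E L out v"
proof (cases "ok v")
  case False
  then have "out v = {Error}" unfolding rule_def by simp
  then show ?thesis using False unfolding Pi_correct_at_def
    by (simp add: label_classes)
next
  case okv: True
  show ?thesis
  proof (cases "near i v")
    case True
    then have ov: "out v = {Pointer (error_side i D E L v) 1}" using okv unfolding rule_def by simp
    from error_side_step[OF okv True] obtain u where u: "axis_of (error_side i D E L v) \<in> {1..i}"
      "zz v [error_side i D E L v] = Some u"
      "\<not> ok u \<or> near i u \<and> pointer_continues (error_side i D E L v) 1 (error_side i D E L u) 1" by blast
    have s: "error_side i D E L v \<in> sides i" using u(1) by (cases "error_side i D E L v") (auto simp: sides_def)
    have "Error \<in> out u \<or> (\<exists>s' r'. Pointer s' r' \<in> out u \<and> pointer_continues (error_side i D E L v) 1 s' r')"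
      using u(3) unfolding rule_def by auto
    then show ?thesis using ov okv u(2) s unfolding Pi_correct_at_def
      by (simp add: label_classes)
  next
    case far: False
    show ?thesis
    proof (cases "\<exists>x og. anchored i K D E L v x og")
      case False
      then have ov: "out v = {ExemptM}" using okv far unfolding rule_def by simp
      have "\<not> is_origin E L v"
      proof
        assume "is_origin E L v"
        then have "anchored i K D E L v (\<lambda>_. 0) v" unfolding anchored_def using far by simp
        then show False using False by blast
      qed
      then have "\<exists>j\<in>{1..i}. has_edge E L v (Prev j)" using out_exempt[OF okv] by simp
      then show ?thesis using ov okv unfolding Pi_correct_at_def by (simp add: label_classes)
    next
      case True
      then obtain x og where a: "weight i x \<le> K" "zz v (rev (map opposite (word i x))) = Some og"
        "is_origin E L og" "\<not> near i og" unfolding anchored_def by blast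
      have "zz og (rev (map opposite (rev (map opposite (word i x))))) = Some v"
        by (rule zz_reverse[OF quiet_mono[OF not_near_quiet[OF far]] a(2)]) (use a D_ge in simp)
      then have x: "zz og (word i x) = Some v" by (simp add: rev_map comp_def)
      have "(v, og) \<in> E\<^sup>*" using z_imp_relpow[OF a(2)] relpow_imp_rtrancl by blast
      then have "og \<in> V" using vV EV by (induction rule: rtrancl_induct) auto
      then interpret O: solver_origin i E L D M R K V og by unfold_locales (use a in auto)
      have ov: "out v = plan i M O.d x" by (rule out_plan[OF a(3,4) x a(1) far])
      have exempt: "\<exists>j\<in>{1..i}. has_edge E L v (Prev j)" if "out v = {ExemptM} \<or> out v = {ExemptU}"
      proof -
        have "\<not> is_origin E L v"
        proof
          assume "is_origin E L v"
          then have "\<not> has_edge E L v (Prev j)" for j unfolding is_origin_def by blast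
          then have x0: "\<forall>j\<in>{1..i}. x j = 0" using O.coord_has_prev[OF x] a(1) D_ge by auto
          then show False using that ov plan_zero[OF i2 x0, of M O.d] by simp
        qed
        then show ?thesis using out_exempt[OF okv] by blast
      qed
      show ?thesis
      proof (cases "\<forall>k\<in>{2..i}. O.d 1 < O.d k")
        case True
        then have "out v = {Unbalanced} \<or> out v = {ExemptU}" using ov unfolding plan_unbalanced[OF True] by presburger
        then show ?thesis
        proof
          assume u: "out v = {Unbalanced}"
          have "(\<exists>u\<in>nbhd E i v. out u \<inter> err_labels i \<noteq> {}) \<or>
            ((\<forall>u\<in>nbhd E i v. out u \<subseteq> unb_labels) \<and> (\<forall>u\<in>nbhd E i v. grid_ok i E L u) \<and> unbalance_ok i E L out v)"
            using O.unbalanced_correct[OF True x a(1) far u] by blast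
          then show ?thesis using u okv unfolding Pi_correct_at_def
            by (simp add: label_classes)
        next
          assume u: "out v = {ExemptU}"
          then show ?thesis using exempt okv unfolding Pi_correct_at_def
            by (simp add: label_classes)
        qed
      next
        case False
        show ?thesis
        proof (cases "out v = {ExemptM}")
          case True
          then show ?thesis using exempt okv unfolding Pi_correct_at_def by (simp add: label_classes)
        next
          case ne: False
          have c: "(\<exists>u\<in>nbhd E 2 v. out u \<inter> err_labels i \<noteq> {}) \<or>
            ((\<forall>u\<in>nbhd E 2 v. out u \<subseteq> enc_labels i) \<and> (\<forall>u\<in>nbhd E 2 v. grid_ok i E L u) \<and> encoding_ok i M E L out v)"
            using O.rows_correct[OF False x a(1) far ne] by blast
          have "out v = row_label M (O.d (tape_axis i O.d)) (tape_axis i O.d) (x 1) (x (tape_axis i O.d))"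
            using ne ov unfolding plan_rows[OF False] by presburger
          then have sub: "out v \<subseteq> range Tape \<union> range State \<union> {Head} \<union> Dimension ` {2..i}" "out v \<noteq> {}"
            using tape_axis[OF i2, of O.d] unfolding row_label_def by (auto split: prod.splits if_splits)
          then have "out v \<subseteq> enc_labels i - {ExemptM}" unfolding enc_labels_def by auto
          moreover have "Error \<notin> out v" "ExemptU \<notin> out v" "ExemptM \<notin> out v" "Unbalanced \<notin> out v"
            "\<And>s r. Pointer s r \<notin> out v" using sub(1) by auto
          ultimately show ?thesis using c okv sub(2) unfolding Pi_correct_at_def by auto
        qed
      qed
    qed
  qed
qed

end

section \<open>Locality of the rule\<close>

text \<open>The rule asks only which label paths exist and whether their ends are valid. Equal
  answers up to length \<open>T\<close> therefore suffice, and no isomorphism of balls has to be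
  constructed.\<close>

definition same_view ::
  "nat \<Rightarrow> nat \<Rightarrow> adjacency \<Rightarrow> labelling \<Rightarrow> nat \<Rightarrow> adjacency \<Rightarrow> labelling \<Rightarrow> nat \<Rightarrow> bool" where
  "same_view i T E L v E' L' v' \<longleftrightarrow>
     (\<forall>p. length p \<le> T \<longrightarrow> map_option (grid_ok i E L) (z E L v p) = map_option (grid_ok i E' L') (z E' L' v' p))"

lemma same_view_sym: "same_view i T E L v E' L' v' \<Longrightarrow> same_view i T E' L' v' E L v"
  unfolding same_view_def by simp

lemma same_view_ok: "same_view i T E L v E' L' v' \<Longrightarrow> grid_ok i E L v \<longleftrightarrow> grid_ok i E' L' v'"
  unfolding same_view_def by (auto dest: spec[of _ "[]"])

lemma same_view_mono: "same_view i T E L v E' L' v' \<Longrightarrow> S \<le> T \<Longrightarrow> same_view i S E L v E' L' v'"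
  unfolding same_view_def by auto

lemma same_view_step:
  assumes "same_view i T E L v E' L' v'" "z E L v p = Some u" "length p + S \<le> T"
  shows "\<exists>u'. z E' L' v' p = Some u' \<and> same_view i S E L u E' L' u'"
proof -
  have "map_option (grid_ok i E L) (z E L v p) = map_option (grid_ok i E' L') (z E' L' v' p)"
    using assms(1,3) unfolding same_view_def by simp
  then obtain u' where u': "z E' L' v' p = Some u'" using assms(2) by (cases "z E' L' v' p") auto
  have "map_option (grid_ok i E L) (z E L u q) = map_option (grid_ok i E' L') (z E' L' u' q)" if "length q \<le> S" for q
  proof -
    have "map_option (grid_ok i E L) (z E L v (p @ q)) = map_option (grid_ok i E' L') (z E' L' v' (p @ q))"
      using assms(1,3) that unfolding same_view_def by simp
    then show ?thesis using assms(2) u' by (simp add: z_append)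
  qed
  then show ?thesis using u' unfolding same_view_def by blast
qed

lemma same_view_near:
  "same_view i (k * D) E L v E' L' v' \<Longrightarrow> error_within i D E L k v \<longleftrightarrow> error_within i D E' L' k v'"
proof -
  have "same_view i (k * D) E L v E' L' v' \<Longrightarrow> error_within i D E L k v \<Longrightarrow> error_within i D E' L' k v'"
    for E L v E' L' v'
  proof (induction k arbitrary: v v')
    case 0
    then show ?case using same_view_ok by force
  next
    case (Suc k)
    then obtain a s u where a: "a \<le> D" "s \<in> {Next (i - k), Prev (i - k)}"
      "z E L v (replicate a s) = Some u" "error_within i D E L k u" by auto
    obtain u' where u': "z E' L' v' (replicate a s) = Some u'" "same_view i (k * D) E L u E' L' u'"
      using same_view_step[OF Suc.prems(1) a(3), of "k * D"] a(1) by auto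
    then have "error_within i D E' L' k u'" using Suc.IH a(4) by blast
    then show ?case using u'(1) a(1,2) unfolding error_within.simps by blast
  qed
  then show "same_view i (k * D) E L v E' L' v' \<Longrightarrow> error_within i D E L k v \<longleftrightarrow> error_within i D E' L' k v'"
    using same_view_sym by blast
qed

lemma same_view_near':
  "same_view i T E L v E' L' v' \<Longrightarrow> k * D \<le> T \<Longrightarrow> error_within i D E L k v \<longleftrightarrow> error_within i D E' L' k v'"
  using same_view_near same_view_mono by blast

lemma same_view_hits:
  assumes "same_view i T E L v E' L' v'" "a + k * D \<le> T"
  shows "hits i D E L k s a v \<longleftrightarrow> hits i D E' L' k s a v'"
proof -
  have "hits i D E' L' k s a v'" if sv: "same_view i T E L v E' L' v'" "hits i D E L k s a v" for E L v E' L' v'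
  proof -
    obtain u where u: "z E L v (replicate a s) = Some u" "error_within i D E L k u" using sv(2) unfolding hits_def by blast
    obtain u' where "z E' L' v' (replicate a s) = Some u'" "same_view i (k * D) E L u E' L' u'"
      using same_view_step[OF sv(1) u(1), of "k * D"] assms(2) by auto
    then show ?thesis using u(2) same_view_near unfolding hits_def by blast
  qed
  then show ?thesis using assms(1) same_view_sym by blast
qed

lemma same_view_prefers_next:
  assumes "same_view i T E L v E' L' v'" "D + k * D \<le> T"
  shows "prefers_next i D E L k v \<longleftrightarrow> prefers_next i D E' L' k v'"
proof -
  have "hits i D E L k s a v \<longleftrightarrow> hits i D E' L' k s a v'" if "a \<le> D" for a s
    by (rule same_view_hits[OF assms(1)]) (use assms(2) that in simp)
  then show ?thesis unfolding prefers_next_def by (meson less_imp_le le_trans)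
qed

lemma same_view_error_side:
  assumes "same_view i T E L v E' L' v'" "D + i * D \<le> T" "error_within i D E L i v" "grid_ok i E L v"
  shows "error_side i D E L v = error_side i D E' L' v'"
proof -
  have eq: "error_within i D E L (Suc k) v \<longleftrightarrow> error_within i D E' L' (Suc k) v'" if "k < i" for k
  proof (rule same_view_near'[OF assms(1)])
    have "Suc k * D \<le> i * D" using that by (intro mult_le_mono1) simp
    then show "Suc k * D \<le> T" using assms(2) by linarith
  qed
  obtain i' where i': "i = Suc i'" using assms(3,4) by (cases i) auto
  define k where "k = (LEAST k. error_within i D E L (Suc k) v)"
  have k: "error_within i D E L (Suc k) v" unfolding k_def by (rule LeastI[of _ i']) (use assms i' in simp)
  have ki: "k < i" using Least_le[of "\<lambda>k. error_within i D E L (Suc k) v" i'] assms(3) i' unfolding k_def by simp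
  have "(LEAST k. error_within i D E' L' (Suc k) v') = k"
  proof (rule Least_equality)
    show "error_within i D E' L' (Suc k) v'" using eq[OF ki] k by simp
    show "k \<le> l" if l: "error_within i D E' L' (Suc l) v'" for l
    proof (rule ccontr)
      assume "\<not> k \<le> l"
      then have "error_within i D E L (Suc l) v" "l < k" using eq[of l] l ki by auto
      then show False using not_less_Least unfolding k_def by blast
    qed
  qed
  moreover have "prefers_next i D E L k v \<longleftrightarrow> prefers_next i D E' L' k v'"
  proof (rule same_view_prefers_next[OF assms(1)])
    have "k * D \<le> i * D" using ki by (intro mult_le_mono1) simp
    then show "D + k * D \<le> T" using assms(2) by linarith
  qed
  ultimately show ?thesis unfolding error_side_def k_def[symmetric] by simp
qed

lemma same_view_extent:
  assumes "same_view i T E L v E' L' v'" "R \<le> T" shows "extent R E L v = extent R E' L' v'"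
proof
  fix j
  have "(\<exists>u. z E L v (replicate a (Next j)) = Some u) \<longleftrightarrow> (\<exists>u. z E' L' v' (replicate a (Next j)) = Some u)"
    if "a \<le> R" for a
    using same_view_step[OF assms(1), of "replicate a (Next j)" _ 0]
      same_view_step[OF same_view_sym[OF assms(1)], of "replicate a (Next j)" _ 0] that assms(2) by auto
  then show "extent R E L v j = extent R E' L' v' j" unfolding extent_def by (metis (no_types, lifting))
qed

lemma same_view_anchored:
  assumes "same_view i T E L v E' L' v'" "K + i * D + R + 1 \<le> T" "anchored i K D E L v x og"
  shows "\<exists>og'. anchored i K D E' L' v' x og' \<and> extent R E' L' og' = extent R E L og"
proof -
  from assms(3) have a: "weight i x \<le> K" "z E L v (rev (map opposite (word i x))) = Some og"
    "is_origin E L og" "\<not> error_within i D E L i og" unfolding anchored_def by auto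
  obtain og' where o: "z E' L' v' (rev (map opposite (word i x))) = Some og'"
    "same_view i (i * D + R + 1) E L og E' L' og'"
    using same_view_step[OF assms(1) a(2), of "i * D + R + 1"] a(1) assms(2) by auto
  have n: "\<not> error_within i D E' L' i og'" using same_view_near'[OF o(2)] a(4) by simp
  \<comment> \<open>Being an origin is about edges, while views speak of paths; at valid nodes the
    two agree by \<open>grid_ok_has_edge\<close>.\<close>
  have ok: "grid_ok i E L og" "grid_ok i E' L' og'"
    using a(4) n error_within_mono[of i D E L 0 og i] error_within_mono[of i D E' L' 0 og' i] by auto
  have "\<not> has_edge E' L' og' (Prev j)" for j
  proof
    assume "has_edge E' L' og' (Prev j)"
    then obtain u where "z E' L' og' [Prev j] = Some u" using grid_ok_has_edge[OF ok(2)] by blast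
    then have "\<exists>u. z E L og [Prev j] = Some u"
      using same_view_step[OF same_view_sym[OF o(2)], of "[Prev j]" u 0] by auto
    then show False using a(3) grid_ok_has_edge[OF ok(1)] unfolding is_origin_def by blast
  qed
  then have "anchored i K D E' L' v' x og'" unfolding anchored_def is_origin_def using a(1) o(1) n by blast
  moreover have "extent R E' L' og' = extent R E L og" using same_view_extent[OF o(2)] by simp
  ultimately show ?thesis by blast
qed

text \<open>The first bound pays for \<open>K\<close> steps to an origin and for the questions asked
  there: the error search of depth \<open>i * D\<close>, the extents, and \<open>Prev\<close> edges.
  The second pays for \<open>error_side\<close>, which compares errors up to \<open>D\<close> steps
  away.\<close>

lemma same_view_rule:
  assumes s: "same_view i T E L v E' L' v'" and T: "K + i * D + R + 1 \<le> T" "D + i * D \<le> T"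
  shows "rule i M R K D E L v = rule i M R K D E' L' v'"
proof -
  note s' = same_view_sym[OF s]
  have n: "error_within i D E L i v \<longleftrightarrow> error_within i D E' L' i v'" by (rule same_view_near'[OF s]) (use T in simp)
  have ok: "grid_ok i E L v \<longleftrightarrow> grid_ok i E' L' v'" by (rule same_view_ok[OF s])
  have "(\<exists>x og. anchored i K D E L v x og) \<longleftrightarrow> (\<exists>x og. anchored i K D E' L' v' x og)"
    using same_view_anchored[OF s T(1)] same_view_anchored[OF s' T(1)] by blast
  moreover have "(\<exists>x og. anchored i K D E L v x og \<and> l \<in> plan i M (extent R E L og) x) \<longleftrightarrow>
    (\<exists>x og. anchored i K D E' L' v' x og \<and> l \<in> plan i M (extent R E' L' og) x)" for l
    using same_view_anchored[OF s T(1)] same_view_anchored[OF s' T(1)] by metis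
  moreover have "error_side i D E L v = error_side i D E' L' v'"
    if "grid_ok i E L v" "error_within i D E L i v" by (rule same_view_error_side[OF s T(2) that(2,1)])
  ultimately show ?thesis unfolding rule_def using n ok by auto
qed

section \<open>The graph reconstructed from the gathered edges\<close>

definition view_edges :: "(nat \<times> side \<times> nat) set \<Rightarrow> adjacency" where
  "view_edges K = {(a, b). \<exists>s. (a, s, b) \<in> K}"

definition view_label :: "(nat \<times> side \<times> nat) set \<Rightarrow> labelling" where
  "view_label K a b = (THE s. (a, s, b) \<in> K)"

text \<open>\<open>f\<close> maps nodes to identifiers and \<open>K\<close> is the set of gathered
  triples. The reconstructed graph is faithful only at \<open>seen\<close> nodes, whose incident
  edges are all in \<open>K\<close>.\<close>

locale view_iso =
  fixes V :: "nat set" and E :: adjacency and L :: labelling and f :: "nat \<Rightarrow> nat" and K :: "(nat \<times> side \<times> nat) set"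
  assumes EV: "E \<subseteq> V \<times> V" and sym_E: "sym E" and inj: "inj_on f V"
begin

definition seen :: "nat \<Rightarrow> bool" where
  "seen u \<longleftrightarrow> u \<in> V \<and> (\<forall>s b. (f u, s, b) \<in> K \<longleftrightarrow> (\<exists>w. (u, w) \<in> E \<and> s = L u w \<and> b = f w))"

abbreviation E' :: adjacency where "E' \<equiv> view_edges K"
abbreviation L' :: labelling where "L' \<equiv> view_label K"

lemma view_edge: "seen u \<Longrightarrow> (f u, b) \<in> E' \<longleftrightarrow> (\<exists>w. (u, w) \<in> E \<and> b = f w)"
  unfolding seen_def view_edges_def by auto

lemma view_label:
  assumes "seen u" "(u, w) \<in> E" shows "L' (f u) (f w) = L u w"
  unfolding view_label_def
proof (rule the_equality)
  show "(f u, L u w, f w) \<in> K" using assms unfolding seen_def by auto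
  fix s assume "(f u, s, f w) \<in> K"
  then obtain w' where "(u, w') \<in> E" "s = L u w'" "f w = f w'" using assms unfolding seen_def by auto
  moreover have "w \<in> V" "w' \<in> V" using EV assms(2) calculation by auto
  ultimately show "s = L u w" using inj by (metis inj_onD)
qed

lemma view_edge_label: "seen u \<Longrightarrow> (f u, b) \<in> E' \<and> L' (f u) b = s \<longleftrightarrow> (\<exists>w. (u, w) \<in> E \<and> L u w = s \<and> b = f w)"
  using view_edge view_label by metis

lemma f_eq: "(u, w) \<in> E \<Longrightarrow> (u', w') \<in> E \<Longrightarrow> f w = f w' \<longleftrightarrow> w = w'"
  using inj EV by (metis inj_on_contraD mem_Sigma_iff subsetD)

lemma view_z1:
  assumes "seen u" shows "z E' L' (f u) [s] = map_option f (z E L u [s])"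
proof (cases "z E L u [s]")
  case (Some w)
  then have "\<forall>x. (u, x) \<in> E \<and> L u x = s \<longleftrightarrow> x = w" by (simp add: z_single_iff)
  then have "z E' L' (f u) [s] = Some (f w)" unfolding z_single_iff view_edge_label[OF assms] by metis
  then show ?thesis using Some by simp
next
  case None
  have "z E' L' (f u) [s] = None"
  proof (rule ccontr)
    assume "z E' L' (f u) [s] \<noteq> None"
    then obtain b where b: "z E' L' (f u) [s] = Some b" by blast
    then have b': "\<forall>x. (\<exists>w. (u, w) \<in> E \<and> L u w = s \<and> x = f w) \<longleftrightarrow> x = b"
      unfolding z_single_iff view_edge_label[OF assms] by simp
    then obtain w where w: "(u, w) \<in> E" "L u w = s" "b = f w" by blast
    have "z E L u [s] = Some w" unfolding z_single_iff using b' w f_eq by metis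
    then show False using None by simp
  qed
  then show ?thesis using None by simp
qed

lemma view_grid_ok:
  assumes u: "seen u" and w: "\<And>w. (u, w) \<in> E \<Longrightarrow> seen w"
  shows "grid_ok i E' L' (f u) \<longleftrightarrow> grid_ok i E L u"
proof -
  let ?X = "E `` {u}"
  have nb: "E' `` {f u} = f ` ?X" using view_edge[OF u] by auto
  have lab: "L' (f u) (f x) = L u x" if "x \<in> ?X" for x using view_label[OF u] that by auto
  have rlab: "L' (f x) (f u) = L x u" if "x \<in> ?X" for x
    using view_label[OF w, of x u] that sym_E by (auto dest: symD)
  have "inj_on (L' (f u)) (f ` ?X) \<longleftrightarrow> inj_on (L u) ?X"
    using lab f_eq unfolding inj_on_def by auto
  moreover have "has_edge E' L' (f u) s \<longleftrightarrow> has_edge E L u s" for s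
    unfolding has_edge_def view_edge_label[OF u] by blast
  moreover have "(\<forall>x\<in>f ` ?X. L' (f u) x \<in> sides i) \<longleftrightarrow> (\<forall>x\<in>?X. L u x \<in> sides i)" using lab by auto
  moreover have "(\<forall>x\<in>f ` ?X. L' x (f u) = opposite (L' (f u) x)) \<longleftrightarrow> (\<forall>x\<in>?X. L x u = opposite (L u x))"
    using lab rlab by auto
  moreover have "z E' L' (f x) [L' (f u) (f y)] \<noteq> None \<and> z E' L' (f x) [L' (f u) (f y)] = z E' L' (f y) [L' (f u) (f x)] \<longleftrightarrow>
     z E L x [L u y] \<noteq> None \<and> z E L x [L u y] = z E L y [L u x]" if xy: "x \<in> ?X" "y \<in> ?X" for x y
  proof -
    have e: "z E' L' (f x) [L' (f u) (f y)] = map_option f (z E L x [L u y])"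
      "z E' L' (f y) [L' (f u) (f x)] = map_option f (z E L y [L u x])"
      using view_z1 w xy lab by auto
    show ?thesis unfolding e
      using z_single_edge[of E L x "L u y"] z_single_edge[of E L y "L u x"] f_eq
      by (cases "z E L x [L u y]"; cases "z E L y [L u x]") auto
  qed
  then have "(\<forall>x\<in>f ` ?X. \<forall>y\<in>f ` ?X. axis_of (L' (f u) x) \<noteq> axis_of (L' (f u) y) \<longrightarrow>
        z E' L' x [L' (f u) y] \<noteq> None \<and> z E' L' x [L' (f u) y] = z E' L' y [L' (f u) x]) \<longleftrightarrow>
      (\<forall>x\<in>?X. \<forall>y\<in>?X. axis_of (L u x) \<noteq> axis_of (L u y) \<longrightarrow>
        z E L x [L u y] \<noteq> None \<and> z E L x [L u y] = z E L y [L u x])"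
    using lab by simp
  ultimately show ?thesis unfolding grid_ok_def nb by presburger
qed

text \<open>The extra unit of distance is due to validity, which involves steps that start at
  neighbours of the node.\<close>

lemma view_same:
  assumes "\<And>d u. d \<le> Suc T \<Longrightarrow> (v, u) \<in> E ^^ d \<Longrightarrow> seen u"
  shows "same_view i T E L v E' L' (f v)"
proof -
  have zp: "z E' L' (f u) p = map_option f (z E L u p)" if "(v, u) \<in> E ^^ d" "d + length p \<le> T" for u p d
    using that
  proof (induction p arbitrary: u d)
    case (Cons s p)
    have s: "z E' L' (f u) [s] = map_option f (z E L u [s])" by (rule view_z1[OF assms[of d]]) (use Cons.prems in auto)
    show ?case
    proof (cases "z E L u [s]")
      case None
      then show ?thesis using s z_Cons[of E L u s p] z_Cons[of E' L' "f u" s p] by simp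
    next
      case (Some w)
      have "(v, w) \<in> E ^^ Suc d" using Cons.prems(1) z_single_edge[OF Some] by auto
      from Cons.IH[OF this] Cons.prems(2)
      show ?thesis using Some s z_Cons[of E L u s p] z_Cons[of E' L' "f u" s p] by simp
    qed
  qed simp
  show ?thesis
    unfolding same_view_def
  proof (intro allI impI)
    fix p :: "side list" assume p: "length p \<le> T"
    have zz: "z E' L' (f v) p = map_option f (z E L v p)" by (rule zp[of v 0]) (use p in auto)
    show "map_option (grid_ok i E L) (z E L v p) = map_option (grid_ok i E' L') (z E' L' (f v) p)"
    proof (cases "z E L v p")
      case (Some u)
      have r: "(v, u) \<in> E ^^ length p" by (rule z_imp_relpow[OF Some])
      have "grid_ok i E' L' (f u) \<longleftrightarrow> grid_ok i E L u"
      proof (rule view_grid_ok)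
        show "seen u" by (rule assms[OF _ r]) (use p in simp)
        fix w assume "(u, w) \<in> E"
        then have "(v, w) \<in> E ^^ Suc (length p)" using r by auto
        then show "seen w" by (rule assms[rotated]) (use p in simp)
      qed
      then show ?thesis using zz Some by simp
    qed (use zz in simp)
  qed
qed

end

section \<open>The algorithm as a whole\<close>

instance side :: countable
  by countable_datatype

text \<open>This is K + (i+1) * D + R + 1 for K = i * (R+1) and D = K + 1, which meets both bounds
  of \<open>same_view_rule\<close> and is linear in \<open>R\<close>.\<close>

definition radius :: "nat \<Rightarrow> nat \<Rightarrow> nat" where
  "radius i R = i * Suc R + Suc i * Suc (i * Suc R) + R + 1"

lemma not_grid_ok_isolated:
  assumes "i \<ge> 2" "E `` {v} = {}" shows "\<not> grid_ok i E L v"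
proof
  assume "grid_ok i E L v"
  moreover have "1 \<in> {1..i}" using assms(1) by simp
  ultimately have "has_edge E L v (Prev 1) \<or> has_edge E L v (Next 1)" unfolding grid_ok_def by blast
  then show False using assms(2) unfolding has_edge_def by auto
qed

lemma solvable_in_radius:
  fixes M :: "('q, 'g) lba"
  assumes i2: "i \<ge> 2" and lba: "is_lba M" and T_ge: "\<And>B. B \<ge> 2 \<Longrightarrow> B \<le> running_time M B"
    and R1: "\<And>n. R n \<ge> 1"
    and room: "\<And>n d. d \<ge> 2 \<Longrightarrow> Suc (R n) * d ^ (i - 1) \<le> n \<Longrightarrow> running_time M d < R n"
  shows "solvable_in \<Delta> c (Pi_problem i M) (\<lambda>n. radius i (R n) + 2)"
proof (rule gather_solves)
  fix n N assume N: "is_network \<Delta> c (in_labels (Pi_problem i M)) n N"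
  define V E L where "V = nodes N" and "E = edges N" and "L = label N"
  have EV: "E \<subseteq> V \<times> V" and sym: "sym E" and fin: "finite V" and n: "card V = n" and inj: "inj_on (ident N) V"
    using N unfolding is_network_def simple_connected_graph_def V_def E_def by auto
  define K where "K = i * Suc (R n)"
  define D where "D = Suc K"
  let ?out = "rule i M (R n) K D E L"
  interpret solver i E L D M "R n" K V
    by unfold_locales (use sym lba i2 T_ge fin EV R1 room n in \<open>auto simp: K_def D_def\<close>)
  have "correct (Pi_problem i M) V E L ?out"
    unfolding Pi_problem_def using out_correct by simp
  moreover have "rule i M (R n) K D (view_edges (known N (radius i (R n) + 2) v))
       (view_label (known N (radius i (R n) + 2) v)) (ident N v) = ?out v" for v
  proof -
    let ?K = "known N (radius i (R n) + 2) v"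
    show ?thesis
    proof (cases "v \<in> V")
      case True
      interpret W: view_iso V E L "ident N" ?K
        by unfold_locales (use EV sym inj in auto)
      have rad: "K + i * D + R n + 1 \<le> radius i (R n)" "D + i * D \<le> radius i (R n)"
        unfolding radius_def K_def D_def by auto
      have sv: "same_view i (radius i (R n)) E L v W.E' W.L' (ident N v)"
      proof (rule W.view_same)
        fix d u assume d: "d \<le> Suc (radius i (R n))" "(v, u) \<in> E ^^ d"
        have inV: "w \<in> V" if "(v, w) \<in> E ^^ e" for w e
        proof -
          have "(v, w) \<in> E\<^sup>*" using that relpow_imp_rtrancl by blast
          then show ?thesis using True EV by (induction rule: rtrancl_induct) auto
        qed
        show "W.seen u"
          unfolding W.seen_def
        proof (intro conjI allI iffI)
          show "u \<in> V" using inV d by blast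
          fix s b
          show "\<exists>w. (u, w) \<in> E \<and> s = L u w \<and> b = ident N w" if "(ident N u, s, b) \<in> ?K"
          proof -
            from that obtain u' w e where u': "ident N u = ident N u'" "s = L u' w" "b = ident N w"
              "(u', w) \<in> E" "(v, u') \<in> E ^^ e" unfolding known_def E_def L_def by auto
            then have "u = u'" using inj_onD[OF inj u'(1)] inV d by blast
            then show ?thesis using u' by blast
          qed
          show "(ident N u, s, b) \<in> ?K" if "\<exists>w. (u, w) \<in> E \<and> s = L u w \<and> b = ident N w"
          proof -
            \<comment> \<open>The summand 2: \<open>view_same\<close> needs one unit beyond the
              radius, and \<open>known\<close> covers distances strictly below its
              parameter.\<close>
            have "d < radius i (R n) + 2" using d(1) by simp
            then show ?thesis using that d(2) unfolding known_def E_def L_def by blast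
          qed
        qed
      qed
      show ?thesis by (rule same_view_rule[OF sv rad, symmetric])
    next
      case False
      \<comment> \<open>Numbers that are not nodes have no edges in either graph, so both sides
        equal {Error}.\<close>
      then have iso: "E `` {v} = {}" using EV by auto
      have "?K = {}"
      proof -
        have "(v, u) \<notin> E ^^ d \<or> u = v" for u d
          using iso relpow_Suc_D2[of v u _ E] by (cases d) (simp, blast)
        then show ?thesis using iso unfolding known_def E_def[symmetric] by blast
      qed
      then have "view_edges ?K = {}" unfolding view_edges_def by simp
      then have "\<not> grid_ok i (view_edges ?K) (view_label ?K) (ident N v)"
        by (intro not_grid_ok_isolated[OF i2]) simp
      then show ?thesis using not_grid_ok_isolated[OF i2 iso] unfolding rule_def by simp
    qed
  qed
  ultimately show "correct (Pi_problem i M) (nodes N) (edges N) (label N)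
      (rule i M (R (card (nodes N))) (i * Suc (R (card (nodes N)))) (Suc (i * Suc (R (card (nodes N)))))
        (edges N) (label N)) \<and>
    (\<forall>v. (\<lambda>n x K. rule i M (R n) (i * Suc (R n)) (Suc (i * Suc (R n))) (view_edges K) (view_label K) x)
        n (ident N v) (known N (radius i (R n) + 2) v) =
      rule i M (R (card (nodes N))) (i * Suc (R (card (nodes N)))) (Suc (i * Suc (R (card (nodes N)))))
        (edges N) (label N) v)"
    unfolding V_def E_def L_def K_def D_def n[unfolded V_def] by simp
qed

section \<open>Boxes\<close>

text \<open>\<open>h\<close> merely names the grid points by numbers, as the model requires;
  \<open>co\<close> undoes it, and all reasoning is about coordinates via \<open>mv\<close>.\<close>

locale box =
  fixes i :: nat and d :: "nat \<Rightarrow> nat" and h :: "(nat \<Rightarrow> nat) \<Rightarrow> nat"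
  assumes i2: "i \<ge> 2" and d2: "\<And>j. j \<in> {1..i} \<Longrightarrow> d j \<ge> 2"
    and inj: "inj_on h (PiE {1..i} (\<lambda>j. {..<d j}))"
begin

definition G :: "(nat \<Rightarrow> nat) set" where "G = PiE {1..i} (\<lambda>j. {..<d j})"

definition co :: "nat \<Rightarrow> nat \<Rightarrow> nat" where "co = inv_into G h"

fun mv :: "side \<Rightarrow> (nat \<Rightarrow> nat) \<Rightarrow> (nat \<Rightarrow> nat) option" where
  "mv (Next j) x = (if j \<in> {1..i} \<and> Suc (x j) < d j then Some (x(j := Suc (x j))) else None)"
| "mv (Prev j) x = (if j \<in> {1..i} \<and> 0 < x j then Some (x(j := x j - 1)) else None)"

definition E :: adjacency where "E = {(h x, h y) | x y s. x \<in> G \<and> mv s x = Some y}"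
definition L :: labelling where "L v u = (THE s. mv s (co v) = Some (co u))"

lemma co [simp]: "x \<in> G \<Longrightarrow> co (h x) = x"
  unfolding co_def using inj by (simp add: G_def)

lemma h_eq: "x \<in> G \<Longrightarrow> y \<in> G \<Longrightarrow> h x = h y \<longleftrightarrow> x = y"
  using co by metis

lemma G_upd: "x \<in> G \<Longrightarrow> j \<in> {1..i} \<Longrightarrow> a < d j \<Longrightarrow> x(j := a) \<in> G"
  unfolding G_def by (auto simp: PiE_iff extensional_def)

lemma G_less: "x \<in> G \<Longrightarrow> j \<in> {1..i} \<Longrightarrow> x j < d j"
  unfolding G_def by (simp add: PiE_iff)

lemma mv_G: "x \<in> G \<Longrightarrow> mv s x = Some y \<Longrightarrow> y \<in> G"
proof (cases s)
  case (Prev j)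
  assume x: "x \<in> G" and y: "mv s x = Some y"
  have j: "j \<in> {1..i}" "y = x(j := x j - 1)" using y Prev by (auto split: if_splits)
  have "x j - 1 < d j" using G_less[OF x j(1)] by simp
  then show "y \<in> G" using G_upd[OF x j(1)] j(2) by simp
next
  case (Next j)
  assume x: "x \<in> G" and y: "mv s x = Some y"
  have j: "j \<in> {1..i}" "Suc (x j) < d j" "y = x(j := Suc (x j))" using y Next by (auto split: if_splits)
  then show "y \<in> G" using G_upd[OF x j(1,2)] by simp
qed

lemma mv_opposite: "mv s x = Some y \<Longrightarrow> x \<in> G \<Longrightarrow> mv (opposite s) y = Some x"
proof (cases s)
  case (Prev j)
  assume y: "mv s x = Some y" and x: "x \<in> G"
  have j: "j \<in> {1..i}" "x j > 0" "y = x(j := x j - 1)" using y Prev by (auto split: if_splits)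
  then show "mv (opposite s) y = Some x" using G_less[OF x j(1)] Prev by simp
next
  case (Next j)
  assume y: "mv s x = Some y" and x: "x \<in> G"
  then show "mv (opposite s) y = Some x" using Next by (auto split: if_splits)
qed

lemma mv_diff: "mv s x = Some y \<Longrightarrow> y (axis_of s) \<noteq> x (axis_of s) \<and> (\<forall>k. k \<noteq> axis_of s \<longrightarrow> y k = x k)"
  by (cases s) (auto split: if_splits)

lemma mv_mono: "mv (Next j) x = Some y \<Longrightarrow> x j < y j" "mv (Prev j) x = Some y \<Longrightarrow> y j < x j"
  by (auto split: if_splits)

lemma mv_form: "mv s x = Some y \<Longrightarrow> y = x(axis_of s := y (axis_of s))"
  by (cases s) (auto split: if_splits)

lemma mv_local:
  "mv s x = Some y \<Longrightarrow> x' (axis_of s) = x (axis_of s) \<Longrightarrow> mv s x' = Some (x'(axis_of s := y (axis_of s)))"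
  by (cases s) (auto split: if_splits)

lemma mv_inj: "mv s x = Some y \<Longrightarrow> mv t x = Some y \<Longrightarrow> s = t"
proof -
  assume s: "mv s x = Some y" and t: "mv t x = Some y"
  have "axis_of s = axis_of t" using mv_diff[OF s] mv_diff[OF t] by metis
  then consider "t = s" | "t = opposite s" using same_axis by blast
  then show "s = t"
  proof cases
    case 2
    have "False"
    proof (cases s)
      case (Prev j)
      then have "y j < x j" "x j < y j" using mv_mono[of j x y] s t 2 by (simp_all del: mv.simps)
      then show ?thesis by simp
    next
      case (Next j)
      then have "y j < x j" "x j < y j" using mv_mono[of j x y] s t 2 by (simp_all del: mv.simps)
      then show ?thesis by simp
    qed
    then show ?thesis ..
  qed simp
qed

lemma edge_iff: "x \<in> G \<Longrightarrow> (h x, u) \<in> E \<longleftrightarrow> (\<exists>s y. mv s x = Some y \<and> u = h y)"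
  unfolding E_def using h_eq by blast

lemma label_eq: "x \<in> G \<Longrightarrow> mv s x = Some y \<Longrightarrow> L (h x) (h y) = s"
  unfolding L_def using mv_G mv_inj by (intro the_equality) auto

lemma edge_label: "x \<in> G \<Longrightarrow> (h x, u) \<in> E \<and> L (h x) u = s \<longleftrightarrow> (\<exists>y. mv s x = Some y \<and> u = h y)"
  using edge_iff label_eq by metis

lemma has_edge_mv: "x \<in> G \<Longrightarrow> has_edge E L (h x) s \<longleftrightarrow> mv s x \<noteq> None"
  unfolding has_edge_def edge_label by auto

lemma z_mv:
  assumes "x \<in> G" shows "z E L (h x) [s] = map_option h (mv s x)"
proof (cases "mv s x")
  case (Some y)
  have "z E L (h x) [s] = Some (h y)" unfolding z_single_iff edge_label[OF assms] using Some by auto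
  then show ?thesis using Some by simp
next
  case None
  have "z E L (h x) [s] = None"
  proof (rule ccontr)
    assume "z E L (h x) [s] \<noteq> None"
    then obtain u where u: "z E L (h x) [s] = Some u" by blast
    show False using z_single_edge[OF u] None unfolding edge_label[OF assms] by simp
  qed
  then show ?thesis using None by simp
qed

lemma mv_swap: "mv s x = Some y \<Longrightarrow> mv t x = Some w \<Longrightarrow> axis_of s \<noteq> axis_of t \<Longrightarrow>
    \<exists>u. mv t y = Some u \<and> mv s w = Some u"
proof -
  assume s: "mv s x = Some y" and t: "mv t x = Some w" and ax: "axis_of s \<noteq> axis_of t"
  have "mv t y = Some (y(axis_of t := w (axis_of t)))"
    by (rule mv_local[OF t]) (use mv_diff[OF s] ax in simp)
  moreover have "mv s w = Some (w(axis_of s := y (axis_of s)))"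
    by (rule mv_local[OF s]) (use mv_diff[OF t] ax in simp)
  moreover have "y(axis_of t := w (axis_of t)) = w(axis_of s := y (axis_of s))"
    using mv_form[OF s] mv_form[OF t] fun_upd_twist[OF ax] by metis
  ultimately show ?thesis by simp
qed

lemma sym_E: "sym E"
proof (rule symI)
  fix v u assume "(v, u) \<in> E"
  then obtain x y s where "v = h x" "u = h y" "x \<in> G" "mv s x = Some y" unfolding E_def by blast
  then show "(u, v) \<in> E" using mv_opposite mv_G unfolding E_def by blast
qed

lemma grid_ok_all:
  assumes x: "x \<in> G" shows "grid_ok i E L (h x)"
  unfolding grid_ok_def
proof (intro conjI ballI impI)
  fix u assume "u \<in> E `` {h x}"
  then obtain s y where u: "mv s x = Some y" "u = h y" using edge_iff[OF x] by auto
  then have l: "L (h x) u = s" using label_eq[OF x] by simp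
  show "L (h x) u \<in> sides i" unfolding l using u(1) by (cases s) (auto simp: sides_def split: if_splits)
  have "L u (h x) = opposite s" using label_eq[OF mv_G[OF x u(1)] mv_opposite[OF u(1) x]] u(2) by simp
  then show "L u (h x) = opposite (L (h x) u)" using l by simp
  fix u' assume "u' \<in> E `` {h x}" and ax: "axis_of (L (h x) u) \<noteq> axis_of (L (h x) u')"
  then obtain t w where w: "mv t x = Some w" "u' = h w" using edge_iff[OF x] by auto
  then have l': "L (h x) u' = t" using label_eq[OF x] by simp
  obtain y' where y': "mv t y = Some y'" "mv s w = Some y'" using mv_swap[OF u(1) w(1)] ax l l' by auto
  show "z E L u [L (h x) u'] \<noteq> None" "z E L u [L (h x) u'] = z E L u' [L (h x) u]"
    unfolding l l' unfolding u(2) w(2) using z_mv[OF mv_G[OF x u(1)]] z_mv[OF mv_G[OF x w(1)]] y' by auto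
next
  show "inj_on (L (h x)) (E `` {h x})"
  proof (rule inj_onI)
    fix u u' assume "u \<in> E `` {h x}" "u' \<in> E `` {h x}" "L (h x) u = L (h x) u'"
    then show "u = u'" using edge_iff[OF x] label_eq[OF x] by (metis Image_singleton_iff option.inject)
  qed
next
  fix j assume j: "j \<in> {1..i}"
  show "has_edge E L (h x) (Prev j) \<or> has_edge E L (h x) (Next j)"
    unfolding has_edge_mv[OF x] using j d2[OF j] by (cases "x j") auto
qed

section \<open>Boxes as networks\<close>

definition all_sides :: "side list" where "all_sides = map Next [1..<Suc i] @ map Prev [1..<Suc i]"
definition avail :: "(nat \<Rightarrow> nat) \<Rightarrow> side list" where "avail x = filter (\<lambda>s. mv s x \<noteq> None) all_sides"

text \<open>Ports follow one fixed order of the sides, so points with the same available sides have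
  the same port numbering. The comparison of shifted boxes relies on this.\<close>

definition net :: "(nat \<Rightarrow> nat) \<Rightarrow> side network" where
  "net idf = \<lparr>nodes = h ` G, edges = E, ident = idf,
     port = (\<lambda>v p. h (the (mv (avail (co v) ! p) (co v)))), label = L\<rparr>"

lemma set_avail: "s \<in> set (avail x) \<longleftrightarrow> mv s x \<noteq> None"
  by (cases s) (auto simp: avail_def all_sides_def image_iff simp del: upt_Suc)

lemma distinct_avail: "distinct (avail x)"
  unfolding avail_def all_sides_def by (intro distinct_filter) (auto simp: distinct_map inj_on_def simp del: upt_Suc)

lemma bij_port:
  assumes x: "x \<in> G"
  shows "bij_betw (\<lambda>p. h (the (mv (avail x ! p) x))) {..<length (avail x)} (E `` {h x})"
proof -
  have "bij_betw (\<lambda>p. avail x ! p) {..<length (avail x)} (set (avail x))"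
    by (rule bij_betw_nth) (use distinct_avail in auto)
  moreover have "bij_betw (\<lambda>s. h (the (mv s x))) (set (avail x)) (E `` {h x})"
    unfolding bij_betw_def
  proof
    show "inj_on (\<lambda>s. h (the (mv s x))) (set (avail x))"
    proof (rule inj_onI)
      fix s t assume st: "s \<in> set (avail x)" "t \<in> set (avail x)" "h (the (mv s x)) = h (the (mv t x))"
      then obtain y w where "mv s x = Some y" "mv t x = Some w" unfolding set_avail by blast
      then show "s = t" using st(3) h_eq mv_G[OF x] mv_inj by (metis option.sel)
    qed
    show "(\<lambda>s. h (the (mv s x))) ` set (avail x) = E `` {h x}"
    proof (rule set_eqI)
      fix u show "u \<in> (\<lambda>s. h (the (mv s x))) ` set (avail x) \<longleftrightarrow> u \<in> E `` {h x}"
        unfolding image_iff Bex_def set_avail Image_singleton_iff edge_iff[OF x]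
        by (metis not_None_eq option.sel)
    qed
  qed
  ultimately show ?thesis using bij_betw_trans by (fastforce simp: comp_def)
qed

lemma degree_eq: "x \<in> G \<Longrightarrow> degree E (h x) = length (avail x)"
  unfolding degree_def using bij_betw_same_card[OF bij_port] by simp

lemma finite_G: "finite G"
  unfolding G_def by (intro finite_PiE) auto

lemma card_nodes: "card (h ` G) = (\<Prod>j=1..i. d j)"
  using card_image[of h G] inj by (simp add: G_def card_PiE)

definition zero :: "nat \<Rightarrow> nat" where "zero = (\<lambda>j\<in>{1..i}. 0)"

lemma zero_G: "zero \<in> G"
  unfolding G_def zero_def using d2 by fastforce

lemma connected_zero: "x \<in> G \<Longrightarrow> (h x, h zero) \<in> E\<^sup>*"
proof (induction "weight i x" arbitrary: x)
  case 0
  then have "\<forall>j\<in>{1..i}. x j = 0" by (simp add: weight_def)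
  then have "x = zero" using 0(2) zero_G unfolding G_def zero_def by (intro PiE_ext) auto
  then show ?case by simp
next
  case (Suc n)
  obtain j where j: "j \<in> {1..i}" "x j > 0"
    using Suc.hyps(2) unfolding weight_def by (metis Zero_not_Suc gr0I sum.neutral)
  let ?y = "x(j := x j - 1)"
  have m: "mv (Prev j) x = Some ?y" using j by simp
  have "weight i ?y = n" using weight_upd[OF j(1), of x "x j - 1"] j(2) Suc.hyps(2) by simp
  then have "(h ?y, h zero) \<in> E\<^sup>*" using Suc.hyps(1)[of ?y] mv_G[OF Suc.prems m] by simp
  moreover have "(h x, h ?y) \<in> E" using m edge_iff[OF Suc.prems] by blast
  ultimately show ?case by (meson converse_rtrancl_into_rtrancl)
qed

lemma is_network_net:
  assumes "inj_on idf (h ` G)" "\<And>x. x \<in> G \<Longrightarrow> idf (h x) \<in> {1..n ^ c}" "n = card (h ` G)" "2 * i \<le> \<Delta>"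
  shows "is_network \<Delta> c (sides i) n (net idf)"
  unfolding is_network_def
proof (intro conjI)
  show "simple_connected_graph (nodes (net idf)) (edges (net idf))"
    unfolding simple_connected_graph_def
  proof (intro conjI ballI)
    show "finite (nodes (net idf))" "nodes (net idf) \<noteq> {}" using finite_G zero_G by (auto simp: net_def)
    show "edges (net idf) \<subseteq> nodes (net idf) \<times> nodes (net idf)"
      using mv_G by (auto simp: net_def E_def)
    show "sym (edges (net idf))" using sym_E by (simp add: net_def)
    show "irrefl (edges (net idf))"
    proof (rule irreflI)
      fix v show "(v, v) \<notin> edges (net idf)"
      proof
        assume "(v, v) \<in> edges (net idf)"
        then have "(v, v) \<in> E" by (simp add: net_def)
        then obtain x y s where v: "v = h x" "v = h y" "x \<in> G" "mv s x = Some y" unfolding E_def by blast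
        then have "x = y" using h_eq mv_G by metis
        then show False using mv_diff[OF v(4)] by simp
      qed
    qed
    fix u v assume "u \<in> nodes (net idf)" "v \<in> nodes (net idf)"
    then have "(u, h zero) \<in> E\<^sup>*" "(v, h zero) \<in> E\<^sup>*" using connected_zero by (auto simp: net_def)
    then have "(h zero, v) \<in> E\<^sup>*" using sym_rtrancl[OF sym_E] by (meson symD)
    with \<open>(u, h zero) \<in> E\<^sup>*\<close> show "(u, v) \<in> (edges (net idf))\<^sup>*" by (simp add: net_def)
  qed
  show "card (nodes (net idf)) = n" using assms(3) by (simp add: net_def)
  show "\<forall>v\<in>nodes (net idf). degree (edges (net idf)) v \<le> \<Delta>"
  proof
    fix v assume "v \<in> nodes (net idf)"
    then obtain x where x: "x \<in> G" "v = h x" by (auto simp: net_def)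
    have "length (avail x) \<le> length all_sides" unfolding avail_def by (rule length_filter_le)
    also have "\<dots> = 2 * i" by (simp add: all_sides_def del: upt_Suc)
    finally show "degree (edges (net idf)) v \<le> \<Delta>" using assms(4) degree_eq x by (simp add: net_def)
  qed
  show "inj_on (ident (net idf)) (nodes (net idf))" using assms(1) by (simp add: net_def)
  show "\<forall>v\<in>nodes (net idf). ident (net idf) v \<in> {1..n ^ c}" using assms(2) by (auto simp: net_def)
  show "\<forall>v\<in>nodes (net idf). bij_betw (port (net idf) v) {..<degree (edges (net idf)) v} (edges (net idf) `` {v})"
    using bij_port degree_eq by (auto simp: net_def)
  show "\<forall>(v, u)\<in>edges (net idf). label (net idf) v u \<in> sides i"
  proof clarify
    fix v u assume "(v, u) \<in> edges (net idf)"
    then obtain x y s where x: "v = h x" "(h x, u) \<in> E" "x \<in> G" by (auto simp: net_def E_def)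
    then show "label (net idf) v u \<in> sides i" using grid_ok_all[OF x(3)] by (auto simp: grid_ok_def net_def)
  qed
qed

definition port_of :: "side \<Rightarrow> (nat \<Rightarrow> nat) \<Rightarrow> nat" where
  "port_of s x = (THE p. p < length (avail x) \<and> avail x ! p = s)"

lemma port_to_net:
  assumes "x \<in> G" "mv s x = Some y"
  shows "port_to (net idf) (h y) (h x) = port_of (opposite s) y"
proof -
  have y: "y \<in> G" by (rule mv_G[OF assms])
  have o: "mv (opposite s) y = Some x" by (rule mv_opposite[OF assms(2,1)])
  have "port (net idf) (h y) p = h x \<longleftrightarrow> avail y ! p = opposite s" if p: "p < length (avail y)" for p
  proof -
    have "avail y ! p \<in> set (avail y)" using p by simp
    then obtain w where w: "mv (avail y ! p) y = Some w" unfolding set_avail by blast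
    then have "port (net idf) (h y) p = h w" using y by (simp add: net_def)
    moreover have "h w = h x \<longleftrightarrow> w = x" using h_eq mv_G[OF y w] assms(1) by blast
    ultimately show ?thesis using w o mv_inj by (metis option.inject)
  qed
  then show ?thesis
    unfolding port_to_def port_of_def using degree_eq[OF y] by (intro arg_cong[of _ _ The]) (auto simp: net_def)
qed

lemma initial_state_net:
  assumes "x \<in> G"
  shows "initial_state A (net idf) (h x) = initial A (card (h ` G)) (idf (h x)) (length (avail x)) (avail x)"
proof -
  let ?ls = "map (\<lambda>p. L (h x) (h (the (mv (avail x ! p) x)))) [0..<length (avail x)]"
  have "?ls = avail x"
  proof (rule nth_equalityI)
    fix p assume "p < length (?ls)"
    then have p: "p < length (avail x)" by simp
    then have "avail x ! p \<in> set (avail x)" by simp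
    then obtain w where "mv (avail x ! p) x = Some w" unfolding set_avail by blast
    then show "?ls ! p = avail x ! p"
      using p label_eq[OF assms] by simp
  qed simp
  then show ?thesis unfolding initial_state_def using assms degree_eq by (simp add: net_def)
qed

lemma round_step_net:
  assumes x: "x \<in> G"
  shows "round_step A (net idf) st (h x) =
     (if decision A (st (h x)) \<noteq> None then st (h x)
      else receive A (st (h x))
        (map (\<lambda>s. send A (st (h (the (mv s x)))) (port_of (opposite s) (the (mv s x)))) (avail x)))"
proof -
  let ?xs = "map (\<lambda>p. let u = port (net idf) (h x) p in send A (st u) (port_to (net idf) u (h x)))
          [0..<degree (edges (net idf)) (h x)]"
  let ?ys = "map (\<lambda>s. send A (st (h (the (mv s x)))) (port_of (opposite s) (the (mv s x)))) (avail x)"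
  have "?xs = ?ys"
  proof (rule nth_equalityI)
    show "length (?xs) =
      length (?ys)"
      using degree_eq[OF x] by (simp add: net_def)
    fix p assume "p < length (?xs)"
    then have p: "p < length (avail x)" using degree_eq[OF x] by (simp add: net_def)
    then have "avail x ! p \<in> set (avail x)" by simp
    then obtain w where w: "mv (avail x ! p) x = Some w" unfolding set_avail by blast
    have "port (net idf) (h x) p = h w" using x w by (simp add: net_def)
    then show "?xs ! p =
        ?ys ! p"
      using p w port_to_net[OF x w] degree_eq[OF x] by (simp add: net_def)
  qed
  then show ?thesis unfolding round_step_def by simp
qed

section \<open>Shifting a box by one row\<close>

definition down :: "(nat \<Rightarrow> nat) \<Rightarrow> nat \<Rightarrow> nat" where "down x = x(1 := x 1 - 1)"

lemma down_G: "x \<in> G \<Longrightarrow> down x \<in> G"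
  unfolding down_def using i2 G_less[of x 1] by (intro G_upd) auto

lemma down_mv:
  assumes "2 \<le> x 1" "Suc (x 1) < d 1" shows "mv s (down x) = map_option down (mv s x)"
proof (cases "axis_of s = 1")
  case True
  then show ?thesis using assms by (cases s) (auto simp: down_def)
next
  case False
  then have ax: "down x (axis_of s) = x (axis_of s)" by (simp add: down_def)
  show ?thesis
  proof (cases "mv s x")
    case None
    then show ?thesis using mv_local[of s "down x" _ x] ax by (cases "mv s (down x)") auto
  next
    case (Some y)
    have "(down x)(axis_of s := y (axis_of s)) = down y"
      using mv_form[OF Some] False mv_diff[OF Some] fun_upd_twist[OF False] unfolding down_def by metis
    then show ?thesis using mv_local[OF Some, of "down x"] ax Some by simp
  qed
qed

lemma down_avail: "2 \<le> x 1 \<Longrightarrow> Suc (x 1) < d 1 \<Longrightarrow> avail (down x) = avail x"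
  unfolding avail_def by (intro filter_cong) (auto simp: down_mv)

text \<open>The state after t rounds depends only on the ball of radius t. The margins keep the
  balls around \<open>x\<close> and \<open>down x\<close> away from both ends of axis 1, where
  available sides would differ; \<open>t + 2\<close> rather than \<open>t + 1\<close> is due to
  \<open>down x\<close> lying one row lower.\<close>

lemma shifted_state:
  assumes idf: "\<And>x. x \<in> G \<Longrightarrow> x 1 > 0 \<Longrightarrow> idf (h x) = idf' (h (down x))"
    and "x \<in> G" "t + 2 \<le> x 1" "x 1 + t + 1 < d 1"
  shows "state_after A (net idf) t (h x) = state_after A (net idf') t (h (down x))"
  using assms(2-4)
proof (induction t arbitrary: x)
  case 0
  have "avail (down x) = avail x" by (rule down_avail) (use 0 in auto)
  moreover have "idf (h x) = idf' (h (down x))" by (rule idf) (use 0 in auto)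
  ultimately show ?case unfolding state_after_def
    by (simp add: initial_state_net[OF 0(1)] initial_state_net[OF down_G[OF 0(1)]])
next
  case (Suc t)
  let ?s = "state_after A (net idf) t" and ?s' = "state_after A (net idf') t"
  have av: "avail (down x) = avail x" using down_avail Suc.prems by simp
  have here: "?s (h x) = ?s' (h (down x))" using Suc.IH[of x] Suc.prems by simp
  have "send A (?s (h (the (mv s x)))) (port_of (opposite s) (the (mv s x))) =
      send A (?s' (h (the (mv s (down x))))) (port_of (opposite s) (the (mv s (down x))))"
    if "s \<in> set (avail x)" for s
  proof -
    obtain y where y: "mv s x = Some y" using \<open>s \<in> set (avail x)\<close> unfolding set_avail by blast
    have y1: "x 1 \<le> y 1 + 1" "y 1 \<le> x 1 + 1" using y by (cases s; auto split: if_splits)+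
    have "mv s (down x) = Some (down y)" using down_mv y Suc.prems by simp
    moreover have "?s (h y) = ?s' (h (down y))"
      using Suc.IH[of y] mv_G[OF Suc.prems(1) y] y1 Suc.prems by simp
    moreover have "port_of (opposite s) y = port_of (opposite s) (down y)"
      unfolding port_of_def using down_avail[of y] y1 Suc.prems by simp
    ultimately show ?thesis using y by simp
  qed
  then have "map (\<lambda>s. send A (?s (h (the (mv s x)))) (port_of (opposite s) (the (mv s x)))) (avail x) =
      map (\<lambda>s. send A (?s' (h (the (mv s (down x))))) (port_of (opposite s) (the (mv s (down x))))) (avail (down x))"
    unfolding av by simp
  moreover have "state_after A (net idf) (Suc t) (h x) = round_step A (net idf) ?s (h x)"
    "state_after A (net idf') (Suc t) (h (down x)) = round_step A (net idf') ?s' (h (down x))"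
    by (simp_all add: state_after_def)
  ultimately show ?case
    by (simp only: round_step_net[OF Suc.prems(1)] round_step_net[OF down_G[OF Suc.prems(1)]] here)
qed

end

section \<open>Forced outputs on a box\<close>

lemma LC1_shape:
  assumes "LC1 i out v" "Dimension k \<in> out v"
  shows "\<exists>t q. out v = {Dimension k, Tape t, State q} \<union> (if Head \<in> out v then {Head} else {})"
proof -
  from assms(1) consider "out v = {ExemptM}"
    | k' t q where "out v = {Dimension k', Tape t, State q}"
    | k' t q where "out v = {Dimension k', Tape t, State q, Head}"
    unfolding LC1_def by blast
  then show ?thesis
  proof cases
    case 1
    then show ?thesis using assms(2) by simp
  next
    case (2 k' t q)
    then have "k' = k" "Head \<notin> out v" using assms(2) by simp_all
    then have "out v = {Dimension k, Tape t, State q} \<union> (if Head \<in> out v then {Head} else {})"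
      using 2 by (simp only: if_False Un_empty_right)
    then show ?thesis by blast
  next
    case (3 k' t q)
    then have "k' = k" "Head \<in> out v" using assms(2) by simp_all
    then have "out v = {Dimension k, Tape t, State q} \<union> (if Head \<in> out v then {Head} else {})"
      using 3 by (simp only: if_True) blast
    then show ?thesis by blast
  qed
qed

text \<open>With \<open>d 1\<close> equal to the running time the rows are numbered up to one less,
  so no row is in the final state and each forces the next. \<open>tall\<close> excludes the way out
  via \<open>Unbalanced\<close>.\<close>

locale box_solution = box i d h
  for i :: nat and d :: "nat \<Rightarrow> nat" and h :: "(nat \<Rightarrow> nat) \<Rightarrow> nat" +
  fixes M :: "('q::finite, 'g::finite) lba" and out :: "nat \<Rightarrow> ('q, 'g) out_label set" and B :: nat
  assumes lba: "is_lba M" and B2: "B \<ge> 2" and dk: "\<And>k. k \<in> {2..i} \<Longrightarrow> d k = B"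
    and d1: "d 1 = running_time M B" and tall: "B \<le> d 1"
    and correct: "\<And>x. x \<in> G \<Longrightarrow> Pi_correct_at i M E L out (h x)"
begin

lemma V_closed: "v \<in> h ` G \<Longrightarrow> u \<in> nbhd E r v \<Longrightarrow> u \<in> h ` G"
proof -
  have EV: "E \<subseteq> h ` G \<times> h ` G" using mv_G unfolding E_def by blast
  assume v: "v \<in> h ` G" and "u \<in> nbhd E r v"
  then obtain e where "(v, u) \<in> E ^^ e" unfolding nbhd_def by blast
  then have "(v, u) \<in> E\<^sup>*" using relpow_imp_rtrancl by blast
  then show "u \<in> h ` G" using v EV by (induction rule: rtrancl_induct) auto
qed

lemma labels: "x \<in> G \<Longrightarrow> out (h x) \<subseteq> enc_labels i \<union> unb_labels \<union> err_labels i"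
  using correct unfolding Pi_correct_at_def by blast

lemma no_Error: "x \<in> G \<Longrightarrow> Error \<notin> out (h x)"
  using correct grid_ok_all unfolding Pi_correct_at_def by blast

text \<open>It decreases as long as a pointer keeps its side, and serves as the last component of a
  lexicographic measure.\<close>

definition ahead :: "side \<Rightarrow> (nat \<Rightarrow> nat) \<Rightarrow> nat" where
  "ahead s x = (case s of Next j \<Rightarrow> d j - x j | Prev j \<Rightarrow> x j)"

lemma ahead_less: "mv s x = Some y \<Longrightarrow> ahead s y < ahead s x"
  by (cases s) (auto simp: ahead_def split: if_splits)

text \<open>Error pointers would have to lead to an error: their type, then their axis, increases, and along
  one axis they run towards the boundary.\<close>

lemma no_Pointer: "x \<in> G \<Longrightarrow> Pointer s r \<notin> out (h x)"
proof (induction "(r, s, x)" arbitrary: r s x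
    rule: wf_induct_rule[OF wf_measures[of "[\<lambda>(r, s, x). 1 - r, \<lambda>(r, s, x). i - axis_of s, \<lambda>(r, s, x). ahead s x]"]])
  case (1 r s x)
  show ?case
  proof
    assume p: "Pointer s r \<in> out (h x)"
    obtain u where u: "z E L (h x) [s] = Some u"
      "Error \<in> out u \<or> (\<exists>s' r'. Pointer s' r' \<in> out u \<and> pointer_continues s r s' r')"
      using correct[OF 1(2)] p unfolding Pi_correct_at_def by blast
    obtain y where y: "mv s x = Some y" "u = h y" using u(1) z_mv[OF 1(2)] by auto
    have yG: "y \<in> G" by (rule mv_G[OF 1(2) y(1)])
    obtain s' r' where p': "Pointer s' r' \<in> out (h y)" "pointer_continues s r s' r'"
      using u(2) no_Error[OF yG] y(2) by blast
    have r: "r \<le> 1" using labels[OF 1(2)] p by (auto simp: enc_labels_def unb_labels_def err_labels_def)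
    have s': "r' \<le> 1" "axis_of s' \<le> i"
      using labels[OF yG] p'(1) by (auto simp: enc_labels_def unb_labels_def err_labels_def sides_def)
    have "((r', s', y), (r, s, x)) \<in> measures [\<lambda>(r, s, x). 1 - r, \<lambda>(r, s, x). i - axis_of s, \<lambda>(r, s, x). ahead s x]"
    proof -
      have "r = 0 \<or> r = 1" "r' = 0 \<or> r' = 1" using r s'(1) by auto
      then have "r < r' \<or> r' = r \<and> s' = s \<or> r' = r \<and> axis_of s < axis_of s'"
        using p'(2) unfolding pointer_continues_def by (auto simp: le_less)
      then show ?thesis using r s' ahead_less[OF y(1)] by (auto simp: in_measures)
    qed
    from 1(1)[OF this yG] p'(1) show False by blast
  qed
qed

lemma no_error: "x \<in> G \<Longrightarrow> out (h x) \<inter> err_labels i = {}"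
  using no_Error no_Pointer unfolding err_labels_def by auto

lemma no_error_nbhd: "x \<in> G \<Longrightarrow> \<not> (\<exists>u\<in>nbhd E r (h x). out u \<inter> err_labels i \<noteq> {})"
  using V_closed[of "h x"] no_error by blast

lemma z_Next_list:
  "x \<in> G \<Longrightarrow> distinct js \<Longrightarrow> z E L (h x) (map Next js) = Some w \<Longrightarrow>
     \<exists>y\<in>G. w = h y \<and> (\<forall>j. y j = (if j \<in> set js then Suc (x j) else x j))"
proof (induction js arbitrary: x)
  case Nil
  then show ?case by auto
next
  case (Cons k js)
  obtain u where u: "z E L (h x) [Next k] = Some u" "z E L u (map Next js) = Some w"
    using z_rotate[of E L "h x" "[Next k]" "map Next js" w] Cons.prems(3) by auto
  then obtain x' where x': "mv (Next k) x = Some x'" "u = h x'" using z_mv[OF Cons.prems(1)] by auto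
  have x'': "x' = x(k := Suc (x k))" using x'(1) by (auto split: if_splits)
  from Cons.IH[OF mv_G[OF Cons.prems(1) x'(1)]] Cons.prems(2) u(2) x'(2)
  obtain y where y: "y \<in> G" "w = h y" "\<forall>j. y j = (if j \<in> set js then Suc (x' j) else x' j)" by auto
  have "\<forall>j. y j = (if j \<in> set (k # js) then Suc (x j) else x j)"
    using y(3) Cons.prems(2) x'' by auto
  then show ?case using y by blast
qed

text \<open>The diagonal from the origin cannot end at the far end of axis 1, since no other axis is longer.\<close>

lemma Unbalanced_diagonal:
  assumes "Unbalanced \<in> out (h zero)" shows "\<exists>x\<in>G. (\<forall>j\<in>{1..i}. x j = a) \<and> Unbalanced \<in> out (h x)"
proof (induction a)
  case 0
  have "\<forall>j\<in>{1..i}. zero j = 0" by (simp add: zero_def)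
  then show ?case using assms zero_G by blast
next
  case (Suc a)
  then obtain x where x: "x \<in> G" "\<forall>j\<in>{1..i}. x j = a" "Unbalanced \<in> out (h x)" by blast
  have "unbalance_ok i E L out (h x)"
    using correct[OF x(1)] x(3) no_error_nbhd[OF x(1), of i] unfolding Pi_correct_at_def by blast
  then have cases: "(\<exists>w. z E L (h x) (map Next [1..<Suc i]) = Some w \<and> Unbalanced \<in> out w) \<or>
     ((\<forall>j\<in>{2..i}. has_edge E L (h x) (Next j)) \<and> \<not> has_edge E L (h x) (Next 1))"
    using x(3) unfolding unbalance_ok_def Let_def by blast
  have "\<not> ((\<forall>j\<in>{2..i}. has_edge E L (h x) (Next j)) \<and> \<not> has_edge E L (h x) (Next 1))"
  proof
    assume *: "(\<forall>j\<in>{2..i}. has_edge E L (h x) (Next j)) \<and> \<not> has_edge E L (h x) (Next 1)"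
    have "2 \<in> {2..i}" "2 \<in> {1..i}" "1 \<in> {1..i}" using i2 by auto
    then have "Suc a < d 2" "\<not> Suc a < d 1"
      using * x(2) unfolding has_edge_mv[OF x(1)] by (auto split: if_splits)
    then show False using dk[of 2] tall i2 by simp
  qed
  then obtain w where w: "z E L (h x) (map Next [1..<Suc i]) = Some w" "Unbalanced \<in> out w" using cases by blast
  obtain y where y: "y \<in> G" "w = h y" "\<forall>j. y j = (if j \<in> set [1..<Suc i] then Suc (x j) else x j)"
    using z_Next_list[OF x(1) distinct_upt w(1)] by blast
  have "\<forall>j\<in>{1..i}. y j = Suc a" using y(3) x(2) by auto
  then show ?case using w(2) y(1,2) by blast
qed

text \<open>An \<open>Unbalanced\<close> origin would force the diagonal to continue for ever, in
  particular to the coordinate \<open>d 1\<close>, which is outside the box.\<close>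

lemma origin_not_Unbalanced: "Unbalanced \<notin> out (h zero)"
proof
  assume "Unbalanced \<in> out (h zero)"
  from Unbalanced_diagonal[OF this, of "d 1"] obtain x where "x \<in> G" "\<forall>j\<in>{1..i}. x j = d 1" by blast
  moreover have "1 \<in> {1..i}" using i2 by simp
  ultimately show False using G_less[of x 1] by simp
qed

lemma enc_ok:
  assumes x: "x \<in> G" and sub: "out (h x) \<subseteq> enc_labels i - {ExemptM}"
  shows "encoding_ok i M E L out (h x)"
  using correct[OF x] sub no_error_nbhd[OF x, of 2] unfolding Pi_correct_at_def by blast

lemma Dimension_enc:
  assumes x: "x \<in> G" and k: "Dimension k \<in> out (h x)"
  shows "encoding_ok i M E L out (h x)" "k \<in> {2..i}"
proof -
  \<comment> \<open>An infinite set has \<open>card\<close> 0, so finiteness is needed to conclude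
    from \<open>card < 2\<close> that there is at most one label.\<close>
  have "finite (enc_labels i :: ('q, 'g) out_label set)" "finite (unb_labels :: ('q, 'g) out_label set)"
    unfolding enc_labels_def unb_labels_def by auto
  moreover have "out (h x) \<subseteq> enc_labels i \<union> unb_labels" using labels[OF x] no_error[OF x] by blast
  ultimately have fin: "finite (out (h x))" by (meson finite_UnI finite_subset)
  show k2: "k \<in> {2..i}" using labels[OF x] k by (auto simp: enc_labels_def unb_labels_def err_labels_def)
  have "out (h x) \<subseteq> enc_labels i - {ExemptM}"
  proof (cases "card (out (h x)) \<ge> 2")
    case True
    then show ?thesis using correct[OF x] unfolding Pi_correct_at_def by blast
  next
    case False
    then have "card (out (h x)) \<le> 1" by simp
    then have "\<forall>l\<in>out (h x). \<forall>l'\<in>out (h x). l = l'" using card_le_Suc0_iff_eq[OF fin] by simp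
    then have "out (h x) = {Dimension k}" using k by blast
    then show ?thesis using k2 by (auto simp: enc_labels_def)
  qed
  then show "encoding_ok i M E L out (h x)" by (rule enc_ok[OF x])
qed

text \<open>All other classes are excluded at the origin: exempt labels need a \<open>Prev\<close>
  edge, error labels cannot occur in a valid grid, and \<open>Unbalanced\<close> was ruled out. LC2
  then supplies the dimension.\<close>

lemma origin_Dimension: "\<exists>k\<in>{2..i}. Dimension k \<in> out (h zero)"
proof -
  have np: "\<not> has_edge E L (h zero) (Prev j)" for j
    unfolding has_edge_mv[OF zero_G] by (simp add: zero_def)
  then have "ExemptM \<notin> out (h zero)" "ExemptU \<notin> out (h zero)"
    using correct[OF zero_G] unfolding Pi_correct_at_def by blast+
  then have "out (h zero) \<subseteq> enc_labels i - {ExemptM}"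
    using labels[OF zero_G] no_error[OF zero_G] origin_not_Unbalanced unfolding unb_labels_def by blast
  from enc_ok[OF zero_G this] show ?thesis
    using np unfolding encoding_ok_def LC2_def is_origin_def by blast
qed

section \<open>The rows of the encoding\<close>

definition pt :: "nat \<Rightarrow> nat \<Rightarrow> nat \<Rightarrow> nat \<Rightarrow> nat" where
  "pt k a b = (\<lambda>j\<in>{1..i}. if j = 1 then a else if j = k then b else 0)"

lemma pt_G: "k \<in> {2..i} \<Longrightarrow> a < d 1 \<Longrightarrow> b < B \<Longrightarrow> pt k a b \<in> G"
  unfolding pt_def G_def using d2 dk by (auto simp: PiE_iff)

lemma pt_simps: "k \<in> {2..i} \<Longrightarrow> pt k a b 1 = a" "k \<in> {2..i} \<Longrightarrow> pt k a b k = b"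
  "j \<noteq> 1 \<Longrightarrow> j \<noteq> k \<Longrightarrow> j \<in> {1..i} \<Longrightarrow> pt k a b j = 0"
  by (auto simp: pt_def)

lemma pt_upd: "k \<in> {2..i} \<Longrightarrow> (pt k a b)(1 := a') = pt k a' b" "k \<in> {2..i} \<Longrightarrow> (pt k a b)(k := b') = pt k a b'"
  by (auto simp: pt_def fun_eq_iff)

lemma pt_mv:
  assumes k: "k \<in> {2..i}"
  shows "mv (Next 1) (pt k a b) = (if Suc a < d 1 then Some (pt k (Suc a) b) else None)"
    "mv (Prev 1) (pt k a b) = (if a > 0 then Some (pt k (a - 1) b) else None)"
    "mv (Next k) (pt k a b) = (if Suc b < B then Some (pt k a (Suc b)) else None)"
    "mv (Prev k) (pt k a b) = (if b > 0 then Some (pt k a (b - 1)) else None)"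
proof -
  have m: "1 \<in> {1..i}" "k \<in> {1..i}" using k by auto
  show "mv (Next 1) (pt k a b) = (if Suc a < d 1 then Some (pt k (Suc a) b) else None)"
    "mv (Prev 1) (pt k a b) = (if a > 0 then Some (pt k (a - 1) b) else None)"
    "mv (Next k) (pt k a b) = (if Suc b < B then Some (pt k a (Suc b)) else None)"
    "mv (Prev k) (pt k a b) = (if b > 0 then Some (pt k a (b - 1)) else None)"
    by (simp_all only: mv.simps pt_simps(1,2)[OF k] pt_upd[OF k] dk[OF k] m simp_thms)
qed

text \<open>Column 0 is axis 1 itself and so belongs to the encodings on all tape axes. This lets
  two outputs with possibly different tape axes be compared.\<close>

lemma pt_00: "k \<in> {2..i} \<Longrightarrow> pt k a 0 = pt 2 a 0"
  by (auto simp: pt_def fun_eq_iff)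

lemma zero_pt: "zero = pt k 0 0"
  by (auto simp: pt_def zero_def fun_eq_iff)

context
  fixes k assumes k: "k \<in> {2..i}"
begin

abbreviation f :: "nat \<Rightarrow> nat \<Rightarrow> nat" where "f a b \<equiv> h (pt k a b)"

lemma f_z:
  assumes "a < d 1" "b < B"
  shows "z E L (f a b) [Next 1] = (if Suc a < d 1 then Some (f (Suc a) b) else None)"
    "z E L (f a b) [Prev 1] = (if a > 0 then Some (f (a - 1) b) else None)"
    "z E L (f a b) [Next k] = (if Suc b < B then Some (f a (Suc b)) else None)"
    "z E L (f a b) [Prev k] = (if b > 0 then Some (f a (b - 1)) else None)"
    "has_edge E L (f a b) (Prev 1) \<longleftrightarrow> a > 0"
    "has_edge E L (f a b) (Prev k) \<longleftrightarrow> b > 0"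
    "has_edge E L (f a b) (Next k) \<longleftrightarrow> Suc b < B"
  unfolding z_mv[OF pt_G[OF k assms]] has_edge_mv[OF pt_G[OF k assms]] pt_mv[OF k] by simp_all

lemma row_Dimension:
  assumes "a < d 1" "Dimension k \<in> out (f a 0)" "b < B" shows "Dimension k \<in> out (f a b)"
  using assms(3)
proof (induction b)
  case (Suc b)
  then have D: "Dimension k \<in> out (f a b)" and b: "b < B" by auto
  have "LC3 i E L out (f a b)"
    using Dimension_enc(1)[OF pt_G[OF k assms(1) b] D] unfolding encoding_ok_def by simp
  moreover have "z E L (f a b) [Next k] = Some (f a (Suc b))" using f_z(3)[OF assms(1) b] Suc.prems by simp
  ultimately show ?case using D k unfolding LC3_def by blast
qed (use assms in simp)

lemma LC4_at:
  assumes "a < d 1" "b < B" "Dimension k \<in> out (f a b)"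
  shows "a = 0 \<Longrightarrow> LC4_first M E L out k (f a b)" "single_head M E L out k (f a b)"
    "\<exists>t q. out (f a b) = {Dimension k, Tape t, State q} \<union> (if Head \<in> out (f a b) then {Head} else {})"
    "\<And>q t q' t'. a > 0 \<Longrightarrow> {State q, Tape t} \<subseteq> out (f a b) \<Longrightarrow> {State q', Tape t'} \<subseteq> out (f (a - 1) b) \<Longrightarrow>
       LC4_next M E L out k (f a b) (f (a - 1) b) q t q' t'"
proof -
  have e: "encoding_ok i M E L out (f a b)" by (rule Dimension_enc(1)[OF pt_G[OF k assms(1,2)] assms(3)])
  then have lc4: "LC4 i M E L out (f a b)" unfolding encoding_ok_def by simp
  have l: "(\<not> has_edge E L (f a b) (Prev 1) \<longrightarrow> LC4_first M E L out k (f a b)) \<and>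
        (has_edge E L (f a b) (Prev 1) \<longrightarrow>
           (\<forall>p q t q' t'. z E L (f a b) [Prev 1] = Some p \<and>
              {State q, Tape t} \<subseteq> out (f a b) \<and> {State q', Tape t'} \<subseteq> out p \<longrightarrow>
              LC4_next M E L out k (f a b) p q t q' t')) \<and>
        single_head M E L out k (f a b)"
    by (rule bspec[OF lc4[unfolded LC4_def] k, THEN mp, OF assms(3)])
  show "LC4_first M E L out k (f a b)" if "a = 0"
  proof -
    have "\<not> has_edge E L (f a b) (Prev 1)" using f_z(5)[OF assms(1,2)] that by simp
    with conjunct1[OF l] show ?thesis by (rule mp)
  qed
  show "single_head M E L out k (f a b)" using l by (elim conjE)
  show "\<exists>t q. out (f a b) = {Dimension k, Tape t, State q} \<union> (if Head \<in> out (f a b) then {Head} else {})"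
    using e assms(3) unfolding encoding_ok_def by (blast intro: LC1_shape)
  show "LC4_next M E L out k (f a b) (f (a - 1) b) q t q' t'"
    if "a > 0" "{State q, Tape t} \<subseteq> out (f a b)" "{State q', Tape t'} \<subseteq> out (f (a - 1) b)" for q t q' t'
  proof -
    have e: "has_edge E L (f a b) (Prev 1)" using f_z(5)[OF assms(1,2)] that(1) by simp
    have z1: "z E L (f a b) [Prev 1] = Some (f (a - 1) b)" using f_z(2)[OF assms(1,2)] that(1) by simp
    from l have "has_edge E L (f a b) (Prev 1) \<longrightarrow>
           (\<forall>p q t q' t'. z E L (f a b) [Prev 1] = Some p \<and>
              {State q, Tape t} \<subseteq> out (f a b) \<and> {State q', Tape t'} \<subseteq> out p \<longrightarrow>
              LC4_next M E L out k (f a b) p q t q' t')" by (elim conjE)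
    from this[rule_format, OF e conjI[OF z1 conjI[OF that(2,3)]]] show ?thesis .
  qed
qed

lemma row_0:
  assumes "Dimension k \<in> out (f 0 0)" "b < B" shows "out (f 0 b) = row_label M B k 0 b"
proof -
  have d0: "0 < d 1" using tall B2 by simp
  have D: "Dimension k \<in> out (f 0 b)" by (rule row_Dimension[OF d0 assms])
  obtain t q where o: "out (f 0 b) = {Dimension k, Tape t, State q} \<union> (if Head \<in> out (f 0 b) then {Head} else {})"
    using LC4_at(3)[OF d0 assms(2) D] by blast
  have first: "LC4_first M E L out k (f 0 b)" by (rule LC4_at(1)[OF d0 assms(2) D refl])
  have tape: "Tape x \<in> out (f 0 b) \<Longrightarrow> x = t" "State p \<in> out (f 0 b) \<Longrightarrow> p = q" for x p
    by (subst (asm) o; auto split: if_splits)+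
  have qs: "q = start M" using first tape(2) unfolding LC4_first_def by blast
  have ts: "t = (if b = 0 then left_marker M else if b = B - 1 then right_marker M else blank M)"
    using first tape(1) assms(2) f_z(6,7)[OF d0 assms(2)] unfolding LC4_first_def by auto
  have hd: "Head \<in> out (f 0 b) \<longleftrightarrow> b = 0"
    using first LC4_at(2)[OF d0 assms(2) D] f_z(5,6)[OF d0 assms(2)] unfolding LC4_first_def single_head_def by auto
  have "lba_run M B 0 = (start M, \<lambda>p. if p = 0 then left_marker M else if p = B - 1 then right_marker M else blank M, 0)"
    by (simp add: lba_run_def initial_config_def)
  then show ?thesis unfolding o[unfolded hd] qs ts row_label_def by (simp only: prod.case)
qed

text \<open>At the old head position \<open>delta\<close> fixes symbol, state and move. Elsewhere
  the symbol is copied and the state is forced on the adjacent cells, so the whole row has the same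
  state. \<open>single_head\<close> excludes any head other than the moved one.\<close>

lemma row_Suc:
  assumes a: "Suc a < d 1" and row: "\<And>b. b < B \<Longrightarrow> out (f a b) = row_label M B k a b"
    and D0: "\<And>b. b < B \<Longrightarrow> Dimension k \<in> out (f (Suc a) b)" and bB: "b < B"
  shows "out (f (Suc a) b) = row_label M B k (Suc a) b"
proof -
  have a': "a < d 1" using a by simp
  obtain q0 tape0 h0 where r0: "lba_run M B a = (q0, tape0, h0)" by (cases "lba_run M B a") auto
  have h0: "h0 < B" by (rule lba_head_bound[OF lba B2 r0])
  have nf: "q0 \<noteq> final M" using lba_run_not_final[of a M B] a' d1 r0 by simp
  obtain p2 g e where e: "delta M q0 (tape0 h0) = (p2, g, e)" by (cases "delta M q0 (tape0 h0)") auto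
  have r1: "lba_run M B (Suc a) = (p2, tape0(h0 := g), move_head e h0)"
    using r0 nf e by (simp add: lba_run_Suc)
  have h1: "move_head e h0 < B" by (rule lba_head_bound[OF lba B2 r1])
  have rowa: "out (f a b) = {Dimension k, Tape (tape0 b), State q0} \<union> (if b = h0 then {Head} else {})" if "b < B" for b
    using row[OF that] r0 by (simp add: row_label_def)
  have "\<exists>t q. out (f (Suc a) b) = {Dimension k, Tape t, State q} \<union> (if Head \<in> out (f (Suc a) b) then {Head} else {})"
    if "b < B" for b by (rule LC4_at(3)[OF a that D0[OF that]])
  then obtain t q where o: "\<And>b. b < B \<Longrightarrow>
      out (f (Suc a) b) = {Dimension k, Tape (t b), State (q b)} \<union> (if Head \<in> out (f (Suc a) b) then {Head} else {})"
    by metis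
  have uniq: "p = q b" if "State p \<in> out (f (Suc a) b)" "b < B" for p b
    using that(1) by (subst (asm) o[OF that(2)]) (auto split: if_splits)
  have nxt: "LC4_next M E L out k (f (Suc a) b) (f a b) (q b) (t b) q0 (tape0 b)" if b: "b < B" for b
  proof -
    have "{State (q b), Tape (t b)} \<subseteq> out (f (Suc a) b)" by (subst o[OF b]) auto
    moreover have "{State q0, Tape (tape0 b)} \<subseteq> out (f a b)" unfolding rowa[OF b] by auto
    ultimately show ?thesis using LC4_at(4)[OF a b D0[OF b], of "q b" "t b" q0 "tape0 b"] by simp
  qed
  have head: "Head \<in> out (f a b) \<longleftrightarrow> b = h0" if "b < B" for b unfolding rowa[OF that] by auto
  have away: "t b = tape0 b \<and> (Suc b < B \<longrightarrow> q (Suc b) = q b) \<and> (b > 0 \<longrightarrow> q (b - 1) = q b)"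
    if b: "b < B" "b \<noteq> h0" for b
  proof -
    have n: "tape0 b = t b \<or> t b = tape0 b" "\<forall>s\<in>{Prev k, Next k}. \<forall>u. z E L (f (Suc a) b) [s] = Some u \<longrightarrow> State (q b) \<in> out u"
      "t b = tape0 b"
      using nxt[OF b(1)] head[OF b(1)] b(2) unfolding LC4_next_def by auto
    have "q (Suc b) = q b" if "Suc b < B"
      using n(2) f_z(3)[OF a b(1)] that uniq[of "q b" "Suc b"] by simp
    moreover have "q (b - 1) = q b" if "b > 0"
      using n(2) f_z(4)[OF a b(1)] that uniq[of "q b" "b - 1"] b(1) by simp
    ultimately show ?thesis using n(3) by blast
  qed
  have at: "q h0 = p2" "t h0 = g" and moved: "Head \<in> out (f (Suc a) (move_head e h0))"
  proof -
    have "Head \<in> out (f a h0)" using head[OF h0] by simp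
    with nxt[OF h0] obtain e' where e': "delta M q0 (tape0 h0) = (q h0, t h0, e')"
      "case e' of Stay \<Rightarrow> Head \<in> out (f (Suc a) h0)
        | Leftward \<Rightarrow> (\<exists>u. z E L (f (Suc a) h0) [Prev k] = Some u \<and> Head \<in> out u)
        | Rightward \<Rightarrow> (\<exists>u. z E L (f (Suc a) h0) [Next k] = Some u \<and> Head \<in> out u)"
      unfolding LC4_next_def by auto
    then show "q h0 = p2" "t h0 = g" using e by auto
    have "e' = e" using e e'(1) by simp
    with e'(2) show "Head \<in> out (f (Suc a) (move_head e h0))"
      using f_z(3,4)[OF a h0] by (cases e) (auto split: if_splits)
  qed
  \<comment> \<open>Of two adjacent cells at most one is the old head position, and the other one
    forces its state on it.\<close>
  have step: "q (Suc b) = q b" if "Suc b < B" for b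
    using away[of b] away[of "Suc b"] that by (cases "b = h0") auto
  have const: "q b = q 0" if "b < B" for b
    using that by (induction b) (auto simp: step)
  have qb: "q b = p2" using const[OF bB] const[OF h0] at(1) by simp
  have tb: "t b = (tape0(h0 := g)) b" using away[of b] bB at(2) by auto
  have hd: "Head \<in> out (f (Suc a) b) \<longleftrightarrow> b = move_head e h0"
  proof
    assume "Head \<in> out (f (Suc a) b)"
    then have "head_moves_to M E L out k (f (Suc a) b)"
      using LC4_at(2)[OF a bB D0[OF bB]] f_z(5)[OF a bB] unfolding single_head_def by simp
    then obtain x p q' t' where x: "z E L x [Prev 1] = Some p" "{Head, State q', Tape t'} \<subseteq> out p"
      "case snd (snd (delta M q' t')) of
           Stay \<Rightarrow> x = f (Suc a) b
         | Leftward \<Rightarrow> z E L (f (Suc a) b) [Next k] = Some x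
         | Rightward \<Rightarrow> z E L (f (Suc a) b) [Prev k] = Some x"
      unfolding head_moves_to_def by blast
    have "\<exists>b'<B. x = f (Suc a) b'"
    proof (cases "snd (snd (delta M q' t'))")
      case Stay
      then show ?thesis using x(3) bB by auto
    next
      case Leftward
      then have "Suc b < B" "x = f (Suc a) (Suc b)" using x(3) f_z(3)[OF a bB] by (simp_all split: if_splits)
      then show ?thesis by blast
    next
      case Rightward
      then have "x = f (Suc a) (b - 1)" using x(3) f_z(4)[OF a bB] by (simp split: if_splits)
      moreover have "b - 1 < B" using bB by simp
      ultimately show ?thesis by blast
    qed
    then obtain b' where b': "b' < B" "x = f (Suc a) b'" by blast
    have p: "p = f a b'" using x(1) f_z(2)[OF a b'(1)] b'(2) by simp
    have "b' = h0" using x(2) head[OF b'(1)] p by simp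
    have qt: "q' = q0" "t' = tape0 h0" using x(2) rowa[OF h0] p \<open>b' = h0\<close> by (auto split: if_splits)
    have inj: "f (Suc a) c = f (Suc a) c' \<Longrightarrow> c = c'" if "c < B" "c' < B" for c c'
      using h_eq[OF pt_G[OF k a that(1)] pt_G[OF k a that(2)]] pt_simps(2)[OF k] by metis
    have cs: "case e of Stay \<Rightarrow> f (Suc a) h0 = f (Suc a) b
         | Leftward \<Rightarrow> z E L (f (Suc a) b) [Next k] = Some (f (Suc a) h0)
         | Rightward \<Rightarrow> z E L (f (Suc a) b) [Prev k] = Some (f (Suc a) h0)"
    proof -
      have "snd (snd (delta M q' t')) = e" "x = f (Suc a) h0" using e qt b'(2) \<open>b' = h0\<close> by simp_all
      then show ?thesis using x(3) by (simp only:)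
    qed
    show "b = move_head e h0"
    proof (cases e)
      case Stay
      then show ?thesis using cs inj[OF h0 bB] by simp
    next
      case Leftward
      then have "Suc b < B" "f (Suc a) (Suc b) = f (Suc a) h0"
        using cs f_z(3)[OF a bB] by (auto split: if_splits)
      then show ?thesis using inj[of "Suc b" h0] h0 Leftward by simp
    next
      case Rightward
      then have "b > 0" "f (Suc a) (b - 1) = f (Suc a) h0"
        using cs f_z(4)[OF a bB] by (auto split: if_splits)
      then show ?thesis using inj[of "b - 1" h0] h0 Rightward bB by simp
    qed
  qed (use moved in simp)
  show ?thesis unfolding o[OF bB, unfolded hd] qb tb by (simp only: row_label_def r1 prod.case)
qed

text \<open>A row that is not final passes \<open>Dimension k\<close> on to the next row, and there
  \<open>row_Suc\<close> determines the rest. The previous row enters because LC4 reaches the next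
  row through a condition that also mentions the labels of the predecessor.\<close>

lemma rows_forced:
  assumes "Dimension k \<in> out (h zero)" "a < d 1"
  shows "\<forall>b<B. out (f a b) = row_label M B k a b"
proof -
  have next_Dim: "Dimension k \<in> out (f (Suc a) b)"
    if "Suc a < d 1" "b < B" "out (f a b) = row_label M B k a b" "a > 0 \<Longrightarrow> out (f (a - 1) b) = row_label M B k (a - 1) b"
    for a b
  proof -
    have a: "a < d 1" using that(1) by simp
    have D: "Dimension k \<in> row_label M B k a' b'" for a' b' by (cases "lba_run M B a'") (simp add: row_label_def)
    obtain q0 tape0 h0 where r0: "lba_run M B a = (q0, tape0, h0)" by (cases "lba_run M B a") auto
    have nf: "q0 \<noteq> final M" using lba_run_not_final[of a M B] a d1 r0 by simp
    have z1: "z E L (f a b) [Next 1] = Some (f (Suc a) b)" using f_z(1)[OF a that(2)] that(1) by simp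
    have Da: "Dimension k \<in> out (f a b)" using that(3) D by simp
    show ?thesis
    proof (cases "a = 0")
      case True
      have "start M \<noteq> final M" using nf r0 True by (simp add: lba_run_def initial_config_def)
      then show ?thesis using LC4_at(1)[OF a that(2) Da True] z1 unfolding LC4_first_def by blast
    next
      case False
      obtain q1 tape1 h1 where r1: "lba_run M B (a - 1) = (q1, tape1, h1)" by (cases "lba_run M B (a - 1)") auto
      have "{State q0, Tape (tape0 b)} \<subseteq> out (f a b)" "{State q1, Tape (tape1 b)} \<subseteq> out (f (a - 1) b)"
        using that(3,4) False r0 r1 by (auto simp: row_label_def)
      from LC4_at(4)[OF a that(2) Da _ this] False have "LC4_next M E L out k (f a b) (f (a - 1) b) q0 (tape0 b) q1 (tape1 b)"
        by simp
      then show ?thesis using nf z1 unfolding LC4_next_def by blast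
    qed
  qed
  have D00: "Dimension k \<in> out (f 0 0)" using assms(1) zero_pt by simp
  have "\<forall>a'\<le>a. \<forall>b<B. out (f a' b) = row_label M B k a' b"
    using assms(2)
  proof (induction a)
    case 0
    then show ?case using row_0[OF D00] by simp
  next
    case (Suc a)
    then have IH: "\<forall>a'\<le>a. \<forall>b<B. out (f a' b) = row_label M B k a' b" by simp
    have "Dimension k \<in> out (f (Suc a) b)" if "b < B" for b
      by (rule next_Dim[OF Suc.prems that]) (use IH that in auto)
    then have "\<forall>b<B. out (f (Suc a) b) = row_label M B k (Suc a) b"
      using row_Suc[OF Suc.prems] IH by simp
    then show ?case using IH le_Suc_eq by auto
  qed
  then show ?thesis by simp
qed

end

end

section \<open>The lower bound\<close>

text \<open>A configuration contains a tape function on all numbers, so cells beyond the tape must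
  be known before configurations can be equated from their rows.\<close>

lemma lba_tape_outside:
  assumes "is_lba M" "B \<ge> 2" "lba_run M B t = (q, tape, h)" "p \<ge> B" shows "tape p = blank M"
  using assms(3)
proof (induction t arbitrary: q tape h)
  case 0
  then show ?case using assms(2,4) by (auto simp: lba_run_def initial_config_def)
next
  case (Suc t)
  obtain q' tape' h' where r: "lba_run M B t = (q', tape', h')" by (cases "lba_run M B t") auto
  have "h' < B" by (rule lba_head_bound[OF assms(1,2) r])
  then show ?case using Suc.prems Suc.IH[OF r] r assms(4)
    by (auto simp: lba_run_Suc split: if_splits prod.splits)
qed

lemma row_label_determines:
  assumes "is_lba M" "B \<ge> 2" "\<And>b. b < B \<Longrightarrow> row_label M B k a b = row_label M B k' a' b"
  shows "lba_run M B a = lba_run M B a'"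
proof -
  obtain q tape h where r: "lba_run M B a = (q, tape, h)" by (cases "lba_run M B a") auto
  obtain q' tape' h' where r': "lba_run M B a' = (q', tape', h')" by (cases "lba_run M B a'") auto
  have hh: "h < B" "h' < B" using lba_head_bound[OF assms(1,2)] r r' by blast+
  have eq: "{Dimension k, Tape (tape b), State q} \<union> (if b = h then {Head} else {}) =
      {Dimension k', Tape (tape' b), State q'} \<union> (if b = h' then {Head} else {})" if "b < B" for b
    using assms(3)[OF that] r r' by (simp add: row_label_def)
  have B0: "0 < B" using assms(2) by simp
  have "State q \<in> {Dimension k', Tape (tape' 0), State q'} \<union> (if 0 = h' then {Head} else {})"
    unfolding eq[OF B0, symmetric] by simp
  then have "q = q'" by (auto split: if_splits)
  moreover have "Head \<in> {Dimension k', Tape (tape' h), State q'} \<union> (if h = h' then {Head} else {})"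
    unfolding eq[OF hh(1), symmetric] by simp
  then have "h = h'" by (auto split: if_splits)
  moreover have "tape b = tape' b" for b
  proof (cases "b < B")
    case True
    have "Tape (tape b) \<in> {Dimension k', Tape (tape' b), State q'} \<union> (if b = h' then {Head} else {})"
      unfolding eq[OF True, symmetric] by simp
    then show ?thesis by (auto split: if_splits)
  next
    case False
    then show ?thesis using lba_tape_outside[OF assms(1,2)] r r' by (metis not_less)
  qed
  ultimately show ?thesis using r r' by auto
qed

text \<open>The machine is deterministic: a configuration that is its own successor persists for
  ever and would have to be final already.\<close>

lemma lba_run_no_repeat:
  assumes "is_lba M" "B \<ge> 2" "a < running_time M B" shows "lba_run M B (Suc a) \<noteq> lba_run M B a"
proof
  assume eq: "lba_run M B (Suc a) = lba_run M B a"
  have "lba_run M B (a + m) = lba_run M B a" for m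
    by (induction m) (use eq in \<open>auto simp: lba_run_Suc\<close>)
  then have "lba_run M B (running_time M B) = lba_run M B a"
    using assms(3) by (metis le_add_diff_inverse less_imp_le)
  then show False using lba_halts[OF assms(1,2)] lba_run_not_final[OF assms(3)] by simp
qed

lemma running_time_lower_bound:
  fixes M :: "('q::finite, 'g::finite) lba"
  assumes i2: "i \<ge> 2" and \<Delta>: "\<Delta> \<ge> 2 * i" and c: "c \<ge> 1" and lba: "is_lba M" and B: "B \<ge> 2"
    and T: "B \<le> running_time M B" and A: "solves \<Delta> c (Pi_problem i M) A t"
    and n: "n = B ^ (i - 1) * running_time M B"
  shows "running_time M B \<le> 2 * t n + 4"
proof (rule ccontr)
  assume "\<not> running_time M B \<le> 2 * t n + 4"
  then have far: "2 * t n + 4 < running_time M B" by simp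
  define d where "d j = (if j = 1 then running_time M B else B)" for j :: nat
  have "finite (PiE {1..i} (\<lambda>j. {..<d j}))" by (intro finite_PiE) auto
  then obtain h :: "(nat \<Rightarrow> nat) \<Rightarrow> nat"
    where h: "bij_betw h (PiE {1..i} (\<lambda>j. {..<d j})) {0..<card (PiE {1..i} (\<lambda>j. {..<d j}))}"
    using ex_bij_betw_finite_nat by blast
  have d2: "d j \<ge> 2" for j using B T by (simp add: d_def)
  interpret box i d h by unfold_locales (use i2 d2 h in \<open>auto simp: bij_betw_def\<close>)
  have dprod: "(\<Prod>j=1..i. d j) = n"
  proof -
    have "(\<Prod>j=1..i. d j) = d 1 * (\<Prod>j\<in>{2..i}. d j)"
      using i2 prod.atLeast_Suc_atMost[of 1 i d] by (simp add: numeral_2_eq_2)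
    also have "(\<Prod>j\<in>{2..i}. d j) = (\<Prod>j\<in>{2..i}. B)" by (intro prod.cong) (auto simp: d_def)
    finally show ?thesis using n by (simp add: d_def)
  qed
  have cardG: "card (h ` G) = n" using card_nodes dprod by simp
  have hG: "h ` G = {0..<n}"
    using h dprod unfolding bij_betw_def G_def by (simp add: card_PiE)
  have hlt: "h x < n" if "x \<in> G" for x
    using imageI[of x G h] that unfolding hG by simp
  have n0: "n > 0" using n B T by simp
  have nc: "n \<le> n ^ c" using power_increasing[OF c, of n] n0 by simp
  \<comment> \<open>The shift is cyclic, so that the identifiers in \<open>idf'\<close> are again
    distinct and in range. The seam is at the last row, outside the views compared.\<close>
  define up where "up x = x(1 := Suc (x 1) mod d 1)" for x :: "nat \<Rightarrow> nat"
  have one: "1 \<in> {1..i}" using i2 by simp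
  have up_G: "up x \<in> G" if "x \<in> G" for x
  proof -
    have "d 1 > 0" using B T by (simp add: d_def)
    then show ?thesis unfolding up_def by (intro G_upd[OF that one] mod_less_divisor)
  qed
  have up_inj: "x = y" if "x \<in> G" "y \<in> G" "up x = up y" for x y
  proof -
    have "Suc (x 1) mod d 1 = Suc (y 1) mod d 1" using fun_cong[OF that(3), of 1] unfolding up_def by simp
    moreover have "x 1 < d 1" "y 1 < d 1" using that G_less one by blast+
    ultimately have "x 1 = y 1" by (auto simp: mod_Suc split: if_splits)
    moreover have "x j = y j" if "j \<noteq> 1" for j
      using fun_cong[OF \<open>up x = up y\<close>, of j] that unfolding up_def by simp
    ultimately show ?thesis by (metis ext)
  qed
  have up_down: "up (down x) = x" if "x \<in> G" "x 1 > 0" for x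
    using G_less[OF that(1) one] that(2) by (auto simp: up_def down_def fun_eq_iff)
  define idf where "idf v = Suc v" for v
  define idf' where "idf' v = Suc (h (up (co v)))" for v
  have N: "is_network \<Delta> c (sides i) n (net idf)"
  proof (rule is_network_net)
    show "inj_on idf (h ` G)" by (rule inj_onI) (simp add: idf_def)
    show "idf (h x) \<in> {1..n ^ c}" if "x \<in> G" for x using hlt[OF that] nc by (simp add: idf_def)
    show "n = card (h ` G)" "2 * i \<le> \<Delta>" using cardG \<Delta> by simp_all
  qed
  have N': "is_network \<Delta> c (sides i) n (net idf')"
  proof (rule is_network_net)
    show "inj_on idf' (h ` G)"
    proof (rule inj_onI)
      fix v w assume "v \<in> h ` G" "w \<in> h ` G" and eq: "idf' v = idf' w"
      then obtain x y where xy: "x \<in> G" "y \<in> G" "v = h x" "w = h y" by blast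
      then have "h (up x) = h (up y)" using eq by (simp add: idf'_def)
      then have "up x = up y" using h_eq[OF up_G[OF xy(1)] up_G[OF xy(2)]] by blast
      then show "v = w" using up_inj[OF xy(1,2)] xy(3,4) by blast
    qed
    show "idf' (h x) \<in> {1..n ^ c}" if "x \<in> G" for x
      using hlt[OF up_G[OF that]] that nc by (simp add: idf'_def)
    show "n = card (h ` G)" "2 * i \<le> \<Delta>" using cardG \<Delta> by simp_all
  qed
  define out where "out idf v = the (decision A (state_after A (net idf) (t n) v))" for idf v
  have sol: "box_solution i d h M (out idf) B" if "is_network \<Delta> c (sides i) n (net idf)" for idf
  proof unfold_locales
    show "is_lba M" "B \<ge> 2" by fact+
    show "d k = B" if "k \<in> {2..i}" for k using that by (auto simp: d_def)
    show "d 1 = running_time M B" "B \<le> d 1" using T by (auto simp: d_def)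
    show "Pi_correct_at i M E L (out idf) (h x)" if x: "x \<in> G" for x
    proof -
      have "in_labels (Pi_problem i M) = sides i" by (simp add: Pi_problem_def)
      then have "correct (Pi_problem i M) (nodes (net idf)) (edges (net idf)) (label (net idf)) (out idf)"
        using A \<open>is_network \<Delta> c (sides i) n (net idf)\<close> unfolding solves_def out_def by metis
      then show ?thesis using x unfolding Pi_problem_def by (simp add: net_def)
    qed
  qed
  interpret S: box_solution i d h M "out idf" B by (rule sol[OF N])
  interpret S': box_solution i d h M "out idf'" B by (rule sol[OF N'])
  obtain k where k: "k \<in> {2..i}" "Dimension k \<in> out idf (h zero)" using S.origin_Dimension by blast
  obtain k' where k': "k' \<in> {2..i}" "Dimension k' \<in> out idf' (h zero)" using S'.origin_Dimension by blast
  \<comment> \<open>\<open>Suc r = t n + 2\<close> is the first row that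
    \<open>shifted_state\<close> admits; its upper margin, 2 * t n + 3 < d 1, follows from
    \<open>far\<close>.\<close>
  define r where "r = Suc (t n)"
  have r: "Suc r < d 1" "r < d 1" using far by (auto simp: r_def d_def)
  note row = S.rows_forced[OF k r(1), rule_format] and row' = S'.rows_forced[OF k' r(2), rule_format]
  have same: "out idf (h (S.pt k (Suc r) b)) = out idf' (h (S.pt k r b))" if "b < B" for b
  proof -
    have x: "S.pt k (Suc r) b \<in> G" by (rule S.pt_G[OF k(1) r(1) that])
    have dn: "down (S.pt k (Suc r) b) = S.pt k r b"
      unfolding down_def S.pt_simps(1)[OF k(1)] S.pt_upd(1)[OF k(1)] by simp
    have "state_after A (net idf) (t n) (h (S.pt k (Suc r) b)) = state_after A (net idf') (t n) (h (down (S.pt k (Suc r) b)))"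
    proof (rule shifted_state)
      show "idf (h x) = idf' (h (down x))" if "x \<in> G" "x 1 > 0" for x
        using that up_down down_G by (simp add: idf_def idf'_def)
      show "S.pt k (Suc r) b \<in> G" by (rule x)
      show "t n + 2 \<le> S.pt k (Suc r) b 1" "S.pt k (Suc r) b 1 + t n + 1 < d 1"
        unfolding S.pt_simps(1)[OF k(1)] using far by (auto simp: r_def d_def)
    qed
    then show ?thesis unfolding out_def dn by simp
  qed
  have B0: "0 < B" using B by simp
  \<comment> \<open>The outputs for the two identifier assignments might use different tape axes. In
    column 0 they label the same nodes, and the \<open>Dimension\<close> label there yields k =
    k'.\<close>
  have "S.pt k r 0 = S.pt k' r 0" using S.pt_00[OF k(1), of r] S.pt_00[OF k'(1), of r] by simp
  then have "row_label M B k (Suc r) 0 = row_label M B k' r 0"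
    using row[OF B0] row'[OF B0] same[OF B0] by simp
  moreover have "Dimension k \<in> row_label M B k (Suc r) 0"
    by (cases "lba_run M B (Suc r)") (simp add: row_label_def)
  ultimately have "k = k'" by (cases "lba_run M B r") (auto simp: row_label_def split: if_splits)
  then have "row_label M B k (Suc r) b = row_label M B k' r b" if "b < B" for b
    using row[OF that] row'[OF that] same[OF that] by simp
  then have "lba_run M B (Suc r) = lba_run M B r" by (rule row_label_determines[OF lba B])
  then show False using lba_run_no_repeat[OF lba B, of r] r(2) by (simp add: d_def)
qed

section \<open>The time complexity\<close>

lemma tape_size_spec:
  assumes T_ge: "\<And>B. B \<ge> 2 \<Longrightarrow> B \<le> running_time M B"
  shows "2 \<le> tape_size M i n" "n \<le> tape_size M i n ^ (i - 1) * running_time M (tape_size M i n)"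
    "2 \<le> b \<Longrightarrow> b < tape_size M i n \<Longrightarrow> b ^ (i - 1) * running_time M b < n"
proof -
  \<comment> \<open>As runs are at least as long as the tape, tape size max 2 n satisfies the
    condition, so a least one exists.\<close>
  have "max 2 n \<le> running_time M (max 2 n)" by (rule T_ge) simp
  moreover have "1 \<le> max 2 n ^ (i - 1)" by simp
  ultimately have "1 * max 2 n \<le> max 2 n ^ (i - 1) * running_time M (max 2 n)"
    by (rule mult_le_mono[rotated])
  then have "2 \<le> max 2 n \<and> n \<le> max 2 n ^ (i - 1) * running_time M (max 2 n)" by linarith
  then have "2 \<le> tape_size M i n \<and> n \<le> tape_size M i n ^ (i - 1) * running_time M (tape_size M i n)"
    unfolding tape_size_def by (rule LeastI[where P = "\<lambda>B. 2 \<le> B \<and> n \<le> B ^ (i - 1) * running_time M B"])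
  then show "2 \<le> tape_size M i n" "n \<le> tape_size M i n ^ (i - 1) * running_time M (tape_size M i n)" by auto
  show "b ^ (i - 1) * running_time M b < n" if "2 \<le> b" "b < tape_size M i n"
    using not_less_Least[of b "\<lambda>B. 2 \<le> B \<and> n \<le> B ^ (i - 1) * running_time M B"] that
    unfolding tape_size_def by simp
qed

text \<open>B^(i-1) * T_M(B) is strictly increasing in B, since i \<ge> 2 and T_M is monotone and
  positive. For these n nothing is lost by rounding, and they are the sizes of the hard
  boxes.\<close>

lemma tape_size_exact:
  assumes "i \<ge> 2" "\<And>B. B \<ge> 2 \<Longrightarrow> B \<le> running_time M B"
    and mono: "\<And>B1 B2. B2 \<ge> 2 \<Longrightarrow> B1 \<ge> B2 \<Longrightarrow> running_time M B1 \<ge> running_time M B2" and B: "B \<ge> 2"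
  shows "tape_size M i (B ^ (i - 1) * running_time M B) = B"
  unfolding tape_size_def
proof (rule Least_equality)
  show "B \<le> b" if "2 \<le> b \<and> B ^ (i - 1) * running_time M B \<le> b ^ (i - 1) * running_time M b" for b
  proof (rule ccontr)
    assume "\<not> B \<le> b"
    then have "b < B" by simp
    then have "b ^ (i - 1) < B ^ (i - 1)" using assms(1) by (intro power_strict_mono) auto
    moreover have "running_time M b \<le> running_time M B" using mono that \<open>b < B\<close> by simp
    moreover have "running_time M B > 0" using assms(2)[OF B] B by simp
    ultimately have "b ^ (i - 1) * running_time M b < B ^ (i - 1) * running_time M B"
      by (metis mult_le_mono2 mult_less_mono1 le_less_trans)
    then show False using that by simp
  qed
qed (use B in simp)

lemma not_smallo:
  fixes f g :: "nat \<Rightarrow> real"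
  assumes T_ge: "\<And>B. B \<ge> 2 \<Longrightarrow> B \<le> running_time M B"
    and f: "\<And>B. B \<ge> 2 \<Longrightarrow> real (running_time M B) \<le> 2 * f (B ^ (i - 1) * running_time M B) + 4"
    and g: "\<And>B. B \<ge> 2 \<Longrightarrow> g (B ^ (i - 1) * running_time M B) = real (running_time M B)"
  shows "f \<notin> o(g)"
proof
  assume "f \<in> o(g)"
  \<comment> \<open>With f \<le> T/8 the lower bound gives T \<le> T/4 + 4, impossible once T \<ge>
    8; this explains the 8 in \<open>B\<close> below.\<close>
  then have "eventually (\<lambda>n. norm (f n) \<le> (1 / 8) * norm (g n)) at_top"
    by (rule landau_o.smallD) simp
  then obtain n0 where n0: "\<And>n. n \<ge> n0 \<Longrightarrow> norm (f n) \<le> (1 / 8) * norm (g n)"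
    unfolding eventually_at_top_linorder by blast
  define B where "B = max 8 n0"
  define n where "n = B ^ (i - 1) * running_time M B"
  have B: "B \<ge> 2" by (simp add: B_def)
  have T: "B \<le> running_time M B" by (rule T_ge[OF B])
  have "1 * B \<le> n" unfolding n_def by (rule mult_le_mono) (use T B in auto)
  then have "n \<ge> n0" by (simp add: B_def)
  from n0[OF this] have "f n \<le> (1 / 8) * real (running_time M B)" using g[OF B] by (simp add: n_def)
  moreover have "real (running_time M B) \<le> 2 * f n + 4" using f[OF B] by (simp add: n_def)
  moreover have "real (running_time M B) \<ge> 8" using T by (simp add: B_def)
  ultimately show False by linarith
qed

lemma radius_bound: "R \<ge> 1 \<Longrightarrow> radius i R + 2 \<le> (2 * i + Suc i * (2 * i + 1) + 4) * R"
proof -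
  assume R: "R \<ge> 1"
  have 1: "i * Suc R \<le> 2 * i * R" using R by (cases R) auto
  have "(2 * i + 1) * R = 2 * i * R + R" by (simp add: algebra_simps)
  then have "Suc (i * Suc R) \<le> (2 * i + 1) * R" using 1 R by linarith
  then have 2: "Suc i * Suc (i * Suc R) \<le> Suc i * ((2 * i + 1) * R)" by (rule mult_le_mono2)
  have "radius i R + 2 \<le> 2 * i * R + Suc i * ((2 * i + 1) * R) + 4 * R"
    unfolding radius_def using 1 2 R by linarith
  also have "\<dots> = (2 * i + Suc i * (2 * i + 1) + 4) * R" by (simp add: algebra_simps)
  finally show ?thesis .
qed

theorem mainTheorem3:
  fixes M :: "('q::finite, 'g::finite) lba" and i \<Delta> c :: nat
  assumes "i \<ge> 2" and "\<Delta> \<ge> 2 * i" and "c \<ge> 1"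
    and "is_lba M"
    and "\<And>B. B \<ge> 2 \<Longrightarrow> B \<le> running_time M B"
    and "\<And>B1 B2. B2 \<ge> 2 \<Longrightarrow> B1 \<ge> B2 \<Longrightarrow> running_time M B1 \<ge> running_time M B2"
  shows "let B = tape_size M i;
             T = (\<lambda>n. real (running_time M (B n)));
             S = (\<lambda>n. real n / real (B n) ^ (i - 1));
             P = Pi_problem i M
         in (\<exists>\<tau>. is_time_complexity \<Delta> c P \<tau> \<and>
                  tight_bound (\<lambda>n. real (\<tau> n)) S \<and> tight_bound (\<lambda>n. real (\<tau> n)) T) \<and>
            tight_bound S T \<and>
            (\<exists>t. solvable_in \<Delta> c P t \<and> (\<lambda>n. real (t n)) \<in> O(T)) \<and>
            \<not> (\<exists>t. solvable_in \<Delta> c P t \<and> (\<lambda>n. real (t n)) \<in> o(T))"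
proof -
  note T_ge = assms(5) and T_mono = assms(6)
  define B where "B = tape_size M i"
  define T where "T n = real (running_time M (B n))" for n
  define S where "S n = real n / real (B n) ^ (i - 1)" for n
  define P where "P = Pi_problem i M"
  note B = tape_size_spec[where M = M and i = i, OF T_ge, folded B_def]
  \<comment> \<open>For \<open>B n = 2\<close> there is no smaller tape size, so the running-time
    term is 0.\<close>
  define R where "R n = B n + n div B n ^ (i - 1) + (if B n \<ge> 3 then running_time M (B n - 1) else 0) + 1" for n
  have room: "running_time M d < R n" if d: "d \<ge> 2" "Suc (R n) * d ^ (i - 1) \<le> n" for n d
  proof (cases "B n \<le> d")
    case True
    let ?X = "B n ^ (i - 1)"
    have X: "?X > 0" using B(1)[of n] by simp
    have "n < Suc (n div ?X) * ?X" using X by (metis dividend_less_div_times mult.commute mult_Suc_right add.commute)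
    also have "\<dots> \<le> Suc (R n) * d ^ (i - 1)"
      by (rule mult_le_mono) (use True in \<open>auto simp: R_def power_mono\<close>)
    finally show ?thesis using d(2) by simp
  next
    case False
    then have "B n \<ge> 3" "d \<le> B n - 1" using d(1) by auto
    then have "running_time M d \<le> running_time M (B n - 1)" using T_mono d(1) by simp
    then show ?thesis using \<open>B n \<ge> 3\<close> by (simp add: R_def)
  qed
  define t where "t n = radius i (R n) + 2" for n
  have t: "solvable_in \<Delta> c P t"
    unfolding t_def P_def
    by (rule solvable_in_radius[OF assms(1,4) T_ge _ room]) (simp_all add: R_def)
  \<comment> \<open>The price for replacing B - 1 by B in the minimality bound, from B \<le> 2 * (B
    - 1).\<close>
  define Q :: real where "Q = 2 ^ (i - 1)"
  have Q1: "Q \<ge> 1" by (simp add: Q_def)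
  have S_pos: "S n \<ge> 0" for n by (simp add: S_def)
  have TB: "real (running_time M (B n - 1)) \<le> Q * S n" if "B n \<ge> 3" for n
  proof -
    have "(B n - 1) ^ (i - 1) * running_time M (B n - 1) < n" by (rule B(3)) (use that in auto)
    then have lt: "real ((B n - 1) ^ (i - 1) * running_time M (B n - 1)) \<le> real n" by linarith
    have "real (B n) ^ (i - 1) \<le> (2 * real (B n - 1)) ^ (i - 1)"
      by (rule power_mono) (use that in auto)
    also have "\<dots> = Q * real ((B n - 1) ^ (i - 1))" by (simp add: Q_def power_mult_distrib)
    finally have "real (B n) ^ (i - 1) * real (running_time M (B n - 1)) \<le>
        Q * real ((B n - 1) ^ (i - 1)) * real (running_time M (B n - 1))"
      by (rule mult_right_mono) simp
    also have "\<dots> = Q * real ((B n - 1) ^ (i - 1) * running_time M (B n - 1))" by simp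
    also have "\<dots> \<le> Q * real n" by (rule mult_left_mono[OF lt]) (use Q1 in simp)
    finally show ?thesis unfolding S_def using B(1)[of n] by (simp add: field_simps)
  qed
  \<comment> \<open>A positive lower bound on \<open>S\<close>, so that additive constants can be
    absorbed.\<close>
  have QS1: "1 \<le> Q * S n" if "n \<ge> 1" for n
  proof (cases "B n \<ge> 3")
    case True
    then have "1 \<le> running_time M (B n - 1)" using T_ge[of "B n - 1"] by linarith
    then have "1 \<le> real (running_time M (B n - 1))" by linarith
    then show ?thesis using TB[OF True] by linarith
  next
    case False
    then have "B n = 2" using B(1)[of n] by simp
    then show ?thesis using that by (simp add: S_def Q_def)
  qed
  have BQ: "real (B n) \<le> 2 * (Q * S n)" if "n \<ge> 1" for n
  proof (cases "B n \<ge> 3")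
    case True
    then have "B n \<le> running_time M (B n - 1) + 1" using T_ge[of "B n - 1"] by linarith
    then show ?thesis using TB[OF True] QS1[OF that] by linarith
  next
    case False
    then have "B n = 2" using B(1)[of n] by simp
    then show ?thesis using QS1[OF that] by simp
  qed
  have RS: "real (R n) \<le> 5 * Q * S n" if "n \<ge> 1" for n
  proof -
    have "real (n div B n ^ (i - 1)) \<le> S n"
      using of_nat_div_le_of_nat[of n "B n ^ (i - 1)", where 'a = real] by (simp add: S_def)
    also have "\<dots> \<le> Q * S n" using mult_right_mono[OF Q1 S_pos[of n]] by simp
    finally have "real (n div B n ^ (i - 1)) \<le> Q * S n" .
    moreover have "real (if B n \<ge> 3 then running_time M (B n - 1) else 0) \<le> Q * S n"
      using TB[of n] QS1[OF that] by auto
    ultimately show ?thesis using BQ[OF that] QS1[OF that] unfolding R_def by simp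
  qed
  define C where "C = (2 * i + Suc i * (2 * i + 1) + 4)"
  have tS: "real (t n) \<le> (real C * (5 * Q)) * S n" if "n \<ge> 1" for n
  proof -
    have "t n \<le> C * R n" unfolding t_def C_def by (rule radius_bound) (simp add: R_def)
    then have "real (t n) \<le> real C * real (R n)" by (metis of_nat_le_iff of_nat_mult)
    also have "\<dots> \<le> real C * (5 * Q * S n)" by (rule mult_left_mono[OF RS[OF that]]) simp
    finally show ?thesis by simp
  qed
  have ST: "S n \<le> T n" for n
  proof -
    have "real n \<le> real (B n) ^ (i - 1) * T n"
      using B(2)[of n] unfolding T_def by (metis of_nat_le_iff of_nat_mult of_nat_power)
    then show ?thesis unfolding S_def using B(1)[of n] by (simp add: field_simps)
  qed
  have S_O_T: "S \<in> O(T)"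
  proof (rule landau_o.bigI[of 1])
    show "\<forall>\<^sub>F n in sequentially. norm (S n) \<le> 1 * norm (T n)"
      by (rule always_eventually) (use ST S_pos in \<open>auto intro: order_trans[OF _ abs_ge_self]\<close>)
  qed simp
  have O_S: "(\<lambda>n. real (f n)) \<in> O(S)" if "\<And>n. f n \<le> t n" for f
  proof (rule landau_o.bigI[of "real C * (5 * Q)"])
    show "\<forall>\<^sub>F n in sequentially. norm (real (f n)) \<le> (real C * (5 * Q)) * norm (S n)"
      using eventually_ge_at_top[of 1]
    proof eventually_elim
      case (elim n)
      have "real (f n) \<le> real (t n)" using that by simp
      then show ?case using tS[OF elim] S_pos[of n] by simp
    qed
    have "C > 0" by (simp add: C_def)
    then show "real C * (5 * Q) > 0" using Q1 by (intro mult_pos_pos) simp_all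
  qed
  have exact: "B (b ^ (i - 1) * running_time M b) = b" if "b \<ge> 2" for b
    unfolding B_def by (rule tape_size_exact[OF assms(1) T_ge T_mono that])
  have gT: "T (b ^ (i - 1) * running_time M b) = real (running_time M b)" if "b \<ge> 2" for b
    using exact[OF that] by (simp add: T_def)
  \<comment> \<open>At the sizes of the hard boxes \<open>S\<close> and \<open>T\<close> coincide,
    so one lower bound serves both.\<close>
  have gS: "S (b ^ (i - 1) * running_time M b) = real (running_time M b)" if "b \<ge> 2" for b
    using exact[OF that] that by (simp add: S_def)
  have low: "real (running_time M b) \<le> 2 * real (f (b ^ (i - 1) * running_time M b)) + 4"
    if f: "solvable_in \<Delta> c P f" and b: "b \<ge> 2" for f b
  proof -
    obtain A where "solves \<Delta> c (Pi_problem i M) A f" using f unfolding solvable_in_def P_def by blast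
    from running_time_lower_bound[OF assms(1-4) b T_ge[OF b] this refl] show ?thesis by linarith
  qed
  have nT: "(\<lambda>n. real (f n)) \<notin> o(T)" and nS: "(\<lambda>n. real (f n)) \<notin> o(S)" if "solvable_in \<Delta> c P f" for f
    using not_smallo[of M "\<lambda>n. real (f n)" i T, OF T_ge low[OF that] gT]
      not_smallo[of M "\<lambda>n. real (f n)" i S, OF T_ge low[OF that] gS] by auto
  \<comment> \<open>\<open>not_smallo\<close> is applied to \<open>S\<close> in the role of the time
    bound, to compare \<open>S\<close> with \<open>T\<close>.\<close>
  have lowS: "real (running_time M b) \<le> 2 * S (b ^ (i - 1) * running_time M b) + 4" if "b \<ge> 2" for b
    unfolding gS[OF that] by simp
  have "S \<notin> o(T)" by (rule not_smallo[of M S i T, OF T_ge lowS gT])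
  then have tb: "tight_bound S T" using S_O_T unfolding tight_bound_def by simp
  obtain \<tau> where \<tau>: "is_time_complexity \<Delta> c P \<tau>" using time_complexity_exists[OF t] by blast
  then have \<tau>_sol: "solvable_in \<Delta> c P \<tau>" and \<tau>_le: "\<tau> n \<le> t n" for n
    using t unfolding is_time_complexity_def by blast+
  have \<tau>S: "tight_bound (\<lambda>n. real (\<tau> n)) S"
    using O_S[OF \<tau>_le] nS[OF \<tau>_sol] unfolding tight_bound_def by simp
  have \<tau>T: "tight_bound (\<lambda>n. real (\<tau> n)) T"
    using landau_o.big_trans[OF O_S[OF \<tau>_le] S_O_T] nT[OF \<tau>_sol] unfolding tight_bound_def by simp
  have tT: "(\<lambda>n. real (t n)) \<in> O(T)" using landau_o.big_trans[OF O_S[OF order_refl] S_O_T] .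
  have "(\<exists>\<tau>. is_time_complexity \<Delta> c P \<tau> \<and>
                  tight_bound (\<lambda>n. real (\<tau> n)) S \<and> tight_bound (\<lambda>n. real (\<tau> n)) T) \<and>
            tight_bound S T \<and>
            (\<exists>t. solvable_in \<Delta> c P t \<and> (\<lambda>n. real (t n)) \<in> O(T)) \<and>
            \<not> (\<exists>t. solvable_in \<Delta> c P t \<and> (\<lambda>n. real (t n)) \<in> o(T))"
    using \<tau> \<tau>S \<tau>T tb t tT nT by blast
  then show ?thesis
    unfolding Let_def B_def[symmetric] T_def[symmetric, abs_def] S_def[symmetric, abs_def] P_def[symmetric] .
qed

end
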